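(* Let $d\ge 2$ and $(\mathbf a,\mathbf p)\in\Omega$. Suppose that $\mathbf a$ is $\beta$-Diophantine (with $\beta>0$), let $r=1+\left\langle\frac1\beta\right\rangle$, and let $R$ satisfy $r<2R<\frac1\beta+1$. Then $$\lim_{n\to\infty} n^R\left[\mathbb P_{\mathbf a,\mathbf p}\left(\frac{S_n}{\sigma\sqrt n}\le z\right)-\mathcal E_{r}(z)\right]=0$$ uniformly in $z\in\mathbb R$.
   Context: $\langle s\rangle$ denotes the largest integer which is strictly smaller than $s$. Fix an integer $d\ge2$. $\Omega$ is the set of pairs $(\mathbf a,\mathbf p)$, $\mathbf a=(a_1,\dots,a_{d+1})\in\mathbb R^{d+1}$, $\mathbf p=(p_1,\dots,p_{d+1})\in\mathbb R^{d+1}$, with $p_i>0$, $\sum_i p_i=1$, $\sum_i p_ia_i=0$. For $(\mathbf a,\mathbf p)\in\Omega$, $X$ is a random variable taking value $a_j$ with probability $p_j$, $\sigma^2$ is its variance, $S_n=X_1+\dots+X_n$ where the $X_j$ are i.i.d. copies of $X$, and $\mathbb P_{\mathbf a,\mathbf p}$ is the corresponding probability. Diophantine condition: let $b_j=a_j-a_1$ for $j=2,\dots,d+1$ and $d(s)=\max_{2\le j\le d+1}\mathrm{dist}(b_js,2\pi\mathbb Z)$. The vector $\mathbf a$ is $\beta$-Diophantine if there is a constant $K>0$ such that $d(s)\ge K|s|^{-\beta}$ for all $|s|>1$. Edgeworth series: $\mathfrak n(y)=\frac1{\sqrt{2\pi}}e^{-y^2/2}$, $\mathfrak N(z)=\int_{-\infty}^z\mathfrak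 n(y)\,dy$. The order $r$ Edgeworth series of $S_n$ is $\mathcal E_r(z)=\mathfrak N(z)+\mathfrak n(z)\sum_{k=1}^r n^{-k/2}P_k(z)$, where the $P_k$ are the polynomials (not depending on $n$) such that, with $\phi(t)=\mathbb E(e^{itX})$ and $\hat{\mathcal E}_r(t)=\int e^{itz}\,d\mathcal E_r(z)$, one has $\phi\left(\frac{t}{\sigma\sqrt n}\right)^n-\hat{\mathcal E}_r(t)=o(n^{-r/2})$ as $n\to\infty$ for each $t$. *)

theory Defs
  imports "HOL-Probability.Probability"
begin

definition below_floor :: "real \<Rightarrow> int" where
  "below_floor s = (GREATEST k::int. real_of_int k < s)"

lemma below_floor_eq: "below_floor s = \<lceil>s\<rceil> - 1"
  unfolding below_floor_def by (rule Greatest_equality) linarith+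

text \<open>
  Vectors in (d+1)-dimensional space are functions on the naturals of which only the values
  at indices 1, ..., d+1 are ever used.
\<close>

definition Omega :: "nat \<Rightarrow> ((nat \<Rightarrow> real) \<times> (nat \<Rightarrow> real)) set" where
  "Omega d = {(a, p). (\<forall>i\<in>{1..d+1}. p i > 0) \<and> (\<Sum>i=1..d+1. p i) = 1
     \<and> (\<Sum>i=1..d+1. p i * a i) = 0}"

text \<open>
  The law of the variable taking value a j with probability p j. The a j need not be
  distinct; the masses of equal values add up.
\<close>

definition step_law :: "nat \<Rightarrow> (nat \<Rightarrow> real) \<Rightarrow> (nat \<Rightarrow> real) \<Rightarrow> real measure" where
  "step_law d a p = distr (point_measure {1..d+1} (\<lambda>j. ennreal (p j))) borel a"

definition std_dev :: "real measure \<Rightarrow> real" where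
  "std_dev \<mu> = sqrt (prob_space.variance \<mu> (\<lambda>x. x))"

definition dist_lattice :: "nat \<Rightarrow> (nat \<Rightarrow> real) \<Rightarrow> real \<Rightarrow> real" where
  "dist_lattice d a s =
     Max ((\<lambda>j. infdist ((a j - a 1) * s) (range (\<lambda>k::int. 2 * pi * of_int k))) ` {2..d+1})"

definition diophantine :: "nat \<Rightarrow> real \<Rightarrow> (nat \<Rightarrow> real) \<Rightarrow> bool" where
  "diophantine d \<beta> a \<longleftrightarrow>
     (\<exists>K>0. \<forall>s. \<bar>s\<bar> > 1 \<longrightarrow> dist_lattice d a s \<ge> K * \<bar>s\<bar> powr (- \<beta>))"

definition normal_cdf :: "real \<Rightarrow> real" where
  "normal_cdf z = (LBINT y:{..z}. std_normal_density y)"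

definition edgeworth_sum :: "(nat \<Rightarrow> real poly) \<Rightarrow> nat \<Rightarrow> nat \<Rightarrow> real \<Rightarrow> real" where
  "edgeworth_sum P r n z = normal_cdf z
     + std_normal_density z * (\<Sum>k=1..r. real n powr (- real k / 2) * poly (P k) z)"

text \<open>
  Fourier--Stieltjes transform of a continuously differentiable function F of bounded
  variation, for which dF(z) = F'(z) dz. An Edgeworth sum is not monotone in general, so
  the library's Stieltjes measures of nondecreasing functions do not apply.
\<close>

definition fourier_stieltjes :: "(real \<Rightarrow> real) \<Rightarrow> real \<Rightarrow> complex" where
  "fourier_stieltjes F t = (CLBINT z. iexp (t * z) * complex_of_real (deriv F z))"

text \<open>
  The vanishing of P k outside 1, ..., r is only a normalization: those entries do not
  occur in the sum.
\<close>

definition is_edgeworth_polys :: "real measure \<Rightarrow> nat \<Rightarrow> (nat \<Rightarrow> real poly) \<Rightarrow> bool" where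
  "is_edgeworth_polys \<mu> r P \<longleftrightarrow>
     (\<forall>t. (\<lambda>n. char \<mu> (t / (std_dev \<mu> * sqrt (real n))) ^ n
              - fourier_stieltjes (edgeworth_sum P r n) t)
          \<in> o(\<lambda>n. complex_of_real (real n powr (- real r / 2))))
     \<and> (\<forall>k. k \<notin> {1..r} \<longrightarrow> P k = 0)"

text \<open>
  For a centred law of positive finite variance with moments of order r + 2 such polynomials
  exist and are unique: the o-condition determines the coefficient of each power of n, hence
  the Fourier transform of the derivative of the density times P k.
\<close>

definition edgeworth_polys :: "real measure \<Rightarrow> nat \<Rightarrow> nat \<Rightarrow> real poly" where
  "edgeworth_polys \<mu> r = (THE P. is_edgeworth_polys \<mu> r P)"

definition edgeworth :: "real measure \<Rightarrow> nat \<Rightarrow> nat \<Rightarrow> real \<Rightarrow> real" where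
  "edgeworth \<mu> r n z = edgeworth_sum (edgeworth_polys \<mu> r) r n z"

end

theory Submission
  imports Defs "HOL-Complex_Analysis.Complex_Analysis" "HOL-Real_Asymp.Real_Asymp"
begin

text \<open>
  Compare the distribution function of the normalized sum with its Edgeworth sum by Esseen's
  smoothing inequality with cutoff \<open>T = n\<^sup>\<rho>\<close>, where \<open>R < \<rho> < (1/\<beta> + 1)/2\<close>; the term \<open>O(1/T)\<close>
  of that inequality is then \<open>o(n\<^sup>-\<^sup>R)\<close>. For \<open>\<bar>t\<bar> \<le> c \<surd>n\<close> the Edgeworth expansion of the
  characteristic function has error \<open>O(n\<^sup>-\<^sup>(\<^sup>r\<^sup>+\<^sup>1\<^sup>)\<^sup>/\<^sup>2)\<close>, and \<open>r + 1 \<ge> 1/\<beta> + 1 > 2R\<close>. For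
  \<open>c \<surd>n \<le> \<bar>t\<bar> \<le> T\<close> the Diophantine condition gives \<open>\<bar>\<phi>(s)\<bar> \<le> 1 - c \<bar>s\<bar>\<^sup>-\<^sup>2\<^sup>\<beta>\<close> at
  \<open>s = t/(\<sigma>\<surd>n)\<close>, so the \<open>n\<close>-th power is at most \<open>exp (-c n\<^sup>\<gamma>)\<close> with
  \<open>\<gamma> = 1 - 2\<beta>(\<rho> - 1/2) > 0\<close>.

  The expansion near 0 comes from writing the moment generating function as
  \<open>\<psi>(z) = exp (z\<^sup>2/2 + z\<^sup>2 g(z))\<close>: then \<open>\<psi>(w/\<surd>n)\<^sup>n exp (-w\<^sup>2/2) = exp (w\<^sup>2 g(w/\<surd>n))\<close>, and Cauchy's
  estimates for \<open>z \<mapsto> exp (w\<^sup>2 g(z))\<close> with \<open>w\<close> fixed bound both the coefficients and the remainder.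
\<close>

section \<open>Esseen's smoothing inequality\<close>

text \<open>The Edgeworth polynomials are given only by a \<open>THE\<close>, so existence and
  uniqueness must be proved before \<open>edgeworth\<close> can be estimated at all. Both rest on
  one algebraic fact: the Fourier transform of the normal density times a polynomial q is c(w)
  exp(w^2/2) with w = i t, where multiplying c by w corresponds to q -> x q - q'. If v_k(w) denotes
  the k-th Taylor coefficient of z -> exp(w^2 g(z)), the order n^(-k/2) of the expansion is w^k
  v_k(w). The transform of the derivative of density times P_k carries a factor -w, so P_k is the
  preimage of -w^(k-1) v_k(w).

  Cauchy's estimates must hold for all w at once. The radius s of the circle is therefore chosen
  once, with |g| < 1/8 on it; each estimate then costs a factor exp(|w|^2/8), which the Gaussian
  exp(-t^2/2) absorbs, leaving exp(-3 t^2/8).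

  Esseen's integral has a singularity 1/|t| at 0. Every bound on a difference of transforms is
  therefore put in the form |t| B(t) with B integrable near 0.\<close>

text \<open>A weak form of Jordan's inequality. Up to pi/3 the difference has derivative cos y - 1/2
  >= 0; beyond pi/3 monotonicity gives sin x >= sqrt 3 / 2 >= 4/5, while x/2 <= pi/4 < 4/5.\<close>

lemma sin_ge_half: "x / 2 \<le> sin x" if "0 \<le> x" "x \<le> pi / 2" for x :: real
proof (cases "x \<le> pi / 3")
  case True
  have "(\<lambda>x. sin x - x / 2) 0 \<le> (\<lambda>x. sin x - x / 2) x"
  proof (rule DERIV_nonneg_imp_nondecreasing[OF that(1)])
    fix y assume y: "0 \<le> y" "y \<le> x"
    have "cos (pi / 3) \<le> cos y"
      using y True pi_gt_zero by (intro cos_monotone_0_pi_le) auto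
    then have "0 \<le> cos y - 1 / 2" by (simp add: cos_60)
    moreover have "((\<lambda>x. sin x - x / 2) has_real_derivative cos y - 1 / 2) (at y)"
      by (auto intro!: derivative_eq_intros)
    ultimately show "\<exists>D. ((\<lambda>x. sin x - x / 2) has_real_derivative D) (at y) \<and> 0 \<le> D" by blast
  qed
  then show ?thesis by simp
next
  case False
  have "x / 2 \<le> 4 / 5" using that pi_less_4 pi_approx by simp
  also have "8 / 5 \<le> sqrt 3" by (rule real_le_rsqrt) (simp add: power2_eq_square)
  then have "4 / 5 \<le> sqrt 3 / 2" by simp
  also have "\<dots> = sin (pi / 3)" by (simp add: sin_60)
  also have "\<dots> \<le> sin x"
    using that False pi_gt_zero by (intro sin_monotone_2pi_le) auto
  finally show ?thesis .
qed

text \<open>From 1 - cos y = 2 sin(y/2)^2 and the previous bound at |y|/2. It serves twice: for the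
  positive mass of the Fejer kernel and for the decay of the characteristic function.\<close>

lemma one_minus_cos_ge: "y\<^sup>2 / 8 \<le> 1 - cos y" if "\<bar>y\<bar> \<le> pi" for y :: real
proof -
  have "\<bar>y\<bar> / 2 / 2 \<le> sin (\<bar>y\<bar> / 2)" using that by (intro sin_ge_half) auto
  then have "(\<bar>y\<bar> / 4)\<^sup>2 \<le> (sin (\<bar>y\<bar> / 2))\<^sup>2" by (intro power_mono) auto
  moreover have "cos \<bar>y\<bar> = 1 - 2 * (sin (\<bar>y\<bar> / 2))\<^sup>2"
    using cos_double_sin[of "\<bar>y\<bar> / 2"] by simp
  ultimately show ?thesis by (simp add: power_divide)
qed

section \<open>The Fejer kernel\<close>

definition tent :: "real \<Rightarrow> real" where
  "tent t = max 0 (1 - \<bar>t\<bar>)"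

text \<open>This is (sin(v/2) / (v/2))^2, with its limit 1 at the origin. It is left unnormalized;
  the proof needs only that its integral is finite and positive.\<close>

definition fejer :: "real \<Rightarrow> real" where
  "fejer v = (if v = 0 then 1 else 2 * (1 - cos v) / v\<^sup>2)"

lemma borel_measurable_tent [measurable]: "tent \<in> borel_measurable borel"
  unfolding tent_def by measurable

lemma borel_measurable_fejer [measurable]: "fejer \<in> borel_measurable borel"
  unfolding fejer_def by measurable

lemma fejer_nonneg: "0 \<le> fejer v"
  by (simp add: fejer_def)

lemma fejer_minus [simp]: "fejer (- v) = fejer v"
  by (simp add: fejer_def)

lemma tent_eq_indicator: "tent t = indicator {-1..1} t *\<^sub>R (1 - \<bar>t\<bar>)"
  by (auto simp: tent_def indicator_def)

lemma integrable_tent: "integrable lborel tent"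
proof -
  have "set_integrable lborel {-1..1} (\<lambda>t::real. 1 - \<bar>t\<bar>)"
    by (intro borel_integrable_atLeastAtMost' continuous_intros)
  then show ?thesis
    unfolding set_integrable_def by (simp add: tent_eq_indicator[abs_def])
qed

text \<open>With l = -i v, explicit antiderivatives on the two halves of [-1,1] leave (exp l + exp
  (-l) - 2) / l^2. The compact support of \<open>tent\<close> is the point: smoothing with this
  kernel at scale 1/T sees only frequencies |s| <= T.\<close>

lemma fejer_eq_Fourier_tent:
  "complex_of_real (fejer v) = (CLBINT t. complex_of_real (tent t) * iexp (- (t * v)))"
proof -
  let ?u = "\<lambda>t::real. complex_of_real (1 - \<bar>t\<bar>) * iexp (- (t * v))"
  have "(?u has_integral complex_of_real (fejer v)) {-1..1}"
  proof (cases "v = 0")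
    case True
    have "((\<lambda>t::real. 1 + t) has_integral (0 + 0\<^sup>2 / 2) - (- 1 + (-1)\<^sup>2 / 2)) {-1..0}"
      by (rule fundamental_theorem_of_calculus)
         (auto intro!: derivative_eq_intros simp flip: has_real_derivative_iff_has_vector_derivative)
    then have "((\<lambda>t::real. 1 - \<bar>t\<bar>) has_integral 1 / 2) {-1..0}"
      by (rule has_integral_eq_rhs[OF has_integral_eq[rotated]]) auto
    moreover have "((\<lambda>t::real. 1 - t) has_integral (1 - 1\<^sup>2 / 2) - (0 - 0\<^sup>2 / 2)) {0..1}"
      by (rule fundamental_theorem_of_calculus)
         (auto intro!: derivative_eq_intros simp flip: has_real_derivative_iff_has_vector_derivative)
    then have "((\<lambda>t::real. 1 - \<bar>t\<bar>) has_integral 1 / 2) {0..1}"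
      by (rule has_integral_eq_rhs[OF has_integral_eq[rotated]]) auto
    ultimately have "((\<lambda>t::real. 1 - \<bar>t\<bar>) has_integral 1 / 2 + 1 / 2) {-1..1}"
      by (intro has_integral_combine[of "-1" 0 1]) auto
    from has_integral_of_real[OF this] show ?thesis
      using True by (simp add: fejer_def)
  next
    case False
    define l where "l = - \<i> * complex_of_real v"
    have l: "l \<noteq> 0" using False by (simp add: l_def)
    have u: "iexp (- (t * v)) = exp (l * of_real t)" for t by (simp add: l_def mult_ac)
    have D: "((\<lambda>t::real. exp (l * of_real t)) has_vector_derivative l * exp (l * of_real t)) (at t within S)" for t S
    proof -
      have "((\<lambda>z. exp (l * z)) has_field_derivative l * exp (l * of_real t)) (at (of_real t))"
        by (auto intro!: derivative_eq_intros)
      from has_vector_derivative_real_field[OF this] show ?thesis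
        by (rule has_vector_derivative_at_within)
    qed
    have 1: "((\<lambda>t. (1 + of_real t) * exp (l * of_real t)) has_integral
       ((1 + of_real 0) * exp (l * of_real 0) / l - exp (l * of_real 0) / l\<^sup>2)
       - ((1 + of_real (-1)) * exp (l * of_real (-1)) / l - exp (l * of_real (-1)) / l\<^sup>2)) {-1..0::real}"
    proof (rule fundamental_theorem_of_calculus)
      fix t :: real
      have "((\<lambda>t::real. (1 + complex_of_real t)) has_vector_derivative 1) (at t within {-1..0})"
        by (auto intro!: derivative_eq_intros)
      from has_vector_derivative_mult[OF this D]
      show "((\<lambda>t. (1 + of_real t) * exp (l * of_real t) / l - exp (l * of_real t) / l\<^sup>2) has_vector_derivative
         (1 + of_real t) * exp (l * of_real t)) (at t within {-1..0})"
        using l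
        by - (rule derivative_eq_intros D refl | assumption | simp add: field_simps power2_eq_square)+
    qed simp
    have 2: "((\<lambda>t. (1 - of_real t) * exp (l * of_real t)) has_integral
       ((1 - of_real 1) * exp (l * of_real 1) / l + exp (l * of_real 1) / l\<^sup>2)
       - ((1 - of_real 0) * exp (l * of_real 0) / l + exp (l * of_real 0) / l\<^sup>2)) {0..1::real}"
    proof (rule fundamental_theorem_of_calculus)
      fix t :: real
      have "((\<lambda>t::real. (1 - complex_of_real t)) has_vector_derivative - 1) (at t within {0..1})"
        by (auto intro!: derivative_eq_intros)
      from has_vector_derivative_mult[OF this D]
      show "((\<lambda>t. (1 - of_real t) * exp (l * of_real t) / l + exp (l * of_real t) / l\<^sup>2) has_vector_derivative
         (1 - of_real t) * exp (l * of_real t)) (at t within {0..1})"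
        using l
        by - (rule derivative_eq_intros D refl | assumption | simp add: field_simps power2_eq_square)+
    qed simp
    have u': "iexp (- (t * v)) = exp (l * of_real t)" "exp (- (\<i> * (complex_of_real t * complex_of_real v))) = exp (l * of_real t)" for t
      by (simp_all add: l_def mult_ac)
    have "(?u has_integral (1 / l - 1 / l\<^sup>2 + exp (- l) / l\<^sup>2)) {-1..0}"
      by (rule has_integral_eq_rhs[OF has_integral_eq[OF _ 1]]) (auto simp: u')
    moreover have "(?u has_integral (exp l / l\<^sup>2 - 1 / l - 1 / l\<^sup>2)) {0..1}"
      by (rule has_integral_eq_rhs[OF has_integral_eq[OF _ 2]]) (auto simp: u')
    ultimately have "(?u has_integral (1 / l - 1 / l\<^sup>2 + exp (- l) / l\<^sup>2) + (exp l / l\<^sup>2 - 1 / l - 1 / l\<^sup>2)) {-1..1}"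
      by (intro has_integral_combine[of "-1" 0 1]) auto
    moreover have "(1 / l - 1 / l\<^sup>2 + exp (- l) / l\<^sup>2) + (exp l / l\<^sup>2 - 1 / l - 1 / l\<^sup>2)
       = (exp l + exp (- l) - 2) / l\<^sup>2" using l by (simp add: field_simps)
    moreover have "exp l + exp (- l) = 2 * complex_of_real (cos v)"
      unfolding l_def using cos_exp_eq[of "complex_of_real v"] by (simp add: cos_of_real mult.commute[of _ 2] add.commute)
    moreover have "l\<^sup>2 = - complex_of_real (v\<^sup>2)" by (simp add: l_def power_mult_distrib)
    ultimately show ?thesis
      using False by (simp add: fejer_def minus_divide_right[symmetric] algebra_simps diff_divide_distrib)
  qed
  then have "integral {-1..1} ?u = complex_of_real (fejer v)" by (rule integral_unique)
  moreover have "set_integrable lborel {-1..1} ?u"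
    by (intro borel_integrable_atLeastAtMost' continuous_intros)
  ultimately have "(CLBINT t:{-1..1}. ?u t) = complex_of_real (fejer v)"
    by (simp add: set_borel_integral_eq_integral)
  then show ?thesis
    unfolding set_lebesgue_integral_def by (simp add: tent_eq_indicator scaleR_conv_of_real mult.assoc)
qed

lemma fejer_le_1: "fejer v \<le> 1"
proof -
  have "1 - cos v \<le> v\<^sup>2 / 2"
  proof -
    have "\<bar>sin (v / 2)\<bar> \<le> \<bar>v / 2\<bar>" by (rule abs_sin_x_le_abs_x)
    then have "(sin (v / 2))\<^sup>2 \<le> (v / 2)\<^sup>2" by (rule abs_le_square_iff[THEN iffD1])
    then show ?thesis using cos_double_sin[of "v / 2"] by (simp add: power_divide)
  qed
  then show ?thesis by (simp add: fejer_def divide_le_eq)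
qed

text \<open>The constant 5 adds up \<open>fejer v\<close> <= 1 and v^2 \<open>fejer v\<close> <=
  4.\<close>

lemma integrable_fejer: "integrable lborel fejer"
proof (rule Bochner_Integration.integrable_bound)
  show "integrable lborel (\<lambda>v::real. 5 * inverse (1 + v\<^sup>2))"
    using integrable_inverse_1_plus_square by (simp add: set_integrable_def)
  show "AE v in lborel. norm (fejer v) \<le> norm (5 * inverse (1 + v\<^sup>2))"
  proof (intro AE_I2)
    fix v :: real
    have "v\<^sup>2 * fejer v \<le> 4"
    proof (cases "v = 0")
      case False
      then show ?thesis by (simp add: fejer_def) (use cos_ge_minus_one[of v] in linarith)
    qed simp
    with fejer_le_1[of v] have "(1 + v\<^sup>2) * fejer v \<le> 5" by (simp add: algebra_simps)
    then have "fejer v \<le> 5 / (1 + v\<^sup>2)" by (simp add: pos_le_divide_eq add_pos_nonneg mult.commute)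
    then show "norm (fejer v) \<le> norm (5 * inverse (1 + v\<^sup>2))"
      using fejer_nonneg[of v] by (simp add: divide_inverse abs_mult)
  qed
qed simp

lemma integral_fejer_pos: "0 < (LBINT v. fejer v)"
proof -
  have "(LBINT v::real. indicator {0..1} v * (1/4::real)) \<le> (LBINT v. fejer v)"
  proof (rule Bochner_Integration.integral_mono)
    show "integrable lborel (\<lambda>v. fejer v)" by (rule integrable_fejer)
    show "indicator {0..1} v * (1 / 4) \<le> fejer v" for v
    proof (cases "v \<in> {0..1} \<and> v \<noteq> 0")
      case True
      then have "v\<^sup>2 / 8 \<le> 1 - cos v" using pi_gt3 by (intro one_minus_cos_ge) auto
      then show ?thesis using True by (simp add: fejer_def le_divide_eq)
    qed (auto simp: fejer_nonneg fejer_def split: split_indicator)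
  qed (simp add: integrable_real_mult_indicator)
  then show ?thesis by simp
qed

text \<open>Any fraction below 1/2 outside the window would make the later absorption argument work;
  one quarter turns the sup-norm into a third of itself.\<close>

lemma fejer_concentration:
  "\<exists>h\<ge>0. (LBINT v. fejer v * indicator (- {-h..h}) v) \<le> (LBINT v. fejer v) / 4"
proof -
  have "(\<lambda>n. LBINT v. fejer v * indicator (- {- real n..real n}) v) \<longlonglongrightarrow> (LBINT v::real. 0 :: real)"
  proof (rule integral_dominated_convergence[where w = fejer])
    show "AE v in lborel. (\<lambda>n. fejer v * indicator (- {- real n..real n}) v) \<longlonglongrightarrow> 0"
    proof (intro AE_I2 tendsto_eventually)
      fix v :: real
      show "\<forall>\<^sub>F n in sequentially. fejer v * indicator (- {- real n..real n}) v = 0"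
        using eventually_ge_at_top[of "nat \<lceil>\<bar>v\<bar>\<rceil>"]
        proof eventually_elim
          case (elim n)
          then have "\<bar>v\<bar> \<le> real n" by linarith
          then show ?case by (auto simp: indicator_def)
        qed
    qed
  qed (auto simp: fejer_nonneg integrable_fejer split: split_indicator)
  then have "\<forall>\<^sub>F n in sequentially. (LBINT v. fejer v * indicator (- {- real n..real n}) v) < (LBINT v. fejer v) / 4"
    using integral_fejer_pos by (intro order_tendstoD(2)[where y=0]) auto
  then obtain n where "(LBINT v. fejer v * indicator (- {- real n..real n}) v) < (LBINT v. fejer v) / 4"
    by (auto simp: eventually_sequentially)
  then show ?thesis by (intro exI[of _ "real n"]) auto
qed

text \<open>A product of integrable functions of separate variables is integrable on the product
  space, and a bounded kernel preserves this. All four interchanges in the smoothing identity have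
  this shape.\<close>

lemma Fubini_bounded_kernel:
  fixes g1 :: "'a \<Rightarrow> complex" and g2 :: "'b \<Rightarrow> complex"
  assumes "sigma_finite_measure M1" "sigma_finite_measure M2"
    and g1: "integrable M1 g1" and g2: "integrable M2 g2"
    and K: "(\<lambda>(x, y). K x y) \<in> borel_measurable (M1 \<Otimes>\<^sub>M M2)"
    and bound: "\<And>x y. norm (K x y) \<le> B"
  shows "(\<integral>x. g1 x * (\<integral>y. g2 y * K x y \<partial>M2) \<partial>M1) = (\<integral>y. g2 y * (\<integral>x. g1 x * K x y \<partial>M1) \<partial>M2)"
proof -
  interpret M1: sigma_finite_measure M1 by fact
  interpret M2: sigma_finite_measure M2 by fact
  interpret pair_sigma_finite M1 M2 ..
  have [measurable]: "g1 \<in> borel_measurable M1" "g2 \<in> borel_measurable M2"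
    using g1 g2 by auto
  note K[measurable]
  have "integrable (M1 \<Otimes>\<^sub>M M2) (\<lambda>(x, y). g1 x * g2 y)"
  proof (rule Fubini_integrable)
    show "integrable M1 (\<lambda>x. \<integral>y. norm (case (x, y) of (x, y) \<Rightarrow> g1 x * g2 y) \<partial>M2)"
      using g1 by (simp add: norm_mult integrable_norm)
    show "AE x in M1. integrable M2 (\<lambda>y. case (x, y) of (x, y) \<Rightarrow> g1 x * g2 y)"
      using g2 by simp
  qed measurable
  then have "integrable (M1 \<Otimes>\<^sub>M M2) (\<lambda>p. of_real B * (case p of (x, y) \<Rightarrow> g1 x * g2 y))"
    by (rule integrable_mult_right)
  then have int: "integrable (M1 \<Otimes>\<^sub>M M2) (\<lambda>(x, y). g1 x * g2 y * K x y)"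
  proof (rule Bochner_Integration.integrable_bound)
    show "AE p in M1 \<Otimes>\<^sub>M M2. norm (case p of (x, y) \<Rightarrow> g1 x * g2 y * K x y)
        \<le> norm (of_real B * (case p of (x, y) \<Rightarrow> g1 x * g2 y) :: complex)"
    proof (intro AE_I2)
      fix p :: "'a \<times> 'b"
      obtain x y where p: "p = (x, y)" by (cases p)
      have "norm (K x y) \<le> \<bar>B\<bar>" using bound[of x y] by linarith
      then have "norm (g1 x * g2 y) * norm (K x y) \<le> norm (g1 x * g2 y) * \<bar>B\<bar>"
        by (intro mult_left_mono) auto
      then show "norm (case p of (x, y) \<Rightarrow> g1 x * g2 y * K x y)
        \<le> norm (of_real B * (case p of (x, y) \<Rightarrow> g1 x * g2 y) :: complex)"
        by (simp add: p norm_mult mult_ac)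
    qed
  qed measurable
  have "(\<integral>x. g1 x * (\<integral>y. g2 y * K x y \<partial>M2) \<partial>M1) = (\<integral>x. (\<integral>y. g1 x * g2 y * K x y \<partial>M2) \<partial>M1)"
    by (simp add: mult.assoc)
  also have "\<dots> = (\<integral>y. (\<integral>x. g1 x * g2 y * K x y \<partial>M1) \<partial>M2)"
    using Fubini_integral[OF int] by simp
  also have "\<dots> = (\<integral>y. g2 y * (\<integral>x. g1 x * K x y \<partial>M1) \<partial>M2)"
    by (simp add: mult.assoc mult.left_commute[of _ "g2 _"])
  finally show ?thesis .
qed

definition cumulative :: "real measure \<Rightarrow> (real \<Rightarrow> real) \<Rightarrow> real \<Rightarrow> real" where
  "cumulative N f x = (LINT y|N. f y * indicator {..x} y)"

definition fourier :: "real measure \<Rightarrow> (real \<Rightarrow> real) \<Rightarrow> real \<Rightarrow> complex" where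
  "fourier N f s = (CLINT y|N. iexp (s * y) * complex_of_real (f y))"

text \<open>
  The signed measure \<open>f dN\<close> stands both for the law of a random variable (\<open>f = 1\<close>) and for the
  Edgeworth measure (\<open>N\<close> Lebesgue measure, \<open>f\<close> the density), which need not be positive.
\<close>

locale weighted_line =
  fixes N :: "real measure" and f :: "real \<Rightarrow> real"
  assumes sigma_finite: "sigma_finite_measure N" and sets_N [measurable_cong]: "sets N = sets borel"
    and integrable_f: "integrable N f"
begin

sublocale sigma_finite_measure N by (rule sigma_finite)

lemma borel_measurable_f [measurable]: "f \<in> borel_measurable borel"
  using borel_measurable_integrable[OF integrable_f] sets_N measurable_cong_sets by blast

lemma borel_measurable_cumulative [measurable]: "cumulative N f \<in> borel_measurable borel"
proof -
  have "(\<lambda>x. LINT y|N. f y * (if y \<le> x then 1 else 0)) \<in> borel_measurable borel"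
    by (rule borel_measurable_lebesgue_integral) measurable
  then show ?thesis by (simp add: cumulative_def[abs_def] indicator_def)
qed

lemma borel_measurable_fourier [measurable]: "fourier N f \<in> borel_measurable borel"
  unfolding fourier_def[abs_def] by (rule borel_measurable_lebesgue_integral) measurable

lemma integrable_f_indicator: "A \<in> sets borel \<Longrightarrow> integrable N (\<lambda>y. f y * indicator A y)"
  using integrable_mult_indicator[of A N f] integrable_f sets_N by (simp add: mult.commute)

lemma abs_cumulative_le: "\<bar>cumulative N f x\<bar> \<le> (LINT y|N. \<bar>f y\<bar>)"
proof -
  have "\<bar>cumulative N f x\<bar> \<le> (LINT y|N. \<bar>f y * indicator {..x} y\<bar>)"
    unfolding cumulative_def by (rule integral_abs_bound)
  also have "\<dots> \<le> (LINT y|N. \<bar>f y\<bar>)"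
  proof (rule Bochner_Integration.integral_mono)
    show "integrable N (\<lambda>y. \<bar>f y * indicator {..x} y\<bar>)"
      by (intro integrable_abs integrable_f_indicator) simp
  qed (auto simp: integrable_f split: split_indicator)
  finally show ?thesis .
qed

text \<open>Used to remove the left endpoint from the smoothing identity, which is first proved for
  increments.\<close>

lemma cumulative_at_bot: "(\<lambda>n. cumulative N f (c - real n)) \<longlonglongrightarrow> 0"
proof -
  have "(\<lambda>n. LINT y|N. f y * indicator {..c - real n} y) \<longlonglongrightarrow> (LINT y|N. 0)"
  proof (rule integral_dominated_convergence[where w = "\<lambda>y. \<bar>f y\<bar>"])
    show "AE y in N. (\<lambda>n. f y * indicator {..c - real n} y) \<longlonglongrightarrow> 0"
    proof (intro AE_I2 tendsto_eventually)
      fix y :: real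
      show "\<forall>\<^sub>F n in sequentially. f y * indicator {..c - real n} y = 0"
        using eventually_gt_at_top[of "nat \<lceil>c - y\<rceil>"]
      proof eventually_elim
        case (elim n)
        then have "c - y < real n" by linarith
        then show ?case by (auto simp: indicator_def)
      qed
    qed
  qed (use integrable_f in \<open>auto split: split_indicator\<close>)
  then show ?thesis by (simp add: cumulative_def)
qed

lemma norm_fourier_le: "norm (fourier N f s) \<le> (LINT y|N. \<bar>f y\<bar>)"
proof -
  have "norm (fourier N f s) \<le> (LINT y|N. norm (iexp (s * y) * complex_of_real (f y)))"
    unfolding fourier_def by (rule integral_norm_bound)
  then show ?thesis by (simp add: norm_mult)
qed

text \<open>Parseval's identity for an increment of the smoothed distribution function. The
  increment is essential: it turns the half-line into a bounded interval, whose indicator is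
  integrable, so that Fubini applies.\<close>

lemma fejer_smoothing_identity:
  assumes "T > 0" "a \<le> b"
  shows "complex_of_real (LBINT v. fejer v * (cumulative N f (b - v / T) - cumulative N f (a - v / T))) =
    (CLBINT t. complex_of_real (tent t) * (fourier N f (T * t) *
       (CLBINT v. complex_of_real (indicator {T * a<..T * b} v) * iexp (- (t * v)))))"
proof -
  let ?I = "\<lambda>v. indicator {T * a<..T * b} v :: real"
  let ?c = complex_of_real
  have fejer: "integrable lborel (\<lambda>v. ?c (fejer v))"
    using integrable_fejer by (rule integrable_of_real)
  have fint: "integrable N (\<lambda>y. ?c (f y))" using integrable_f by (rule integrable_of_real)
  have I: "integrable lborel (\<lambda>v. ?c (?I v))" 
    using assms by (intro integrable_of_real) simp
  have tri: "integrable lborel (\<lambda>t. ?c (tent t))"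
    using integrable_tent by (rule integrable_of_real)
  have K: "(\<lambda>(v, y). ?c (?I (v + T * y))) \<in> borel_measurable (lborel \<Otimes>\<^sub>M N)"
  proof -
    have "(\<lambda>p. fst p + T * snd p) \<in> borel_measurable (lborel \<Otimes>\<^sub>M N)" by measurable
    moreover have "(\<lambda>s. ?c (?I s)) \<in> borel_measurable borel" by measurable
    ultimately have "(\<lambda>p. ?c (?I (fst p + T * snd p))) \<in> borel_measurable (lborel \<Otimes>\<^sub>M N)"
      by (rule measurable_compose)
    then show ?thesis by (simp add: case_prod_beta')
  qed
  have "?c (LBINT v. fejer v * (cumulative N f (b - v / T) - cumulative N f (a - v / T)))
     = (CLBINT v. ?c (fejer v) * (CLINT y|N. ?c (f y) * ?c (?I (v + T * y))))"
  proof -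
    have "cumulative N f (b - v / T) - cumulative N f (a - v / T) = (LINT y|N. f y * ?I (v + T * y))" for v
    proof -
      have "cumulative N f (b - v / T) - cumulative N f (a - v / T)
        = (LINT y|N. f y * indicator {..b - v / T} y - f y * indicator {..a - v / T} y)"
        unfolding cumulative_def
        by (intro Bochner_Integration.integral_diff[symmetric] integrable_f_indicator) auto
      also have "\<dots> = (LINT y|N. f y * ?I (v + T * y))"
      proof (intro Bochner_Integration.integral_cong refl)
        fix y
        have *: "y \<le> c - v / T \<longleftrightarrow> v + T * y \<le> T * c" for c
          using \<open>T > 0\<close> by (simp add: field_simps)
        have "T * a \<le> T * b" using assms by simp
        then show "f y * indicator {..b - v / T} y - f y * indicator {..a - v / T} y = f y * ?I (v + T * y)"
          by (auto simp: indicator_def *)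
      qed
      finally show ?thesis .
    qed
    then show ?thesis by (simp flip: integral_complex_of_real)
  qed
  also have "\<dots> = (CLINT y|N. ?c (f y) * (CLBINT v. ?c (fejer v) * ?c (?I (v + T * y))))"
    by (rule Fubini_bounded_kernel[where B=1, OF lborel.sigma_finite_measure_axioms sigma_finite_measure_axioms fejer fint])
       (use K in \<open>auto split: split_indicator\<close>)
  also have "\<dots> = (CLINT y|N. ?c (f y) * (CLBINT v. ?c (?I v) * ?c (fejer (v - T * y))))"
  proof (rule Bochner_Integration.integral_cong[OF refl], rule arg_cong2[where f="(*)", OF refl])
    fix y
    show "(CLBINT v. ?c (fejer v) * ?c (?I (v + T * y))) = (CLBINT v. ?c (?I v) * ?c (fejer (v - T * y)))"
      by (subst lborel_integral_real_affine[where c=1 and t="- T * y"]) (auto simp: mult.commute)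
  qed
  also have "\<dots> = (CLBINT v. ?c (?I v) * (CLINT y|N. ?c (f y) * ?c (fejer (v - T * y))))"
    by (rule Fubini_bounded_kernel[where B=1, OF sigma_finite_measure_axioms lborel.sigma_finite_measure_axioms fint I])
       (measurable, use fejer_nonneg fejer_le_1 in \<open>auto simp: abs_le_iff\<close>)
  also have "\<dots> = (CLBINT v. ?c (?I v) * (CLBINT t. ?c (tent t) * fourier N f (T * t) * iexp (- (t * v))))"
  proof (rule Bochner_Integration.integral_cong[OF refl], rule arg_cong2[where f="(*)", OF refl])
    fix v
    have "(CLINT y|N. ?c (f y) * ?c (fejer (v - T * y))) =
        (CLINT y|N. ?c (f y) * (CLBINT t. ?c (tent t) * iexp (- (t * (v - T * y)))))"
      by (simp add: fejer_eq_Fourier_tent)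
    also have "\<dots> = (CLBINT t. ?c (tent t) * (CLINT y|N. ?c (f y) * iexp (- (t * (v - T * y)))))"
    proof (rule Fubini_bounded_kernel[where B=1, OF sigma_finite_measure_axioms lborel.sigma_finite_measure_axioms fint tri])
      show "(\<lambda>(y, t). iexp (- (t * (v - T * y)))) \<in> borel_measurable (N \<Otimes>\<^sub>M lborel)" by measurable
      show "norm (iexp (- (t * (v - T * y)))) \<le> 1" for t y by (simp only: norm_exp_i_times order_refl)
    qed
    also have "\<dots> = (CLBINT t. ?c (tent t) * fourier N f (T * t) * iexp (- (t * v)))"
    proof (intro Bochner_Integration.integral_cong refl)
      fix t
      have "(CLINT y|N. ?c (f y) * iexp (- (t * (v - T * y)))) =
        (CLINT y|N. iexp (- (t * v)) * (iexp (T * t * y) * ?c (f y)))"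
        by (intro Bochner_Integration.integral_cong refl)
           (simp add: exp_add[symmetric] algebra_simps mult.left_commute[of "exp _"])
      then show "?c (tent t) * (CLINT y|N. ?c (f y) * iexp (- (t * (v - T * y)))) =
          ?c (tent t) * fourier N f (T * t) * iexp (- (t * v))"
        by (simp add: fourier_def)
    qed
    finally show "(CLINT y|N. ?c (f y) * ?c (fejer (v - T * y))) =
      (CLBINT t. ?c (tent t) * fourier N f (T * t) * iexp (- (t * v)))" .
  qed
  also have "\<dots> = (CLBINT t. ?c (tent t) * fourier N f (T * t) * (CLBINT v. ?c (?I v) * iexp (- (t * v))))"
  proof (rule Fubini_bounded_kernel[where B=1])
    show "integrable lborel (\<lambda>t. ?c (tent t) * fourier N f (T * t))"
    proof (rule Bochner_Integration.integrable_bound)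
      show "integrable lborel (\<lambda>t. ?c (tent t) * ?c (LINT y|N. \<bar>f y\<bar>))"
        using tri by simp
      show "AE t in lborel. norm (?c (tent t) * fourier N f (T * t)) \<le>
          norm (?c (tent t) * ?c (LINT y|N. \<bar>f y\<bar>))"
        unfolding norm_mult using norm_fourier_le
        by (intro AE_I2 mult_left_mono) (auto intro: order_trans[OF _ abs_ge_self])
    qed measurable
    show "(\<lambda>(v, t). iexp (- (t * v))) \<in> borel_measurable (lborel \<Otimes>\<^sub>M lborel)" by measurable
    show "norm (iexp (- (t * v))) \<le> 1" for t v by (simp only: norm_exp_i_times order_refl)
  qed (use I in \<open>auto simp: lborel.sigma_finite_measure_axioms\<close>)
  finally show ?thesis by (simp add: mult.assoc)
qed

end

text \<open>The bound does not depend on the length of the interval, so it survives sending the left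
  endpoint to minus infinity. Its singularity at t = 0 is the 1/|t| of Esseen's inequality.\<close>

lemma norm_integral_iexp_le:
  "norm (CLBINT v. complex_of_real (indicator {a<..b} v) * iexp (- (t * v))) \<le> 2 / \<bar>t\<bar>"
  if "t \<noteq> 0" "a \<le> b" for a b t :: real
proof -
  define l where "l = - \<i> * complex_of_real t"
  have l: "l \<noteq> 0" using that by (simp add: l_def)
  have u: "iexp (- (t * v)) = exp (l * of_real v)" for v by (simp add: l_def mult_ac)
  have D: "((\<lambda>v::real. exp (l * of_real v) / l) has_vector_derivative exp (l * of_real v)) (at v within S)" for v S
  proof -
    have "((\<lambda>z. exp (l * z) / l) has_field_derivative exp (l * of_real v)) (at (of_real v))"
      using l by (auto intro!: derivative_eq_intros)
    from has_vector_derivative_real_field[OF this] show ?thesis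
      by (rule has_vector_derivative_at_within)
  qed
  have "(CLBINT v. complex_of_real (indicator {a<..b} v) * iexp (- (t * v))) =
     (CLBINT v. indicator {a..b} v *\<^sub>R exp (l * of_real v))"
    unfolding u
  proof (rule integral_cong_AE)
    show "AE v in lborel. complex_of_real (indicator {a<..b} v) * exp (l * of_real v) =
        indicator {a..b} v *\<^sub>R exp (l * of_real v)"
      using AE_lborel_singleton[of a] by eventually_elim (auto simp: indicator_def)
  qed measurable
  also have "\<dots> = exp (l * of_real b) / l - exp (l * of_real a) / l"
    by (rule integral_FTC_Icc[OF that(2)]) (auto intro!: D continuous_intros)
  also have "norm \<dots> \<le> norm (exp (l * of_real b) / l) + norm (exp (l * of_real a) / l)"
    by (rule norm_triangle_ineq4)
  also have "\<dots> = 2 / \<bar>t\<bar>"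
    unfolding u[symmetric] by (simp add: norm_divide l_def norm_mult flip: u)
  finally show ?thesis .
qed

text \<open>The factor |s| assumed in the bound on the transforms cancels the factor 2/|t| from the
  interval, since s = T t; what is left is the integral of B.\<close>

lemma fejer_smoothing_bound:
  fixes B :: "real \<Rightarrow> real"
  assumes "weighted_line N1 f1" "weighted_line N2 f2" and T: "T > 0"
    and B: "\<And>s. \<bar>s\<bar> \<le> T \<Longrightarrow> norm (fourier N1 f1 s - fourier N2 f2 s) \<le> \<bar>s\<bar> * B s"
    and B_nonneg: "\<And>s. 0 \<le> B s" and B_int: "set_integrable lborel {-T..T} B"
  shows "\<bar>LBINT v. fejer v * (cumulative N1 f1 (b - v / T) - cumulative N2 f2 (b - v / T))\<bar>
    \<le> 2 * (LBINT s:{-T..T}. B s)"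
proof -
  interpret W1: weighted_line N1 f1 by fact
  interpret W2: weighted_line N2 f2 by fact
  let ?c = complex_of_real
  define D where "D = (\<lambda>x. cumulative N1 f1 x - cumulative N2 f2 x)"
  define F where "F = (\<lambda>t. fourier N1 f1 (T * t) - fourier N2 f2 (T * t))"
  have [measurable]: "D \<in> borel_measurable borel" "F \<in> borel_measurable borel"
    unfolding D_def F_def by measurable
  define C where "C = (LINT y|N1. \<bar>f1 y\<bar>) + (LINT y|N2. \<bar>f2 y\<bar>)"
  have D_le: "\<bar>D x\<bar> \<le> C" for x
    using W1.abs_cumulative_le[of x] W2.abs_cumulative_le[of x] by (simp add: D_def C_def)
  have C: "0 \<le> C" using D_le[of 0] by linarith
  have fejer_mult: "integrable lborel (\<lambda>v. fejer v * g v)"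
    if [measurable]: "g \<in> borel_measurable borel" and "\<And>x. \<bar>g x\<bar> \<le> K" for g :: "real \<Rightarrow> real" and K
  proof (rule Bochner_Integration.integrable_bound)
    show "integrable lborel (\<lambda>v. fejer v * K)" using integrable_fejer by simp
    show "AE v in lborel. norm (fejer v * g v) \<le> norm (fejer v * K)"
      using that(2) fejer_nonneg by (auto simp: abs_mult intro!: mult_left_mono order_trans[OF that(2) abs_ge_self])
  qed measurable
  define E where "E = (\<lambda>a t. CLBINT v. ?c (indicator {T * a<..T * b} v) * iexp (- (t * v)))"
  have bound: "\<bar>LBINT v. fejer v * (D (b - v / T) - D (a - v / T))\<bar> \<le> 2 * (LBINT s:{-T..T}. B s)"
    if "a \<le> b" for a
  proof -
    have tri_int: "integrable lborel (\<lambda>t. ?c (tent t) * (fourier N f (T * t) * E a t))"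
      if "weighted_line N f" for N f
    proof -
      interpret weighted_line N f by fact
      have [measurable]: "(\<lambda>t. E a t) \<in> borel_measurable borel"
        unfolding E_def by (rule lborel.borel_measurable_lebesgue_integral) measurable
      have E_le: "norm (E a t) \<le> T * b - T * a" for t
      proof -
        have "norm (E a t) \<le> (LBINT v. norm (?c (indicator {T * a<..T * b} v) * iexp (- (t * v))))"
          unfolding E_def by (rule integral_norm_bound)
        also have "\<dots> = (LBINT v. indicator {T * a<..T * b} v)"
          by (intro Bochner_Integration.integral_cong) (auto simp: norm_mult)
        finally show ?thesis using T \<open>a \<le> b\<close> by simp
      qed
      show ?thesis
      proof (rule Bochner_Integration.integrable_bound)
        show "integrable lborel (\<lambda>t. tent t * ((LINT y|N. \<bar>f y\<bar>) * (T * b - T * a)))"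
          using integrable_tent by simp
        show "AE t in lborel. norm (?c (tent t) * (fourier N f (T * t) * E a t)) \<le>
          norm (tent t * ((LINT y|N. \<bar>f y\<bar>) * (T * b - T * a)))"
        proof (intro AE_I2)
          fix t
          have "norm (fourier N f (T * t)) * norm (E a t) \<le> (LINT y|N. \<bar>f y\<bar>) * (T * b - T * a)"
            by (intro mult_mono norm_fourier_le E_le order_trans[OF norm_ge_zero norm_fourier_le]) auto
          then show "norm (?c (tent t) * (fourier N f (T * t) * E a t)) \<le>
            norm (tent t * ((LINT y|N. \<bar>f y\<bar>) * (T * b - T * a)))"
            unfolding norm_mult norm_of_real real_norm_def[of "tent t"]
            by (intro mult_left_mono) (use T \<open>a \<le> b\<close> in auto)
        qed
      qed measurable
    qed
    have E: "E a t = (CLBINT v. ?c (indicator {T * a<..T * b} v) * iexp (- (t * v)))" for t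
      by (simp add: E_def)
    have split: "(LBINT v. fejer v * (D (b - v / T) - D (a - v / T))) =
       (LBINT v. fejer v * (cumulative N1 f1 (b - v / T) - cumulative N1 f1 (a - v / T))) -
       (LBINT v. fejer v * (cumulative N2 f2 (b - v / T) - cumulative N2 f2 (a - v / T)))"
    proof (subst Bochner_Integration.integral_diff[symmetric])
      show "integrable lborel (\<lambda>v. fejer v * (cumulative N1 f1 (b - v / T) - cumulative N1 f1 (a - v / T)))"
        by (rule fejer_mult[where K="2 * (LINT y|N1. \<bar>f1 y\<bar>)"])
           (measurable, smt (verit) W1.abs_cumulative_le)
      show "integrable lborel (\<lambda>v. fejer v * (cumulative N2 f2 (b - v / T) - cumulative N2 f2 (a - v / T)))"
        by (rule fejer_mult[where K="2 * (LINT y|N2. \<bar>f2 y\<bar>)"])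
           (measurable, smt (verit) W2.abs_cumulative_le)
    qed (simp add: D_def algebra_simps)
    have "?c (LBINT v. fejer v * (D (b - v / T) - D (a - v / T))) = (CLBINT t. ?c (tent t) * (F t * E a t))"
      unfolding split of_real_diff W1.fejer_smoothing_identity[OF T \<open>a \<le> b\<close>]
        W2.fejer_smoothing_identity[OF T \<open>a \<le> b\<close>] E[symmetric]
      by (subst Bochner_Integration.integral_diff[symmetric, OF tri_int[OF assms(1)] tri_int[OF assms(2)]])
         (simp add: F_def algebra_simps)
    from arg_cong[OF this, of norm]
    have "\<bar>LBINT v. fejer v * (D (b - v / T) - D (a - v / T))\<bar> =
        norm (CLBINT t. ?c (tent t) * (F t * E a t))"
      unfolding norm_of_real .
    \<comment> \<open>The majorant is written with 0 + T * t and the factor |T| so that it literally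
      matches the affine change of variables s = T t below.\<close>
    also have "\<dots> \<le> (LBINT t. \<bar>T\<bar> *\<^sub>R (2 * (indicator {-T..T} (0 + T * t) *\<^sub>R B (0 + T * t))))"
    proof (rule Bochner_Integration.integral_norm_bound_integral)
      show "integrable lborel (\<lambda>t. ?c (tent t) * (F t * E a t))"
        using Bochner_Integration.integrable_diff[OF tri_int[OF assms(1)] tri_int[OF assms(2)]]
        by (simp add: F_def algebra_simps)
      show "integrable lborel (\<lambda>t. \<bar>T\<bar> *\<^sub>R (2 * (indicator {-T..T} (0 + T * t) *\<^sub>R B (0 + T * t))))"
        using T B_int unfolding set_integrable_def
        by (intro integrable_scaleR_right integrable_mult_right lborel_integrable_real_affine) auto
      fix t :: real
      show "norm (?c (tent t) * (F t * E a t)) \<le> \<bar>T\<bar> *\<^sub>R (2 * (indicator {-T..T} (0 + T * t) *\<^sub>R B (0 + T * t)))"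
      proof (cases "\<bar>t\<bar> \<le> 1")
        case False
        then have "tent t = 0" by (simp add: tent_def)
        then show ?thesis using T B_nonneg[of "T * t"] by simp
      next
        case True
        then have Tt: "\<bar>T * t\<bar> \<le> T" using T by (simp add: abs_mult)
        have F: "norm (F t) \<le> T * \<bar>t\<bar> * B (T * t)"
          using B[OF Tt] T by (simp add: F_def abs_mult)
        have FE: "norm (F t) * norm (E a t) \<le> T * (2 * B (T * t))"
        proof (cases "t = 0")
          case True
          then show ?thesis using F T B_nonneg[of 0] by simp
        next
          case False
          then have "norm (E a t) \<le> 2 / \<bar>t\<bar>"
            unfolding E_def using T \<open>a \<le> b\<close> by (intro norm_integral_iexp_le) auto
          then have "norm (F t) * norm (E a t) \<le> (T * \<bar>t\<bar> * B (T * t)) * (2 / \<bar>t\<bar>)"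
            using F T B_nonneg[of "T * t"] by (intro mult_mono) auto
          then show ?thesis using False by simp
        qed
        have "norm (?c (tent t) * (F t * E a t)) = tent t * (norm (F t) * norm (E a t))"
          by (simp add: norm_mult tent_def)
        also have "\<dots> \<le> 1 * (T * (2 * B (T * t)))"
          by (rule mult_mono[OF _ FE]) (auto simp: tent_def)
        finally show ?thesis using T Tt by (auto simp: abs_le_iff)
      qed
    qed
    also have "\<dots> = \<bar>T\<bar> *\<^sub>R (LBINT t. 2 * (indicator {-T..T} (0 + T * t) *\<^sub>R B (0 + T * t)))"
      by (rule integral_scaleR_right)
    also have "\<dots> = (LBINT s. 2 * (indicator {-T..T} s *\<^sub>R B s))"
      using T by (intro lborel_integral_real_affine[symmetric]) simp
    also have "\<dots> = 2 * (LBINT s:{-T..T}. B s)"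
      by (simp add: set_lebesgue_integral_def)
    finally show ?thesis .
  qed
  \<comment> \<open>The left endpoint a = b - n goes to minus infinity, dominated by the integrable
    2 C \<open>fejer\<close>.\<close>
  have "(\<lambda>n. LBINT v. fejer v * (D (b - v / T) - D (b - real n - v / T))) \<longlonglongrightarrow> (LBINT v. fejer v * (D (b - v / T) - 0))"
  proof (rule integral_dominated_convergence[where w = "\<lambda>v. fejer v * (2 * C)"])
    show "integrable lborel (\<lambda>v. fejer v * (2 * C))" using integrable_fejer by simp
    show "AE v in lborel. (\<lambda>n. fejer v * (D (b - v / T) - D (b - real n - v / T))) \<longlonglongrightarrow> fejer v * (D (b - v / T) - 0)"
    proof (intro AE_I2 tendsto_intros)
      fix v :: real
      show "(\<lambda>n. D (b - real n - v / T)) \<longlonglongrightarrow> 0"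
        using tendsto_diff[OF W1.cumulative_at_bot[of "b - v / T"] W2.cumulative_at_bot[of "b - v / T"]]
        by (simp add: D_def algebra_simps)
    qed
    show "AE v in lborel. norm (fejer v * (D (b - v / T) - D (b - real n - v / T))) \<le> fejer v * (2 * C)" for n
    proof (intro AE_I2)
      fix v
      have "\<bar>D (b - v / T) - D (b - real n - v / T)\<bar> \<le> 2 * C"
        using D_le[of "b - v / T"] D_le[of "b - real n - v / T"] by linarith
      then show "norm (fejer v * (D (b - v / T) - D (b - real n - v / T))) \<le> fejer v * (2 * C)"
        using fejer_nonneg[of v] by (simp add: abs_mult mult_left_mono)
    qed
  qed measurable
  then have "(\<lambda>n. \<bar>LBINT v. fejer v * (D (b - v / T) - D (b - real n - v / T))\<bar>) \<longlonglongrightarrow> \<bar>LBINT v. fejer v * (D (b - v / T) - 0)\<bar>"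
    by (rule tendsto_rabs)
  then have "\<bar>LBINT v. fejer v * (D (b - v / T) - 0)\<bar> \<le> 2 * (LBINT s:{-T..T}. B s)"
    by (rule LIMSEQ_le_const2) (use bound in auto)
  then show ?thesis by (simp add: D_def)
qed

text \<open>
  If \<open>D x\<close> is large, then so is \<open>D\<close> to the right of \<open>x\<close>, hence also its average around \<open>x + h/T\<close>,
  where the kernel has three quarters of its mass.
\<close>

lemma unsmoothing_one_sided:
  fixes D :: "real \<Rightarrow> real"
  assumes [measurable]: "D \<in> borel_measurable borel" and \<eta>: "\<And>x. \<bar>D x\<bar> \<le> \<eta>"
    and lip: "\<And>x s. 0 \<le> s \<Longrightarrow> D x - m * s \<le> D (x + s)"
    and S: "\<And>x. \<bar>LBINT v. fejer v * D (x - v / T)\<bar> \<le> S"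
    and T: "T > 0" and m: "m \<ge> 0" and h: "h \<ge> 0" 
    and conc: "(LBINT v. fejer v * indicator (- {-h..h}) v) \<le> c / 4" and c: "c = (LBINT v. fejer v)"
  shows "D x \<le> 4 * S / (3 * c) + \<eta> / 3 + 2 * m * h / T"
proof -
  have c_pos: "0 < c" using integral_fejer_pos c by simp
  have \<eta>0: "0 \<le> \<eta>" using \<eta>[of 0] by linarith
  have S0: "0 \<le> S" using S[of 0] by linarith
  \<comment> \<open>For |v| <= h the point x + h/T - v/T lies between x and x + 2h/T, so the
    one-sided Lipschitz bound costs at most 2 m h / T and D >= A there. Outside this window only D
    >= -\<eta> is known.\<close>
  define A where "A = D x - 2 * m * h / T"
  show ?thesis
  \<comment> \<open>For A > 0 the concentration bound may be multiplied by A; for A <= 0 the claim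
    is immediate.\<close>
  proof (cases "A \<le> 0")
    case True
    have "0 \<le> 4 * S / (3 * c) + \<eta> / 3" using S0 \<eta>0 c_pos by simp
    then show ?thesis using True by (simp add: A_def)
  next
    case False
    let ?J = "\<lambda>v. indicator (- {-h..h}) v :: real"
    have intJ: "integrable lborel (\<lambda>v. fejer v * ?J v)"
      using integrable_mult_indicator[OF _ integrable_fejer, of "- {-h..h}"] by (simp add: mult.commute)
    have "A * (3 * c / 4) - \<eta> * (c / 4) \<le> A * (c - (LBINT v. fejer v * ?J v)) - \<eta> * (LBINT v. fejer v * ?J v)"
    proof -
      have "A * (3 * c / 4) \<le> A * (c - (LBINT v. fejer v * ?J v))"
        using False conc by (intro mult_left_mono) auto
      moreover have "\<eta> * (LBINT v. fejer v * ?J v) \<le> \<eta> * (c / 4)"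
        using conc \<eta>0 by (intro mult_left_mono) auto
      ultimately show ?thesis by linarith
    qed
    also have "\<dots> = (LBINT v. A * (fejer v - fejer v * ?J v) - \<eta> * (fejer v * ?J v))"
      using intJ integrable_fejer by (simp add: c)
    also have "\<dots> \<le> (LBINT v. fejer v * D (x + h / T - v / T))"
    proof (rule Bochner_Integration.integral_mono)
      show "integrable lborel (\<lambda>v. A * (fejer v - fejer v * ?J v) - \<eta> * (fejer v * ?J v))"
        using intJ integrable_fejer by simp
      show "integrable lborel (\<lambda>v. fejer v * D (x + h / T - v / T))"
      proof (rule Bochner_Integration.integrable_bound)
        show "integrable lborel (\<lambda>v. fejer v * \<eta>)" using integrable_fejer by simp
        show "AE v in lborel. norm (fejer v * D (x + h / T - v / T)) \<le> norm (fejer v * \<eta>)"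
          unfolding norm_mult using \<eta> \<eta>0 by (intro AE_I2 mult_left_mono) auto
      qed measurable
      fix v :: real
      show "A * (fejer v - fejer v * ?J v) - \<eta> * (fejer v * ?J v) \<le> fejer v * D (x + h / T - v / T)"
      proof (cases "v \<in> {-h..h}")
        case True
        have s: "0 \<le> (h - v) / T" "(h - v) / T \<le> 2 * h / T" using True T by (auto intro!: divide_right_mono)
        have "A \<le> D x - m * ((h - v) / T)"
          unfolding A_def using mult_left_mono[OF s(2) m] by (simp add: mult_ac)
        also have "\<dots> \<le> D (x + (h - v) / T)" by (rule lip[OF s(1)])
        finally have "A \<le> D (x + h / T - v / T)" by (simp add: diff_divide_distrib add_diff_eq)
        then have "fejer v * A \<le> fejer v * D (x + h / T - v / T)"
          by (intro mult_left_mono fejer_nonneg)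
        then show ?thesis using True by (simp add: mult.commute)
      next
        case False
        have "- \<eta> \<le> D (x + h / T - v / T)" using \<eta>[of "x + h / T - v / T"] by linarith
        then have "fejer v * - \<eta> \<le> fejer v * D (x + h / T - v / T)"
          by (intro mult_left_mono fejer_nonneg)
        then show ?thesis using False by (simp add: mult.commute)
      qed
    qed
    also have "\<dots> \<le> S" using S[of "x + h / T"] by linarith
    finally have "3 * c * A \<le> 4 * S + \<eta> * c" by (simp add: field_simps)
    then have "A \<le> (4 * S + \<eta> * c) / (3 * c)"
      using c_pos by (simp add: pos_le_divide_eq mult_ac)
    also have "\<dots> = 4 * S / (3 * c) + \<eta> / 3" using c_pos by (simp add: add_divide_distrib)
    finally show ?thesis by (simp add: A_def)
  qed
qed

text \<open>The constant is obtained before measures, cutoff and Lipschitz bound are chosen, hence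
  is uniform in n later on. The supremum \<eta> of the difference is finite beforehand, so the
  inequality \<eta> <= ... + \<eta>/3 from unsmoothing can be solved for \<eta>.\<close>

theorem Esseen_smoothing:
  obtains C :: real where "C \<ge> 0"
    "\<And>N1 f1 N2 f2 (B :: real \<Rightarrow> real) T m x. weighted_line N1 f1 \<Longrightarrow> weighted_line N2 f2 \<Longrightarrow> T > 0 \<Longrightarrow>
      (\<And>s. \<bar>s\<bar> \<le> T \<Longrightarrow> norm (fourier N1 f1 s - fourier N2 f2 s) \<le> \<bar>s\<bar> * B s) \<Longrightarrow>
      (\<And>s. 0 \<le> B s) \<Longrightarrow> set_integrable lborel {-T..T} B \<Longrightarrow>
      mono (cumulative N1 f1) \<Longrightarrow> m \<ge> 0 \<Longrightarrow>
      (\<And>x s. 0 \<le> s \<Longrightarrow> cumulative N2 f2 (x + s) \<le> cumulative N2 f2 x + m * s) \<Longrightarrow>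
      \<bar>cumulative N1 f1 x - cumulative N2 f2 x\<bar> \<le> C * ((LBINT s:{-T..T}. B s) + m / T)"
proof -
  obtain h where h: "h \<ge> 0" "(LBINT v. fejer v * indicator (- {-h..h}) v) \<le> (LBINT v. fejer v) / 4"
    using fejer_concentration by blast
  define c where "c = (LBINT v. fejer v)"
  have c: "c > 0" using integral_fejer_pos by (simp add: c_def)
  define C where "C = max (4 / c) (3 * h)"
  show thesis
  proof (rule that[of C])
    show "C \<ge> 0" using c by (simp add: C_def le_max_iff_disj)
    fix N1 N2 :: "real measure" and f1 f2 B :: "real \<Rightarrow> real" and T m x :: real
    assume W: "weighted_line N1 f1" "weighted_line N2 f2" and T: "T > 0"
      and B: "\<And>s. \<bar>s\<bar> \<le> T \<Longrightarrow> norm (fourier N1 f1 s - fourier N2 f2 s) \<le> \<bar>s\<bar> * B s"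
        "\<And>s. 0 \<le> B s" "set_integrable lborel {-T..T} B"
      and mono: "mono (cumulative N1 f1)" and m: "m \<ge> 0"
      and lip: "\<And>x s. 0 \<le> s \<Longrightarrow> cumulative N2 f2 (x + s) \<le> cumulative N2 f2 x + m * s"
    interpret W1: weighted_line N1 f1 by fact
    interpret W2: weighted_line N2 f2 by fact
    define D where "D = (\<lambda>x. cumulative N1 f1 x - cumulative N2 f2 x)"
    have [measurable]: "D \<in> borel_measurable borel" unfolding D_def by measurable
    define I where "I = (LBINT s:{-T..T}. B s)"
    have S: "\<bar>LBINT v. fejer v * D (x - v / T)\<bar> \<le> 2 * I" for x
      unfolding D_def I_def by (rule fejer_smoothing_bound[OF W T B])
    have "bdd_above (range (\<lambda>x. \<bar>D x\<bar>))"
    proof (rule bdd_aboveI2)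
      show "\<bar>D x\<bar> \<le> (LINT y|N1. \<bar>f1 y\<bar>) + (LINT y|N2. \<bar>f2 y\<bar>)" for x
        using W1.abs_cumulative_le[of x] W2.abs_cumulative_le[of x] by (simp add: D_def)
    qed
    define \<eta> where "\<eta> = (SUP x. \<bar>D x\<bar>)"
    have \<eta>: "\<bar>D x\<bar> \<le> \<eta>" for x
      unfolding \<eta>_def using \<open>bdd_above _\<close> by (intro cSUP_upper) auto
    have lipD: "D x - m * s \<le> D (x + s)" if "0 \<le> s" for x s
      using lip[OF that, of x] monoD[OF mono, of x "x + s"] that by (simp add: D_def)
    let ?K = "4 * (2 * I) / (3 * c) + \<eta> / 3 + 2 * m * h / T"
    have up: "D x \<le> ?K" for x
      by (rule unsmoothing_one_sided[OF _ \<eta> lipD S T m h(1)]) (use h in \<open>auto simp: c_def\<close>)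
    have down: "- D x \<le> ?K" for x
    proof -
      have "- D (- (- x)) \<le> ?K"
      \<comment> \<open>The reflected function -D(-x) satisfies the same one-sided Lipschitz bound,
        and its smoothed values are controlled because \<open>fejer\<close> is even.\<close>
      proof (rule unsmoothing_one_sided[where D = "\<lambda>x. - D (- x)" and x = "- x", OF _ _ _ _ T m h(1)])
        show "- D (- x) - m * s \<le> - D (- (x + s))" if "0 \<le> s" for x s
          using lipD[OF that, of "- x - s"] by simp
        show "\<bar>LBINT v. fejer v * - D (- (x - v / T))\<bar> \<le> 2 * I" for x
        proof -
          have "(LBINT v. fejer v * - D (- (x - v / T))) = (LBINT v. fejer (0 + -1 * v) * - D (- (x - (0 + -1 * v) / T)))"
            by (subst lborel_integral_real_affine[where c="-1" and t=0]) simp_all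
          also have "\<dots> = - (LBINT v. fejer v * D (- x - v / T))" by simp
          finally show ?thesis using S[of "- x"] by simp
        qed
      qed (use h \<eta> in \<open>auto simp: c_def\<close>)
      then show ?thesis by simp
    qed
    have "\<eta> \<le> ?K"
      unfolding \<eta>_def[symmetric] by (subst (1) \<eta>_def, rule cSUP_least) (use up down in \<open>auto simp: abs_le_iff\<close>)
    \<comment> \<open>Absorbing \<eta>/3 on the left produces the factor 3/2, whence the two entries
      4/c and 3h of \<open>C\<close>.\<close>
    then have "\<eta> \<le> 3 / 2 * (4 * (2 * I) / (3 * c) + 2 * m * h / T)" by (simp add: field_simps)
    also have "\<dots> = 4 / c * I + 3 * h * (m / T)" using c T by (simp add: field_simps)
    also have "\<dots> \<le> C * I + C * (m / T)"
    proof (intro add_mono mult_right_mono)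
      show "0 \<le> I" using S[of 0] by linarith
      show "0 \<le> m / T" using m T by simp
    qed (auto simp: C_def)
    finally show "\<bar>cumulative N1 f1 x - cumulative N2 f2 x\<bar> \<le> C * ((LBINT s:{-T..T}. B s) + m / T)"
      using \<eta>[of x] by (simp add: D_def I_def distrib_left)
  qed
qed

section \<open>Fourier transforms of polynomials times the normal density\<close>

definition cpoly :: "real poly \<Rightarrow> complex \<Rightarrow> complex" where
  "cpoly p = poly (map_poly complex_of_real p)"

lemma cpoly_0 [simp]: "cpoly 0 z = 0"
  by (simp add: cpoly_def)

lemma cpoly_pCons [simp]: "cpoly (pCons a p) z = of_real a + z * cpoly p z"
  by (simp add: cpoly_def map_poly_pCons)

lemma cpoly_1 [simp]: "cpoly 1 z = 1"
  by (simp add: one_pCons)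

lemma cpoly_add [simp]: "cpoly (p + q) z = cpoly p z + cpoly q z"
  by (induction p q rule: poly_induct2) (auto simp: algebra_simps)

lemma cpoly_smult [simp]: "cpoly (smult c p) z = of_real c * cpoly p z"
  by (induction p) (auto simp: algebra_simps)

lemma cpoly_minus [simp]: "cpoly (- p) z = - cpoly p z"
  by (induction p) (auto simp: algebra_simps)

lemma cpoly_sum [simp]: "cpoly (\<Sum>i\<in>A. f i) z = (\<Sum>i\<in>A. cpoly (f i) z)"
  by (induction A rule: infinite_finite_induct) auto

lemma cpoly_mult [simp]: "cpoly (p * q) z = cpoly p z * cpoly q z"
  by (induction p) (auto simp: algebra_simps)

lemma cpoly_monom [simp]: "cpoly (monom c n) z = of_real c * z ^ n"
  by (induction n) (auto simp: monom_Suc monom_0)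

lemma poly_of_real_eq_0_imp:
  assumes "\<And>t. t \<noteq> 0 \<Longrightarrow> cpoly p (\<i> * complex_of_real t) = 0"
  shows "p = 0"
proof (rule ccontr)
  assume "p \<noteq> 0"
  then have "map_poly complex_of_real p \<noteq> 0"
    by (simp add: map_poly_eq_0_iff)
  then have "finite {z. poly (map_poly complex_of_real p) z = 0}"
    by (rule poly_roots_finite)
  moreover have "(\<lambda>t. \<i> * complex_of_real t) ` (UNIV - {0}) \<subseteq> {z. poly (map_poly complex_of_real p) z = 0}"
    using assms by (auto simp: cpoly_def)
  ultimately have "finite ((\<lambda>t. \<i> * complex_of_real t) ` (UNIV - {0}))"
    by (rule rev_finite_subset)
  then have "finite (UNIV - {0::real})"
    by (rule finite_imageD) (auto intro: inj_onI)
  then show False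
    using infinite_UNIV_char_0[where 'a=real] by simp
qed

lemma integrable_std_normal_poly:
  "integrable lborel (\<lambda>x. std_normal_density x * poly q x)"
proof -
  have "integrable lborel (\<lambda>x. \<Sum>i\<le>degree q. coeff q i * (std_normal_density x * x ^ i))"
    by (intro Bochner_Integration.integrable_sum integrable_mult_right integrable_std_normal_moment)
  then show ?thesis
    by (simp add: poly_altdef sum_distrib_left mult_ac)
qed

lemma tendsto_std_normal_poly:
  "((\<lambda>x. std_normal_density x * poly q x) \<longlongrightarrow> 0) at_top"
  "((\<lambda>x. std_normal_density x * poly q x) \<longlongrightarrow> 0) at_bot"
proof -
  have top: "((\<lambda>x. std_normal_density x * x ^ k) \<longlongrightarrow> 0) at_top" for k
  proof (rule Lim_null_comparison)
    show "((\<lambda>x::real. exp (1/2) * (x ^ k / exp x)) \<longlongrightarrow> 0) at_top"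
      by (intro tendsto_mult_right_zero tendsto_power_div_exp_0)
    show "\<forall>\<^sub>F x in at_top. norm (std_normal_density x * x ^ k) \<le> exp (1/2) * (x ^ k / exp x)"
      using eventually_ge_at_top[of 0]
    proof eventually_elim
      case (elim x)
      \<comment> \<open>Completing the square compares the Gaussian with exp(1/2 - x), for which the
        limit against powers is known.\<close>
      have "0 \<le> (x - 1)\<^sup>2" by simp
      then have "- x\<^sup>2 / 2 \<le> 1/2 - x" by (simp add: power2_eq_square algebra_simps)
      then have "exp (- x\<^sup>2 / 2) \<le> exp (1/2) / exp x" by (simp flip: exp_diff)
      moreover have "1 / sqrt (2 * pi) \<le> 1"
        using pi_gt3 by (simp add: real_le_rsqrt)
      ultimately have "1 / sqrt (2 * pi) * exp (- x\<^sup>2 / 2) \<le> 1 * (exp (1/2) / exp x)"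
        by (intro mult_mono) auto
      then have "std_normal_density x * x ^ k \<le> 1 * (exp (1/2) / exp x) * x ^ k"
        unfolding std_normal_density_def using elim by (intro mult_right_mono) auto
      then show ?case using elim by (simp add: abs_mult)
    qed
  qed
  have bot: "((\<lambda>x. std_normal_density x * x ^ k) \<longlongrightarrow> 0) at_bot" for k
  proof -
    have "(\<lambda>x::real. std_normal_density (- x) * (- x) ^ k) =
      (\<lambda>x. (-1) ^ k * (std_normal_density x * x ^ k))"
    proof
      show "std_normal_density (- x) * (- x) ^ k = (-1) ^ k * (std_normal_density x * x ^ k)" for x :: real
        by (subst power_minus) (simp add: std_normal_density_def)
    qed
    then show ?thesis
      unfolding filterlim_at_bot_mirror
      using tendsto_mult_right_zero[OF top[of k], of "(-1) ^ k"] by simp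
  qed
  note * = top bot
  have "((\<lambda>x. \<Sum>i\<le>degree q. coeff q i * (std_normal_density x * x ^ i)) \<longlongrightarrow>
          (\<Sum>i\<le>degree q. coeff q i * 0)) at_top"
       "((\<lambda>x. \<Sum>i\<le>degree q. coeff q i * (std_normal_density x * x ^ i)) \<longlongrightarrow>
          (\<Sum>i\<le>degree q. coeff q i * 0)) at_bot"
    by (intro tendsto_intros *)+
  then show "((\<lambda>x. std_normal_density x * poly q x) \<longlongrightarrow> 0) at_top"
    "((\<lambda>x. std_normal_density x * poly q x) \<longlongrightarrow> 0) at_bot"
    by (simp_all add: poly_altdef sum_distrib_left mult_ac)
qed

lemma DERIV_std_normal_poly:
  "((\<lambda>x. std_normal_density x * poly q x) has_real_derivative
     std_normal_density x * poly (pderiv q - pCons 0 q) x) (at x)"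
  unfolding std_normal_density_def
  by (rule derivative_eq_intros poly_DERIV refl | simp add: field_simps)+

text \<open>The correspondence between Hermite polynomials and powers: w^k is paired with the
  probabilists' Hermite polynomial He_k. Both sides are kept real, because the Edgeworth polynomials
  have to be real.\<close>

definition gauss_pair :: "real poly \<Rightarrow> real poly \<Rightarrow> bool" where
  "gauss_pair q c \<longleftrightarrow> (\<forall>t. (CLBINT x. iexp (t * x) * complex_of_real (std_normal_density x * poly q x))
     = cpoly c (\<i> * complex_of_real t) * complex_of_real (exp (- (t\<^sup>2) / 2)))"

lemma integrable_iexp_mult:
  fixes f :: "real \<Rightarrow> real"
  assumes "integrable M f" "g \<in> borel_measurable M"
  shows "integrable M (\<lambda>x. iexp (t * g x) * complex_of_real (f x))"
  using assms(1) by (rule Bochner_Integration.integrable_bound) (use assms in \<open>auto simp: norm_mult\<close>)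

lemma gauss_pair_1: "gauss_pair 1 1"
proof -
  have "(CLBINT x. iexp (t * x) * complex_of_real (std_normal_density x)) = complex_of_real (exp (- (t\<^sup>2) / 2))" for t
  proof -
    have "complex_of_real (exp (- (t\<^sup>2) / 2)) = char std_normal_distribution t"
      by (simp add: char_std_normal_distribution)
    also have "\<dots> = (CLBINT x. std_normal_density x *\<^sub>R iexp (t * x))"
      unfolding char_def by (subst integral_density) auto
    finally show ?thesis
      by (simp add: scaleR_conv_of_real mult.commute)
  qed
  then show ?thesis
    by (simp add: gauss_pair_def)
qed

lemma gauss_pair_add: "gauss_pair q c \<Longrightarrow> gauss_pair q' c' \<Longrightarrow> gauss_pair (q + q') (c + c')"
  unfolding gauss_pair_def
  by (simp add: ring_distribs integral_add integrable_iexp_mult[OF integrable_std_normal_poly, unfolded of_real_mult])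

lemma gauss_pair_smult: "gauss_pair q c \<Longrightarrow> gauss_pair (smult a q) (smult a c)"
  unfolding gauss_pair_def
  by (simp add: mult.left_commute[of _ "complex_of_real a"] mult.assoc)

text \<open>Integration by parts in the form that the derivative of an integrable function vanishing
  at both infinities has integral 0. The derivative of density times q is density times q' - x
  q.\<close>

lemma std_normal_poly_by_parts:
  "(CLBINT x. iexp (t * x) * complex_of_real (std_normal_density x * poly (pderiv q - pCons 0 q) x))
   = - \<i> * t * (CLBINT x. iexp (t * x) * complex_of_real (std_normal_density x * poly q x))"
proof -
  define F where "F = (\<lambda>x. iexp (t * x) * complex_of_real (std_normal_density x * poly q x))"
  define f where "f = (\<lambda>x. \<i> * t * F x +
    iexp (t * x) * complex_of_real (std_normal_density x * poly (pderiv q - pCons 0 q) x))"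
  have intF: "integrable lborel F"
    unfolding F_def by (intro integrable_iexp_mult integrable_std_normal_poly) auto
  have int2: "integrable lborel (\<lambda>x. iexp (t * x) * complex_of_real (std_normal_density x * poly (pderiv q - pCons 0 q) x))"
    by (intro integrable_iexp_mult integrable_std_normal_poly) auto
  have intf: "integrable lborel f"
    unfolding f_def by (intro Bochner_Integration.integrable_add integrable_mult_right intF int2)
  have D: "(F has_vector_derivative f x) (at x)" for x
  proof -
    have 1: "((\<lambda>x. iexp (t * x)) has_vector_derivative (\<i> * t * iexp (t * x))) (at x)"
    proof -
      have "((\<lambda>z. exp (\<i> * (of_real t * z))) has_field_derivative
          \<i> * t * exp (\<i> * (of_real t * of_real x))) (at (of_real x))"
        by (rule derivative_eq_intros refl | simp)+
      from has_vector_derivative_real_field[OF this] show ?thesis by simp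
    qed
    have 2: "((\<lambda>x. complex_of_real (std_normal_density x * poly q x)) has_vector_derivative
        complex_of_real (std_normal_density x * poly (pderiv q - pCons 0 q) x)) (at x)"
      using DERIV_std_normal_poly[of q x]
      by (intro has_vector_derivative_of_real) (simp add: has_real_derivative_iff_has_vector_derivative)
    show ?thesis
      using has_vector_derivative_mult[OF 1 2] unfolding F_def f_def by (simp add: algebra_simps)
  qed
  have norm_F: "norm (F x) = \<bar>std_normal_density x * poly q x\<bar>" for x
    unfolding F_def norm_mult norm_exp_i_times norm_of_real mult_1_left ..
  have lim: "(F \<longlongrightarrow> 0) at_top" "(F \<longlongrightarrow> 0) at_bot"
    by (rule tendsto_norm_zero_cancel, unfold norm_F, rule tendsto_rabs_zero,
        rule tendsto_std_normal_poly)+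
  have "isCont f x" for x
  proof -
    have "continuous_on UNIV f"
      unfolding f_def F_def std_normal_density_def by (intro continuous_intros) auto
    then show ?thesis by (simp add: continuous_on_eq_continuous_at)
  qed
  then have "(LBINT x=-\<infinity>..\<infinity>. f x) = 0 - 0"
    by (intro interval_integral_FTC_integrable[where F=F] D)
       (use lim intf in \<open>auto simp: ereal_tendsto_simps set_integrable_def\<close>)
  then have "integral\<^sup>L lborel f = 0"
    by (simp add: interval_lebesgue_integral_def set_lebesgue_integral_def)
  then show ?thesis
    unfolding f_def using intF int2
    by (subst (asm) Bochner_Integration.integral_add)
       (auto simp: F_def add_eq_0_iff2 simp del: of_real_mult)
qed

lemma gauss_pair_shift: "gauss_pair q c \<Longrightarrow> gauss_pair (pCons 0 q - pderiv q) (pCons 0 c)"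
proof -
  assume *: "gauss_pair q c"
  have "(CLBINT x. iexp (t * x) * complex_of_real (std_normal_density x * poly (pCons 0 q - pderiv q) x)) =
    - (CLBINT x. iexp (t * x) * complex_of_real (std_normal_density x * poly (pderiv q - pCons 0 q) x))" for t
    by (subst Bochner_Integration.integral_minus [symmetric]) (simp add: algebra_simps)
  with * show ?thesis
    unfolding gauss_pair_def std_normal_poly_by_parts by (simp add: mult.assoc)
qed

text \<open>Horner's scheme on c: adding a constant adds it to q, and multiplication by w is the
  shift q -> x q - q'. This yields the existence of the Edgeworth polynomials.\<close>

lemma ex_gauss_pair_left: "\<exists>q. gauss_pair q c"
proof (induction c)
  case 0
  then show ?case by (intro exI[of _ 0]) (simp add: gauss_pair_def)
next
  case (pCons a c)
  then obtain q where "gauss_pair q c" by blast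
  then have "gauss_pair (smult a 1 + (pCons 0 q - pderiv q)) (smult a 1 + pCons 0 c)"
    by (intro gauss_pair_add gauss_pair_smult gauss_pair_1 gauss_pair_shift)
  moreover have "smult a 1 + pCons 0 c = pCons a c"
    by (simp add: one_pCons)
  ultimately show ?case by auto
qed

text \<open>Injectivity for the uniqueness of the Edgeworth polynomials, by counting degrees instead
  of Fourier inversion. The point t = 0 is excluded because the application divides by t.\<close>

lemma poly_eq_0_if_gauss_Fourier_eq_0:
  assumes "\<And>t. t \<noteq> 0 \<Longrightarrow> (CLBINT x. iexp (t * x) * complex_of_real (std_normal_density x * poly q x)) = 0"
  shows "q = 0"
proof (rule ccontr)
  assume "q \<noteq> 0"
  \<comment> \<open>The pairing preserves degrees, because multiplication by the variable on the right
     corresponds to \<open>q \<mapsto> x q - q'\<close> on the left.\<close>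
  have inj: "\<exists>c. gauss_pair q c \<and> c \<noteq> 0 \<and> degree c = degree q" if "q \<noteq> 0" for q
    using that
  proof (induction "degree q" arbitrary: q rule: less_induct)
    case less
    obtain a q' where q: "q = pCons a q'" by (cases q)
    show ?case
    proof (cases "q' = 0")
      case True
      then have "q = smult a 1" "a \<noteq> 0" using q less by (auto simp: one_pCons)
      then show ?thesis using gauss_pair_smult[OF gauss_pair_1, of a]
        by (intro exI[of _ "smult a 1"]) auto
    next
      case False
      then have deg: "degree q = Suc (degree q')" by (simp add: q)
      obtain c1 where c1: "gauss_pair q' c1" "c1 \<noteq> 0" "degree c1 = degree q'"
        using less.hyps[of q'] deg False by auto
      obtain c2 where c2: "gauss_pair (pderiv q') c2" "degree c2 \<le> degree q'"
      proof (cases "pderiv q' = 0")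
        case True
        then show ?thesis by (intro that[of 0]) (auto simp: gauss_pair_def)
      next
        case False
        have "degree (pderiv q') < degree q" using deg by (simp add: degree_pderiv)
        then obtain c2 where "gauss_pair (pderiv q') c2" "degree c2 = degree (pderiv q')"
          using less.hyps[of "pderiv q'"] False by auto
        then show ?thesis by (intro that[of c2]) (auto simp: degree_pderiv)
      qed
      \<comment> \<open>From q = a + x q', rewritten as a + D + (x q' - D) with D the derivative of
        q'. The last summand is the shift, and \<open>c2\<close> has too small a degree to cancel
        its leading term.\<close>
      let ?c = "(smult a 1 + c2) + pCons 0 c1"
      have "gauss_pair (smult a 1 + pderiv q' + (pCons 0 q' - pderiv q')) ?c"
        by (intro gauss_pair_add gauss_pair_smult gauss_pair_1 gauss_pair_shift c1 c2)
      moreover have "smult a 1 + pderiv q' + (pCons 0 q' - pderiv q') = q"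
        by (simp add: q one_pCons)
      moreover have "degree ?c = degree q"
      proof -
        have "degree (smult a 1 + c2) \<le> degree q'"
          using c2 by (intro degree_add_le) auto
        then have "degree (smult a 1 + c2) < degree (pCons 0 c1)"
          using c1 by simp
        then have "degree ?c = degree (pCons 0 c1)"
          by (rule degree_add_eq_right)
        then show ?thesis using c1 deg by simp
      qed
      moreover from this have "?c \<noteq> 0" using deg by (metis degree_0 nat.distinct(1))
      ultimately show ?thesis by metis
    qed
  qed
  then obtain c where c: "gauss_pair q c" "c \<noteq> 0" using \<open>q \<noteq> 0\<close> by blast
  have "cpoly c (\<i> * complex_of_real t) = 0" if "t \<noteq> 0" for t
    using c(1) assms[OF that] unfolding gauss_pair_def by simp
  then have "c = 0" by (rule poly_of_real_eq_0_imp)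
  with c show False by simp
qed

section \<open>Expansion of powers of a moment generating function\<close>

text \<open>Reflection symmetry makes all derivatives at 0 real; it is carried along so that the
  coefficients of the expansion are values of real polynomials.\<close>

definition conj_sym :: "real \<Rightarrow> (complex \<Rightarrow> complex) \<Rightarrow> bool" where
  "conj_sym \<rho> f \<longleftrightarrow> (\<forall>z\<in>ball 0 \<rho>. f (cnj z) = cnj (f z))"

lemma conj_sym_deriv:
  assumes "f holomorphic_on ball 0 \<rho>" "conj_sym \<rho> f"
  shows "conj_sym \<rho> (deriv f)"
  unfolding conj_sym_def
proof
  fix z :: complex assume z: "z \<in> ball 0 \<rho>"
  then have z': "cnj z \<in> ball 0 \<rho>" by simp
  have "(f has_field_derivative deriv f (cnj z)) (at (cnj z))"
    using assms(1) z' holomorphic_derivI open_ball by blast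
  then have "(cnj \<circ> f \<circ> cnj has_field_derivative cnj (deriv f (cnj z))) (at z)"
    by (rule has_field_derivative_cnj_cnj)
  then have "(f has_field_derivative cnj (deriv f (cnj z))) (at z)"
    by (rule has_field_derivative_transform_within_open[OF _ open_ball z])
       (use assms(2) in \<open>auto simp: conj_sym_def\<close>)
  then have "deriv f z = cnj (deriv f (cnj z))"
    by (rule DERIV_imp_deriv)
  then show "deriv f (cnj z) = cnj (deriv f z)" by simp
qed

lemma conj_sym_higher_deriv:
  assumes "f holomorphic_on ball 0 \<rho>" "conj_sym \<rho> f"
  shows "conj_sym \<rho> ((deriv ^^ k) f)"
proof (induction k)
  case (Suc k)
  then show ?case
    using conj_sym_deriv[of "(deriv ^^ k) f" \<rho>] holomorphic_higher_deriv[OF assms(1) open_ball]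
    by simp
qed (use assms in simp)

lemma higher_deriv_0_real:
  assumes "f holomorphic_on ball 0 \<rho>" "conj_sym \<rho> f" "\<rho> > 0"
  shows "(deriv ^^ k) f 0 = complex_of_real (Re ((deriv ^^ k) f 0))"
proof -
  have "(deriv ^^ k) f 0 = cnj ((deriv ^^ k) f 0)"
    using conj_sym_higher_deriv[OF assms(1,2), of k] \<open>\<rho> > 0\<close> unfolding conj_sym_def
    by (metis centre_in_ball complex_cnj_zero)
  then show ?thesis
    by (metis Reals_cnj_iff of_real_Re)
qed

text \<open>Removable singularity. Applied twice, it extracts the double zero of the logarithm of
  the moment generating function.\<close>

lemma holomorphic_divide_by_id:
  assumes "f holomorphic_on ball 0 \<rho>" "conj_sym \<rho> f" "f 0 = 0" "\<rho> > 0"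
  obtains h where "h holomorphic_on ball 0 \<rho>" "conj_sym \<rho> h" "\<And>z. f z = z * h z" "h 0 = deriv f 0"
proof
  define h where "h = (\<lambda>z. if z = 0 then deriv f 0 else f z / z)"
  show "h holomorphic_on ball 0 \<rho>"
    by (rule pole_theorem_open_0[OF assms(1) open_ball, of 0]) (auto simp: h_def assms)
  have "deriv f 0 = cnj (deriv f 0)"
    using conj_sym_deriv[OF assms(1,2)] \<open>\<rho> > 0\<close> unfolding conj_sym_def
    by (metis centre_in_ball complex_cnj_zero)
  then show "conj_sym \<rho> h"
    using assms(2) by (auto simp: conj_sym_def h_def)
  show "f z = z * h z" for z using assms(3) by (simp add: h_def)
  show "h 0 = deriv f 0" by (simp add: h_def)
qed

text \<open>Near 0 the real part of \<psi> is positive, so the principal logarithm is holomorphic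
  and commutes with conjugation. Mean 0 gives it a double zero, and variance 1 gives the quotient
  the value 1/2 at 0, which is split off to make g vanish there.\<close>

lemma ex_log_expansion:
  assumes hol: "\<psi> holomorphic_on UNIV" and [simp]: "\<psi> 0 = 1"
    and d1: "deriv \<psi> 0 = 0" and d2: "deriv (deriv \<psi>) 0 = 1"
    and cnj: "\<And>z. \<psi> (cnj z) = cnj (\<psi> z)"
  obtains \<rho> g where "\<rho> > 0" "g holomorphic_on ball 0 \<rho>" "conj_sym \<rho> g" "g 0 = 0"
    "\<And>z. z \<in> ball 0 \<rho> \<Longrightarrow> \<psi> z = exp (z\<^sup>2 / 2 + z\<^sup>2 * g z)"
proof -
  have "isCont \<psi> 0"
    using holomorphic_on_imp_continuous_on[OF hol] continuous_on_eq_continuous_at[OF open_UNIV] by blast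
  then obtain \<rho> where "\<rho> > 0" and \<rho>: "\<And>z. dist z 0 < \<rho> \<Longrightarrow> dist (\<psi> z) 1 < 1"
    unfolding continuous_at_eps_delta by (metis \<open>\<psi> 0 = 1\<close> zero_less_one)
  have Re_pos: "Re (\<psi> z) > 0" if "z \<in> ball 0 \<rho>" for z
  proof -
    have "\<bar>Re (\<psi> z - 1)\<bar> < 1"
      using \<rho>[of z] that abs_Re_le_cmod[of "\<psi> z - 1"] by (simp add: dist_norm)
    then show ?thesis by simp
  qed
  then have nonneg: "\<psi> z \<notin> \<real>\<^sub>\<le>\<^sub>0" if "z \<in> ball 0 \<rho>" for z
    using that by (auto simp: complex_nonpos_Reals_iff) (metis not_le)
  define L where "L = (\<lambda>z. Ln (\<psi> z))"
  have holb: "\<psi> holomorphic_on ball 0 \<rho>" using hol by (rule holomorphic_on_subset) simp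
  have L_hol: "L holomorphic_on ball 0 \<rho>"
    unfolding L_def by (intro holomorphic_on_Ln' holb nonneg)
  have L_exp: "exp (L z) = \<psi> z" if "z \<in> ball 0 \<rho>" for z
    using Re_pos[OF that] by (cases "\<psi> z = 0") (auto simp: L_def)
  have "conj_sym \<rho> L"
    unfolding conj_sym_def L_def using cnj nonneg by (auto simp: cnj_Ln)
  moreover have "L 0 = 0" by (simp add: L_def)
  ultimately obtain h1 where h1: "h1 holomorphic_on ball 0 \<rho>" "conj_sym \<rho> h1" "\<And>z. L z = z * h1 z"
      "h1 0 = deriv L 0"
    using holomorphic_divide_by_id[OF L_hol] \<open>\<rho> > 0\<close> by metis
  have dL: "deriv \<psi> z = deriv L z * \<psi> z" if "z \<in> ball 0 \<rho>" for z
  proof -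
    have "(L has_field_derivative deriv L z) (at z)"
      using L_hol that holomorphic_derivI open_ball by blast
    then have "((\<lambda>z. exp (L z)) has_field_derivative deriv L z * exp (L z)) (at z)"
      by (auto intro!: derivative_eq_intros)
    then have "(\<psi> has_field_derivative deriv L z * exp (L z)) (at z)"
      by (rule has_field_derivative_transform_within_open[OF _ open_ball that]) (simp add: L_exp)
    then show ?thesis using L_exp[OF that] by (simp add: DERIV_imp_deriv)
  qed
  have "h1 0 = 0" using dL[of 0] \<open>\<rho> > 0\<close> d1 h1(4) by simp
  then obtain h2 where h2: "h2 holomorphic_on ball 0 \<rho>" "conj_sym \<rho> h2" "\<And>z. h1 z = z * h2 z"
    using holomorphic_divide_by_id[OF h1(1,2)] \<open>\<rho> > 0\<close> by metis
  \<comment> \<open>Differentiating exp(z^2 h2) gives \<psi>' = z K(z) near 0, hence \<psi>''(0) =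
    K(0) = 2 h2(0).\<close>
  have h2_0: "h2 0 = 1 / 2"
  proof -
    define K where "K = (\<lambda>z. (2 * h2 z + z * deriv h2 z) * \<psi> z)"
    have "deriv \<psi> z = z * K z" if "z \<in> ball 0 \<rho>" for z
    proof -
      have "(h2 has_field_derivative deriv h2 z) (at z)"
        using h2(1) that holomorphic_derivI open_ball by blast
      then have "((\<lambda>z. z * (z * h2 z)) has_field_derivative z * (2 * h2 z + z * deriv h2 z)) (at z)"
        by (auto intro!: derivative_eq_intros simp: algebra_simps)
      moreover have "L = (\<lambda>z. z * (z * h2 z))" using h1(3) h2(3) by (intro ext) metis
      ultimately show ?thesis using dL[OF that] by (simp add: DERIV_imp_deriv K_def)
    qed
    note \<psi>' = this
    have "K holomorphic_on ball 0 \<rho>"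
      unfolding K_def by (intro holomorphic_intros h2(1) holb) auto
    then have "(K has_field_derivative deriv K 0) (at 0)"
      using \<open>\<rho> > 0\<close> holomorphic_derivI open_ball by (metis centre_in_ball)
    then have "((\<lambda>z. z * K z) has_field_derivative K 0) (at 0)"
      by (auto intro!: derivative_eq_intros)
    then have "(deriv \<psi> has_field_derivative K 0) (at 0)"
      by (rule has_field_derivative_transform_within_open[OF _ open_ball[of 0 \<rho>]])
         (use \<open>\<rho> > 0\<close> \<psi>' in auto)
    then have "K 0 = 1" using d2 by (simp add: DERIV_imp_deriv)
    then show ?thesis by (simp add: K_def field_simps)
  qed
  show ?thesis
  proof (rule that[of \<rho> "\<lambda>z. h2 z - 1 / 2"])
    show "(\<lambda>z. h2 z - 1 / 2) holomorphic_on ball 0 \<rho>" by (intro holomorphic_intros h2)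
    show "conj_sym \<rho> (\<lambda>z. h2 z - 1 / 2)" using h2(2) by (auto simp: conj_sym_def)
    show "\<psi> z = exp (z\<^sup>2 / 2 + z\<^sup>2 * (h2 z - 1 / 2))" if "z \<in> ball 0 \<rho>" for z
      using L_exp[OF that] h1(3)[of z] h2(3)[of z] by (simp add: algebra_simps power2_eq_square)
  qed (use \<open>\<rho> > 0\<close> h2_0 in auto)
qed

text \<open>The first derivative is w^2 g' exp(w^2 g); Leibniz' rule expresses its further
  derivatives at 0 through lower ones. The start uses g(0) = 0, which makes the exponential equal to
  1 for every w.\<close>

lemma higher_deriv_exp_poly:
  assumes "\<rho> > 0" "g holomorphic_on ball 0 \<rho>" "conj_sym \<rho> g" "g 0 = 0"
  shows "\<exists>V. \<forall>w. (deriv ^^ k) (\<lambda>z. exp (w\<^sup>2 * g z)) 0 = cpoly V w"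
proof (induction k rule: less_induct)
  case (less k)
  show ?case
  proof (cases k)
    case 0
    then show ?thesis using assms(4) by (intro exI[of _ 1]) simp
  next
    case (Suc m)
    have "\<forall>j\<in>{..m}. \<exists>V. \<forall>w. (deriv ^^ j) (\<lambda>z. exp (w\<^sup>2 * g z)) 0 = cpoly V w"
      using less Suc by auto
    from bchoice[OF this] obtain V where
      "\<forall>j\<in>{..m}. \<forall>w. (deriv ^^ j) (\<lambda>z. exp (w\<^sup>2 * g z)) 0 = cpoly (V j) w" ..
    then have V: "(deriv ^^ j) (\<lambda>z. exp (w\<^sup>2 * g z)) 0 = cpoly (V j) w" if "j \<le> m" for j w
      using that by simp
    define G where "G = (\<lambda>i. Re ((deriv ^^ i) (deriv g) 0))"
    have dg: "deriv g holomorphic_on ball 0 \<rho>" using assms(2) by (intro holomorphic_deriv) auto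
    have G: "(deriv ^^ i) (deriv g) 0 = complex_of_real (G i)" for i
      unfolding G_def by (intro higher_deriv_0_real[OF dg conj_sym_deriv[OF assms(2,3)] assms(1)])
    have "(deriv ^^ k) (\<lambda>z. exp (w\<^sup>2 * g z)) 0 =
      cpoly (monom 1 2 * (\<Sum>i = 0..m. smult (of_nat (m choose i) * G i) (V (m - i)))) w" for w
    proof -
      let ?F = "\<lambda>z. exp (w\<^sup>2 * g z)"
      have F: "?F holomorphic_on ball 0 \<rho>" by (intro holomorphic_intros assms(2))
      have dF: "deriv ?F z = w\<^sup>2 * (deriv g z * ?F z)" if "z \<in> ball 0 \<rho>" for z
      proof -
        have "(g has_field_derivative deriv g z) (at z)"
          using assms(2) that holomorphic_derivI open_ball by blast
        then show ?thesis
          by (intro DERIV_imp_deriv) (auto intro!: derivative_eq_intros)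
      qed
      have hol: "(\<lambda>z. deriv g z * ?F z) holomorphic_on ball 0 \<rho>"
        by (intro holomorphic_intros dg F)
      have "(deriv ^^ k) ?F 0 = (deriv ^^ m) (deriv ?F) 0"
        by (simp add: Suc funpow_Suc_right del: funpow.simps)
      also have "\<dots> = (deriv ^^ m) (\<lambda>z. w\<^sup>2 * (deriv g z * ?F z)) 0"
        using F hol dF assms(1,2)
        by (intro higher_deriv_transform_within_open[where S="ball 0 \<rho>"] holomorphic_intros holomorphic_deriv) auto
      also have "\<dots> = w\<^sup>2 * (deriv ^^ m) (\<lambda>z. deriv g z * ?F z) 0"
        using higher_deriv_cmult[OF hol _ open_ball] assms(1) by simp
      also have "(deriv ^^ m) (\<lambda>z. deriv g z * ?F z) 0 =
          (\<Sum>i = 0..m. of_nat (m choose i) * (deriv ^^ i) (deriv g) 0 * (deriv ^^ (m - i)) ?F 0)"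
        using assms(1) by (intro higher_deriv_mult[OF dg F open_ball]) auto
      also have "\<dots> = (\<Sum>i = 0..m. of_nat (m choose i) * G i * cpoly (V (m - i)) w)"
        by (intro sum.cong refl) (simp add: G V)
      finally show ?thesis by simp
    qed
    then show ?thesis by blast
  qed
qed

text \<open>Cauchy's inequalities on the circle of radius s bound the coefficients by M / s^k, so
  the tail is dominated by a geometric series of ratio |z|/s <= 1/2; this is the factor 2.\<close>

lemma Taylor_remainder_Cauchy:
  assumes hol: "f holomorphic_on ball 0 \<rho>" and "0 < s" "s < \<rho>"
    and bound: "\<And>z. norm z = s \<Longrightarrow> norm (f z) \<le> M"
    and z: "norm z \<le> s / 2"
  shows "norm (f z - (\<Sum>k\<le>r. (deriv ^^ k) f 0 / fact k * z ^ k)) \<le> 2 * M * (norm z / s) ^ Suc r"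
    and "norm ((deriv ^^ k) f 0 / fact k) \<le> M / s ^ k"
proof -
  have coeff: "norm ((deriv ^^ k) f 0 / fact k) \<le> M / s ^ k" for k
  proof -
    have "norm ((deriv ^^ k) f 0) \<le> fact k * M / s ^ k"
    proof (rule Cauchy_inequality)
      show "f holomorphic_on ball 0 s" using hol by (rule holomorphic_on_subset) (use assms in auto)
      have "f holomorphic_on cball 0 s" using hol by (rule holomorphic_on_subset) (use assms in auto)
      then show "continuous_on (cball 0 s) f" by (rule holomorphic_on_imp_continuous_on)
    qed (use assms in auto)
    then show ?thesis by (simp add: norm_divide field_simps)
  qed
  then show "norm ((deriv ^^ k) f 0 / fact k) \<le> M / s ^ k" .
  let ?a = "\<lambda>k. (deriv ^^ k) f 0 / fact k * z ^ k"
  define q where "q = norm z / s"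
  have q: "0 \<le> q" "q \<le> 1 / 2" using z \<open>0 < s\<close> by (auto simp: q_def field_simps)
  have sums: "?a sums f z"
    using holomorphic_power_series[OF hol, of z] z assms by simp
  have "norm (f (of_real s)) \<le> M" using bound \<open>0 < s\<close> by simp
  then have M: "0 \<le> M" by (rule order_trans[OF norm_ge_zero])
  have le: "norm (?a k) \<le> M * q ^ k" for k
    using mult_right_mono[OF coeff[of k], of "norm z ^ k"] by (simp add: q_def norm_mult norm_power norm_divide power_divide)
  have geo: "(\<lambda>i. M * q ^ (i + Suc r)) sums (M * q ^ Suc r * (1 / (1 - q)))"
    using sums_mult[OF geometric_sums[of q], of "M * q ^ Suc r"] q by (simp add: power_add mult_ac)
  have "(\<lambda>i. ?a (i + Suc r)) sums (f z - (\<Sum>k<Suc r. ?a k))"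
    using sums by (rule sums_split_initial_segment)
  then have "norm (f z - (\<Sum>k<Suc r. ?a k)) \<le> M * q ^ Suc r * (1 / (1 - q))"
    using norm_suminf_le[of "\<lambda>i. ?a (i + Suc r)" "\<lambda>i. M * q ^ (i + Suc r)"] geo le
    by (simp only: sums_iff)
  also have "\<dots> \<le> M * q ^ Suc r * 2"
    using q M by (intro mult_left_mono mult_nonneg_nonneg zero_le_power) (auto simp: divide_le_eq)
  finally show "norm (f z - (\<Sum>k\<le>r. ?a k)) \<le> 2 * M * (norm z / s) ^ Suc r"
    unfolding q_def[symmetric]
    by (simp add: lessThan_Suc_atMost mult_ac)
qed

text \<open>The radius s and the polynomials v depend only on \<psi>, not on w, n or r. The
  expansion is that of exp(w^2 g(z)) in z with w fixed, evaluated at z = w / sqrt n.\<close>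

lemma power_expansion_near_0:
  assumes hol: "\<psi> holomorphic_on UNIV" and "\<psi> 0 = 1"
    and d1: "deriv \<psi> 0 = 0" and d2: "deriv (deriv \<psi>) 0 = 1"
    and cnj: "\<And>z. \<psi> (cnj z) = cnj (\<psi> z)"
  obtains s v where "s > 0" "v 0 = 1"
    "\<And>k w. norm (cpoly (v k) w) \<le> exp ((norm w)\<^sup>2 / 8) / s ^ k"
    "\<And>n (w::complex) r. n > 0 \<Longrightarrow> norm w \<le> s / 2 * sqrt (real n) \<Longrightarrow>
      norm (\<psi> (w / sqrt n) ^ n * exp (- w\<^sup>2 / 2) - (\<Sum>k\<le>r. (w / sqrt n) ^ k * cpoly (v k) w))
        \<le> 2 * exp ((norm w)\<^sup>2 / 8) * (norm w / (s * sqrt n)) ^ Suc r"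
proof -
  obtain \<rho> g where g: "\<rho> > 0" "g holomorphic_on ball 0 \<rho>" "conj_sym \<rho> g" "g 0 = 0"
    "\<And>z. z \<in> ball 0 \<rho> \<Longrightarrow> \<psi> z = exp (z\<^sup>2 / 2 + z\<^sup>2 * g z)"
    using ex_log_expansion[OF assms] by blast
  have "isCont g 0"
    using g(1,2) by (metis centre_in_ball continuous_on_eq_continuous_at holomorphic_on_imp_continuous_on open_ball)
  \<comment> \<open>Any bound on |g| below 1/2 would leave a decaying Gaussian after multiplication
    by exp(-t^2/2); 1/8 leaves exp(-3 t^2/8).\<close>
  then obtain s0 where "s0 > 0" and s0: "\<And>z. dist z 0 < s0 \<Longrightarrow> dist (g z) 0 < 1 / 8"
    unfolding continuous_at_eps_delta g(4) by (metis zero_less_divide_1_iff zero_less_numeral)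
  define s where "s = min s0 \<rho> / 2"
  have s: "0 < s" "s < \<rho>" "s < s0" using \<open>s0 > 0\<close> g(1) by (auto simp: s_def)
  obtain V where V: "\<And>k w. (deriv ^^ k) (\<lambda>z. exp (w\<^sup>2 * g z)) 0 = cpoly (V k) w"
    using higher_deriv_exp_poly[OF g(1-4)] by metis
  \<comment> \<open>The case k = 0 is separated so that v 0 is syntactically 1; \<open>V 0\<close>
    is specified only through its values.\<close>
  define v where "v = (\<lambda>k. if k = 0 then 1 else smult (1 / fact k) (V k))"
  have v: "(deriv ^^ k) (\<lambda>z. exp (w\<^sup>2 * g z)) 0 / fact k = cpoly (v k) w" for k w
  proof (cases "k = 0")
    case True
    then show ?thesis using g(4) by (simp add: v_def)
  next
    case False
    then show ?thesis by (simp add: v_def V)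
  qed
  have hol: "(\<lambda>z. exp (w\<^sup>2 * g z)) holomorphic_on ball 0 \<rho>" for w
    by (intro holomorphic_intros g(2))
  have bound: "norm (exp (w\<^sup>2 * g z)) \<le> exp ((norm w)\<^sup>2 / 8)" if "norm z = s" for w z
  proof -
    have "norm (g z) \<le> 1 / 8" using s0[of z] that s by simp
    then have "norm (w\<^sup>2 * g z) \<le> (norm w)\<^sup>2 * (1 / 8)"
      unfolding norm_mult norm_power by (intro mult_left_mono) auto
    then have "exp (norm (w\<^sup>2 * g z)) \<le> exp ((norm w)\<^sup>2 / 8)" by simp
    with norm_exp[of "w\<^sup>2 * g z"] show ?thesis by (rule order_trans)
  qed
  show ?thesis
  proof (rule that[of s v])
    show "s > 0" by fact
    show "v 0 = 1" by (simp add: v_def)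
    show "norm (cpoly (v k) w) \<le> exp ((norm w)\<^sup>2 / 8) / s ^ k" for k w
    proof -
      have "norm ((deriv ^^ k) (\<lambda>z. exp (w\<^sup>2 * g z)) 0 / fact k) \<le> exp ((norm w)\<^sup>2 / 8) / s ^ k"
        by (rule Taylor_remainder_Cauchy(2)[OF hol[of w] s(1,2) bound, where z = 0]) (use s in auto)
      then show ?thesis by (simp add: v)
    qed
    fix n r :: nat and w :: complex
    assume n: "n > 0" and w: "norm w \<le> s / 2 * sqrt (real n)"
    let ?z = "w / complex_of_real (sqrt n)"
    have nz: "norm ?z = norm w / sqrt n" by (simp add: norm_divide)
    then have z: "norm ?z \<le> s / 2" using w n by (simp add: divide_le_eq)
    have nz2: "of_nat n * ?z\<^sup>2 = w\<^sup>2" using n by (simp add: power_divide flip: of_real_power)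
    have "\<psi> ?z ^ n = exp (of_nat n * (?z\<^sup>2 / 2 + ?z\<^sup>2 * g ?z))"
      using g(5)[of ?z] z s by (simp add: exp_of_nat_mult)
    also have "of_nat n * (?z\<^sup>2 / 2 + ?z\<^sup>2 * g ?z) = w\<^sup>2 / 2 + w\<^sup>2 * g ?z"
      using nz2 by (metis (no_types, opaque_lifting) distrib_left mult.assoc times_divide_eq_right)
    finally have "\<psi> ?z ^ n * exp (- w\<^sup>2 / 2) = exp (w\<^sup>2 * g ?z)"
      by (simp add: exp_add exp_minus)
    moreover have "norm (exp (w\<^sup>2 * g ?z) - (\<Sum>k\<le>r. cpoly (v k) w * ?z ^ k))
       \<le> 2 * exp ((norm w)\<^sup>2 / 8) * (norm ?z / s) ^ Suc r"
      using Taylor_remainder_Cauchy(1)[OF hol[of w] s(1,2) bound z, of r] unfolding v .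
    ultimately show "norm (\<psi> ?z ^ n * exp (- w\<^sup>2 / 2) - (\<Sum>k\<le>r. ?z ^ k * cpoly (v k) w))
        \<le> 2 * exp ((norm w)\<^sup>2 / 8) * (norm w / (s * sqrt n)) ^ Suc r"
      by (simp add: nz mult_ac)
  qed
qed

section \<open>Edgeworth sums\<close>

lemma isCont_std_normal_density: "isCont std_normal_density x"
  unfolding std_normal_density_def by (intro continuous_intros) auto

text \<open>The fundamental theorem needs a finite base point, so the integral is split at z - 1 and
  only the part beyond it is differentiated.\<close>

lemma DERIV_normal_cdf: "(normal_cdf has_real_derivative std_normal_density z) (at z)"
proof -
  have int: "set_integrable lborel A std_normal_density" if "A \<in> sets borel" for A
    unfolding set_integrable_def
    using that integrable_std_normal_poly[of 1] by (intro integrable_mult_indicator) auto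
  have cont: "continuous_on {z - 1..z + 1} std_normal_density"
    by (intro continuous_at_imp_continuous_on ballI isCont_std_normal_density)
  have eq: "normal_cdf (z - 1) + integral {z - 1..y} std_normal_density = normal_cdf y"
    if "y \<in> {z - 1<..<z + 1}" for y
  proof -
    have "normal_cdf y = (LBINT y:{..z - 1} \<union> {z - 1<..y}. std_normal_density y)"
      unfolding normal_cdf_def using that by (intro arg_cong[where f="\<lambda>A. set_lebesgue_integral lborel A _"]) auto
    also have "\<dots> = normal_cdf (z - 1) + (LBINT y:{z - 1<..y}. std_normal_density y)"
      unfolding normal_cdf_def by (intro set_integral_Un int) auto
    also have "(LBINT y:{z - 1<..y}. std_normal_density y) = (LBINT y:{z - 1..y}. std_normal_density y)"
      unfolding set_lebesgue_integral_def
    proof (rule integral_cong_AE)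
      show "AE x in lborel. indicator {z - 1<..y} x *\<^sub>R std_normal_density x = indicator {z - 1..y} x *\<^sub>R std_normal_density x"
        using AE_lborel_singleton[of "z - 1"] by eventually_elim (auto simp: indicator_def)
    qed auto
    also have "\<dots> = integral {z - 1..y} std_normal_density"
      by (intro set_borel_integral_eq_integral int) auto
    finally show ?thesis by simp
  qed
  have "((\<lambda>y. integral {z - 1..y} std_normal_density) has_real_derivative std_normal_density z)
      (at z within {z - 1..z + 1})"
    by (rule integral_has_real_derivative[OF cont]) auto
  then have "((\<lambda>y. integral {z - 1..y} std_normal_density) has_real_derivative std_normal_density z) (at z)"
    by (simp add: at_within_Icc_at)
  then have "((\<lambda>y. normal_cdf (z - 1) + integral {z - 1..y} std_normal_density) has_real_derivative std_normal_density z) (at z)"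
    by (auto intro!: derivative_eq_intros)
  then show ?thesis
    by (rule has_field_derivative_transform_within_open[where S="{z - 1<..<z + 1}"]) (use eq in auto)
qed

text \<open>The derivative of the Edgeworth sum divided by the normal density.\<close>

definition edgeworth_density_poly :: "(nat \<Rightarrow> real poly) \<Rightarrow> nat \<Rightarrow> nat \<Rightarrow> real poly" where
  "edgeworth_density_poly P r n =
     1 + (\<Sum>k=1..r. smult (real n powr (- real k / 2)) (pderiv (P k) - pCons 0 (P k)))"

lemma DERIV_edgeworth_sum:
  "(edgeworth_sum P r n has_real_derivative
     std_normal_density z * poly (edgeworth_density_poly P r n) z) (at z)"
proof -
  have eq: "edgeworth_sum P r n = (\<lambda>z. normal_cdf z
     + (\<Sum>k=1..r. real n powr (- real k / 2) * (std_normal_density z * poly (P k) z)))"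
    by (simp add: fun_eq_iff edgeworth_sum_def sum_distrib_left mult_ac)
  have "((\<lambda>z. normal_cdf z
     + (\<Sum>k=1..r. real n powr (- real k / 2) * (std_normal_density z * poly (P k) z))) has_real_derivative
     std_normal_density z + (\<Sum>k=1..r. real n powr (- real k / 2) *
       (std_normal_density z * poly (pderiv (P k) - pCons 0 (P k)) z))) (at z)"
    by (intro DERIV_add DERIV_normal_cdf DERIV_sum DERIV_cmult DERIV_std_normal_poly)
  then show ?thesis
    unfolding eq edgeworth_density_poly_def
    by (simp add: poly_sum sum_distrib_left algebra_simps)
qed

lemma deriv_edgeworth_sum:
  "deriv (edgeworth_sum P r n) = (\<lambda>z. std_normal_density z * poly (edgeworth_density_poly P r n) z)"
  using DERIV_imp_deriv[OF DERIV_edgeworth_sum] by blast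

definition gauss_Fourier :: "real poly \<Rightarrow> real \<Rightarrow> complex" where
  "gauss_Fourier q t = (CLBINT x. iexp (t * x) * complex_of_real (std_normal_density x * poly q x))"

lemma gauss_Fourier_add: "gauss_Fourier (p + q) t = gauss_Fourier p t + gauss_Fourier q t"
proof -
  have int: "integrable lborel (\<lambda>x. iexp (t * x) * complex_of_real (std_normal_density x * poly q x))" for q
    by (intro integrable_iexp_mult integrable_std_normal_poly) auto
  show ?thesis
    unfolding gauss_Fourier_def
    by (subst Bochner_Integration.integral_add[OF int int, symmetric]) (simp add: ring_distribs)
qed

lemma gauss_Fourier_smult: "gauss_Fourier (smult a q) t = of_real a * gauss_Fourier q t"
  unfolding gauss_Fourier_def
  by (subst integral_mult_right_zero[symmetric]) (simp add: mult_ac)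

lemma gauss_Fourier_diff: "gauss_Fourier (p - q) t = gauss_Fourier p t - gauss_Fourier q t"
  using gauss_Fourier_add[of p "smult (-1) q" t] gauss_Fourier_smult[of "-1" q t] by simp

lemma gauss_Fourier_0 [simp]: "gauss_Fourier 0 t = 0"
  by (simp add: gauss_Fourier_def)

lemma gauss_Fourier_sum: "gauss_Fourier (\<Sum>i\<in>A. f i) t = (\<Sum>i\<in>A. gauss_Fourier (f i) t)"
  by (induction A rule: infinite_finite_induct) (auto simp: gauss_Fourier_add)

lemma gauss_Fourier_by_parts: "gauss_Fourier (pderiv q - pCons 0 q) t = - \<i> * t * gauss_Fourier q t"
  unfolding gauss_Fourier_def by (rule std_normal_poly_by_parts)

lemma gauss_Fourier_1: "gauss_Fourier 1 t = complex_of_real (exp (- (t\<^sup>2) / 2))"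
  using gauss_pair_1 by (simp add: gauss_pair_def gauss_Fourier_def)

lemma fourier_stieltjes_edgeworth_sum:
  "fourier_stieltjes (edgeworth_sum P r n) t = complex_of_real (exp (- (t\<^sup>2) / 2))
     - \<i> * t * (\<Sum>k=1..r. complex_of_real (real n powr (- real k / 2)) * gauss_Fourier (P k) t)"
proof -
  have "fourier_stieltjes (edgeworth_sum P r n) t = gauss_Fourier (edgeworth_density_poly P r n) t"
    unfolding fourier_stieltjes_def deriv_edgeworth_sum gauss_Fourier_def ..
  also have "\<dots> = complex_of_real (exp (- (t\<^sup>2) / 2)) + (\<Sum>k=1..r. complex_of_real (real n powr (- real k / 2)) *
      (- \<i> * t * gauss_Fourier (P k) t))"
    unfolding edgeworth_density_poly_def gauss_Fourier_add gauss_Fourier_1 gauss_Fourier_sum gauss_Fourier_smult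
      gauss_Fourier_by_parts ..
  finally show ?thesis by (simp add: sum_distrib_left mult_ac sum_negf)
qed

text \<open>Strong induction on k: once the earlier coefficients vanish, multiplying the sum by
  n^(k/2) makes it converge to x k, whereas the o-condition and k <= r force the limit 0.\<close>

lemma asymptotic_coefficients_eq_0:
  fixes x :: "nat \<Rightarrow> complex"
  assumes "(\<lambda>n. \<Sum>k=1..r. complex_of_real (real n powr (- real k / 2)) * x k)
    \<in> o(\<lambda>n. complex_of_real (real n powr (- real r / 2)))"
  shows "k \<in> {1..r} \<Longrightarrow> x k = 0"
proof (induction k rule: less_induct)
  case (less k)
  define S where "S = (\<lambda>n. \<Sum>j=1..r. complex_of_real (real n powr (- real j / 2)) * x j)"
  define c where "c = (\<lambda>n. complex_of_real (real n powr (real k / 2)))"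
  have "(\<lambda>n. S n * c n) \<in> o(\<lambda>n. complex_of_real (real n powr (- real r / 2)) * c n)"
    using assms unfolding S_def by (rule landau_o.small_big_mult) simp
  also have "(\<lambda>n. complex_of_real (real n powr (- real r / 2)) * c n) \<in> O(\<lambda>_. 1)"
  proof (rule bigoI[where c=1])
    show "\<forall>\<^sub>F n in sequentially. norm (complex_of_real (real n powr (- real r / 2)) * c n) \<le> 1 * norm (1::complex)"
      using eventually_ge_at_top[of 1]
    proof eventually_elim
      case (elim n)
      have "real n powr (- real r / 2 + real k / 2) \<le> real n powr 0"
        using elim less.prems by (intro powr_mono) auto
      then show ?case using elim by (simp add: c_def norm_mult powr_add[symmetric])
    qed
  qed
  finally have lim0: "(\<lambda>n. S n * c n) \<longlonglongrightarrow> 0"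
    by (auto dest: smalloD_tendsto)
  \<comment> \<open>Terms with j < k are replaced by 0 beforehand, because their factor n^((k-j)/2)
    diverges; the induction hypothesis justifies this only through x j = 0.\<close>
  have "(\<lambda>n. \<Sum>j=1..r. (if j < k then 0 else if j = k then x k else
      complex_of_real (real n powr ((real k - real j) / 2)) * x j)) \<longlonglongrightarrow>
      (\<Sum>j=1..r. if j = k then x k else 0)"
  proof (rule tendsto_sum)
    fix j
    show "(\<lambda>n. if j < k then 0 else if j = k then x k else
      complex_of_real (real n powr ((real k - real j) / 2)) * x j) \<longlonglongrightarrow> (if j = k then x k else 0)"
    proof (cases "j > k")
      case True
      have "(\<lambda>n. real n powr ((real k - real j) / 2)) \<longlonglongrightarrow> 0"
        using True by (intro tendsto_neg_powr filterlim_real_sequentially) auto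
      then have "(\<lambda>n. complex_of_real (real n powr ((real k - real j) / 2)) * x j) \<longlonglongrightarrow> of_real 0 * x j"
        by (intro tendsto_intros)
      then show ?thesis using True by simp
    qed auto
  qed
  also have "(\<Sum>j=1..r. if j = k then x k else 0) = x k" using less.prems by simp
  finally have "(\<lambda>n. \<Sum>j=1..r. (if j < k then 0 else if j = k then x k else
      complex_of_real (real n powr ((real k - real j) / 2)) * x j)) \<longlonglongrightarrow> x k" .
  moreover have "\<forall>\<^sub>F n in sequentially. (\<Sum>j=1..r. (if j < k then 0 else if j = k then x k else
      complex_of_real (real n powr ((real k - real j) / 2)) * x j)) = S n * c n"
    using eventually_ge_at_top[of 1]
  proof eventually_elim
    case (elim n)
    show ?case
      unfolding S_def sum_distrib_right
    proof (intro sum.cong refl)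
      fix j assume j: "j \<in> {1..r}"
      have "real n powr (- real j / 2) * real n powr (real k / 2) = real n powr ((real k - real j) / 2)"
        by (simp add: powr_add[symmetric] diff_divide_distrib)
      then have "complex_of_real (real n powr (- real j / 2)) * x j * c n =
          complex_of_real (real n powr ((real k - real j) / 2)) * x j"
        unfolding c_def by (metis (no_types, lifting) mult.assoc mult.commute of_real_mult)
      moreover have "x j = 0" if "j < k" using less.IH[OF that j] .
      ultimately show "(if j < k then 0 else if j = k then x k else
        complex_of_real (real n powr ((real k - real j) / 2)) * x j) =
        complex_of_real (real n powr (- real j / 2)) * x j * c n"
        using elim by auto
    qed
  qed
  ultimately have "(\<lambda>n. S n * c n) \<longlonglongrightarrow> x k" by (rule Lim_transform_eventually)
  then show ?case using lim0 LIMSEQ_unique by blast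
qed

text \<open>Subtracting the two o-conditions cancels the characteristic function, so nothing about
  \<mu> is required. What remains is a sum of powers n^(-k/2), whose coefficients vanish one by one
  for each t.\<close>

lemma is_edgeworth_polys_unique:
  assumes P: "is_edgeworth_polys \<mu> r P" and Q: "is_edgeworth_polys \<mu> r Q"
  shows "P = Q"
proof
  fix k
  show "P k = Q k"
  proof (cases "k \<in> {1..r}")
    case False
    then show ?thesis using P Q unfolding is_edgeworth_polys_def by metis
  next
    case True
    have "P k - Q k = 0"
    proof (rule poly_eq_0_if_gauss_Fourier_eq_0, fold gauss_Fourier_def)
      fix t :: real assume "t \<noteq> 0"
      have "(\<lambda>n. (char \<mu> (t / (std_dev \<mu> * sqrt (real n))) ^ n - fourier_stieltjes (edgeworth_sum Q r n) t)
          - (char \<mu> (t / (std_dev \<mu> * sqrt (real n))) ^ n - fourier_stieltjes (edgeworth_sum P r n) t))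
        \<in> o(\<lambda>n. complex_of_real (real n powr (- real r / 2)))"
        by (rule sum_in_smallo(2)) (use P Q in \<open>unfold is_edgeworth_polys_def, blast+\<close>)
      also have "(\<lambda>n. (char \<mu> (t / (std_dev \<mu> * sqrt (real n))) ^ n - fourier_stieltjes (edgeworth_sum Q r n) t)
          - (char \<mu> (t / (std_dev \<mu> * sqrt (real n))) ^ n - fourier_stieltjes (edgeworth_sum P r n) t)) =
        (\<lambda>n. \<Sum>k=1..r. complex_of_real (real n powr (- real k / 2)) * (- \<i> * t * gauss_Fourier (P k - Q k) t))"
        unfolding fourier_stieltjes_edgeworth_sum gauss_Fourier_diff
        by (simp add: fun_eq_iff sum_distrib_left ring_distribs sum_subtractf sum_negf mult_ac)
      finally have "- \<i> * t * gauss_Fourier (P k - Q k) t = 0"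
        by (rule asymptotic_coefficients_eq_0) (use True in simp)
      then show "gauss_Fourier (P k - Q k) t = 0" using \<open>t \<noteq> 0\<close> by simp
    qed
    then show ?thesis by simp
  qed
qed

section \<open>The Edgeworth sum as distribution function of a signed measure\<close>

lemma cumulative_std_normal_poly:
  "(LBINT y:{..x}. std_normal_density y * poly (pderiv q - pCons 0 q) y) = std_normal_density x * poly q x"
proof -
  have "(LBINT y=-\<infinity>..ereal x. std_normal_density y * poly (pderiv q - pCons 0 q) y) = std_normal_density x * poly q x - 0"
  proof (rule interval_integral_FTC_integrable)
    show "((\<lambda>x. std_normal_density x * poly q x) has_vector_derivative std_normal_density y * poly (pderiv q - pCons 0 q) y) (at y)" for y
      using DERIV_std_normal_poly by (simp flip: has_real_derivative_iff_has_vector_derivative)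
    show "isCont (\<lambda>y. std_normal_density y * poly (pderiv q - pCons 0 q) y) y" for y
      by (intro continuous_intros isCont_std_normal_density)
    show "set_integrable lborel (einterval (-\<infinity>) (ereal x)) (\<lambda>y. std_normal_density y * poly (pderiv q - pCons 0 q) y)"
      unfolding set_integrable_def by (intro integrable_mult_indicator integrable_std_normal_poly) auto
    show "(((\<lambda>x. std_normal_density x * poly q x) \<circ> real_of_ereal) \<longlongrightarrow> 0) (at_right (-\<infinity>))"
      using tendsto_std_normal_poly by (simp add: ereal_tendsto_simps)
    have "isCont (\<lambda>x. std_normal_density x * poly q x) x"
      by (intro continuous_intros isCont_std_normal_density)
    then show "(((\<lambda>x. std_normal_density x * poly q x) \<circ> real_of_ereal) \<longlongrightarrow> std_normal_density x * poly q x) (at_left (ereal x))"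
      by (simp add: ereal_tendsto_simps isCont_def filterlim_at_split)
  qed simp
  also have "(LBINT y=-\<infinity>..ereal x. std_normal_density y * poly (pderiv q - pCons 0 q) y) =
     (LBINT y:{..<x}. std_normal_density y * poly (pderiv q - pCons 0 q) y)"
    by (simp add: interval_lebesgue_integral_def einterval_eq)
  also have "\<dots> = (LBINT y:{..x}. std_normal_density y * poly (pderiv q - pCons 0 q) y)"
    unfolding set_lebesgue_integral_def
  proof (rule integral_cong_AE)
    show "AE y in lborel. indicator {..<x} y *\<^sub>R (std_normal_density y * poly (pderiv q - pCons 0 q) y) =
      indicator {..x} y *\<^sub>R (std_normal_density y * poly (pderiv q - pCons 0 q) y)"
      using AE_lborel_singleton[of x] by eventually_elim (auto simp: indicator_def)
  qed (use borel_measurable_integrable[OF integrable_std_normal_poly] in measurable)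
  finally show ?thesis by simp
qed

text \<open>This makes the Edgeworth sum a \<open>cumulative\<close> function, the form in which
  Esseen's inequality takes it. By linearity in the density polynomial only the summands q' - x q
  need an antiderivative.\<close>

lemma edgeworth_sum_eq_integral:
  "edgeworth_sum P r n x = (LBINT y:{..x}. std_normal_density y * poly (edgeworth_density_poly P r n) y)"
proof -
  define G where "G = (\<lambda>q. LBINT y:{..x}. std_normal_density y * poly q y)"
  have int: "set_integrable lborel {..x} (\<lambda>y. std_normal_density y * poly q y)" for q
    unfolding set_integrable_def by (intro integrable_mult_indicator integrable_std_normal_poly) auto
  have G_add: "G (p + q) = G p + G q" for p q
    unfolding G_def by (subst set_integral_add(2)[OF int int, symmetric]) (simp add: ring_distribs)
  have G_smult: "G (smult c q) = c * G q" for c q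
    unfolding G_def by (subst set_integral_mult_right[symmetric]) (simp add: mult_ac)
  have G_sum: "G (\<Sum>i\<in>A. f i) = (\<Sum>i\<in>A. G (f i))" for A :: "nat set" and f
    by (induction A rule: infinite_finite_induct) (auto simp: G_add, auto simp: G_def)
  have G_parts: "G (pderiv q - pCons 0 q) = std_normal_density x * poly q x" for q
    unfolding G_def by (rule cumulative_std_normal_poly)
  have "G (edgeworth_density_poly P r n) = G 1 + (\<Sum>k=1..r. real n powr (- real k / 2) * (std_normal_density x * poly (P k) x))"
    unfolding edgeworth_density_poly_def G_add G_sum G_smult G_parts ..
  also have "\<dots> = edgeworth_sum P r n x"
    by (simp add: edgeworth_sum_def normal_cdf_def G_def sum_distrib_left mult_ac)
  finally show ?thesis unfolding G_def ..
qed

lemma std_normal_poly_bounded: "\<exists>m\<ge>0. \<forall>x. \<bar>std_normal_density x * poly q x\<bar> \<le> m"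
proof -
  let ?f = "\<lambda>x. std_normal_density x * poly q x"
  have "\<forall>\<^sub>F x in at_top. \<bar>?f x\<bar> < 1" "\<forall>\<^sub>F x in at_bot. \<bar>?f x\<bar> < 1"
    using order_tendstoD(2)[OF tendsto_rabs_zero[OF tendsto_std_normal_poly(1)], of 1]
      order_tendstoD(2)[OF tendsto_rabs_zero[OF tendsto_std_normal_poly(2)], of 1] by simp_all
  then obtain b a where ab: "\<And>x. x \<ge> b \<Longrightarrow> \<bar>?f x\<bar> < 1" "\<And>x. x \<le> a \<Longrightarrow> \<bar>?f x\<bar> < 1"
    unfolding eventually_at_top_linorder eventually_at_bot_linorder by blast
  have "continuous_on {a..b} ?f"
    by (intro continuous_at_imp_continuous_on ballI continuous_intros isCont_std_normal_density)
  then have "bounded (?f ` {a..b})" by (intro compact_imp_bounded compact_continuous_image) auto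
  then obtain m where "\<forall>y\<in>?f ` {a..b}. norm y \<le> m"
    unfolding bounded_iff by blast
  then have m: "\<bar>?f x\<bar> \<le> m" if "x \<in> {a..b}" for x
    using that by simp
  show ?thesis
  proof (intro exI[of _ "max 1 m"] conjI allI)
    fix x
    show "\<bar>?f x\<bar> \<le> max 1 m"
      using ab(1)[of x] ab(2)[of x] m[of x] by (cases "x \<ge> b"; cases "x \<le> a") (auto simp: le_max_iff_disj)
  qed simp
qed

section \<open>Decay of the characteristic function\<close>

lemma integral_step_law:
  fixes g :: "real \<Rightarrow> 'b::{banach, second_countable_topology}"
  assumes "(a, p) \<in> Omega d" and [measurable]: "g \<in> borel_measurable borel"
  shows "integral\<^sup>L (step_law d a p) g = (\<Sum>j=1..d+1. p j *\<^sub>R g (a j))"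
proof -
  have p: "\<And>j. j \<in> {1..d+1} \<Longrightarrow> 0 \<le> p j"
    using assms(1) by (force simp: Omega_def intro: less_imp_le)
  have "integral\<^sup>L (step_law d a p) g = integral\<^sup>L (point_measure {1..d+1} (\<lambda>j. ennreal (p j))) (\<lambda>j. g (a j))"
    unfolding step_law_def by (rule integral_distr) (auto simp: point_measure_def)
  also have "\<dots> = (\<Sum>j=1..d+1. p j *\<^sub>R g (a j))"
    using p by (intro lebesgue_integral_point_measure_finite) auto
  finally show ?thesis .
qed

lemma char_step_law:
  assumes "(a, p) \<in> Omega d"
  shows "char (step_law d a p) s = (\<Sum>j=1..d+1. complex_of_real (p j) * iexp (s * a j))"
  unfolding char_def by (subst integral_step_law[OF assms]) (auto simp: scaleR_conv_of_real)

lemma std_dev_step_law: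
  assumes "(a, p) \<in> Omega d"
  shows "std_dev (step_law d a p) = sqrt (\<Sum>j=1..d+1. p j * (a j)\<^sup>2)"
proof -
  have mean: "(LINT x|step_law d a p. x) = 0"
    using assms by (subst integral_step_law[OF assms]) (auto simp: Omega_def)
  show ?thesis
    unfolding std_dev_def mean by (subst integral_step_law[OF assms]) auto
qed

abbreviation two_pi_Z :: "real set" where
  "two_pi_Z \<equiv> range (\<lambda>k::int. 2 * pi * of_int k)"

text \<open>Multiplication by m maps the lattice into itself. This transfers the Diophantine bound
  from m s back to s when |s| <= 1, where it is not assumed directly.\<close>

lemma infdist_two_pi_Z_mult:
  "infdist (real m * x) two_pi_Z \<le> real m * infdist x two_pi_Z"
proof (cases "m = 0")
  case False
  have inf: "infdist x two_pi_Z = (INF z\<in>two_pi_Z. dist x z)" unfolding infdist_def by simp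
  have "infdist (real m * x) two_pi_Z / real m \<le> infdist x two_pi_Z"
    unfolding inf
  proof (rule cINF_greatest)
    fix z assume "z \<in> two_pi_Z"
    then obtain k :: int where z: "z = 2 * pi * of_int k" by blast
    have "infdist (real m * x) two_pi_Z \<le> dist (real m * x) (2 * pi * of_int (int m * k))"
      by (intro infdist_le rangeI)
    also have "\<dots> = real m * dist x (2 * pi * of_int k)"
    proof -
      have "real m * x - 2 * pi * of_int (int m * k) = real m * (x - 2 * pi * of_int k)"
        by (simp add: algebra_simps)
      then show ?thesis by (simp add: dist_real_def abs_mult)
    qed
    finally show "infdist (real m * x) two_pi_Z / real m \<le> dist x z"
      unfolding z using False by (simp add: divide_le_eq mult.commute)
  qed simp
  then show ?thesis using False by (simp add: divide_le_eq mult.commute)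
qed (use infdist_zero[of 0 two_pi_Z] in \<open>auto intro!: image_eqI[of _ _ 0]\<close>)

text \<open>Subtracting the nearest lattice point moves the argument into [-pi, pi] without changing
  the cosine.\<close>

lemma one_minus_cos_ge_infdist: "(infdist x two_pi_Z)\<^sup>2 / 8 \<le> 1 - cos x"
proof -
  define k where "k = round (x / (2 * pi))"
  define y where "y = x - 2 * pi * of_int k"
  have "\<bar>of_int k - x / (2 * pi)\<bar> \<le> 1 / 2" unfolding k_def by (rule of_int_round_abs_le)
  then have "2 * pi * \<bar>of_int k - x / (2 * pi)\<bar> \<le> 2 * pi * (1 / 2)" by (intro mult_left_mono) auto
  moreover have "2 * pi * \<bar>of_int k - x / (2 * pi)\<bar> = \<bar>y\<bar>"
  proof -
    have "2 * pi * (of_int k - x / (2 * pi)) = - y" by (simp add: y_def right_diff_distrib)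
    then have "\<bar>2 * pi * (of_int k - x / (2 * pi))\<bar> = \<bar>y\<bar>" by simp
    then show ?thesis by (simp add: abs_mult)
  qed
  ultimately have y: "\<bar>y\<bar> \<le> pi" by simp
  have "infdist x two_pi_Z \<le> dist x (2 * pi * of_int k)" by (intro infdist_le) auto
  then have "(infdist x two_pi_Z)\<^sup>2 \<le> \<bar>y\<bar>\<^sup>2"
    by (intro power_mono infdist_nonneg) (simp add: y_def dist_real_def)
  then have "(infdist x two_pi_Z)\<^sup>2 / 8 \<le> y\<^sup>2 / 8" by simp
  also have "\<dots> \<le> 1 - cos y" by (rule one_minus_cos_ge[OF y])
  also have "cos y = cos x"
  proof -
    have "y = x + 2 * pi * of_int (- k)" by (simp add: y_def)
    then show ?thesis by (simp only: cos_add cos_int_2pin sin_int_2pin)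
  qed
  finally show ?thesis .
qed

lemma dist_lattice_attained:
  assumes "d \<ge> 1"
  obtains j where "j \<in> {2..d+1}" "dist_lattice d a s = infdist ((a j - a 1) * s) two_pi_Z"
proof -
  have "dist_lattice d a s \<in> (\<lambda>j. infdist ((a j - a 1) * s) two_pi_Z) ` {2..d+1}"
    unfolding dist_lattice_def using assms by (intro Max_in) auto
  then show ?thesis using that by blast
qed

lemma dist_lattice_mult:
  assumes "d \<ge> 1"
  shows "dist_lattice d a (real m * s) \<le> real m * dist_lattice d a s"
proof -
  obtain j where j: "j \<in> {2..d+1}" "dist_lattice d a (real m * s) = infdist ((a j - a 1) * (real m * s)) two_pi_Z"
    using dist_lattice_attained[OF assms] by blast
  have "infdist ((a j - a 1) * (real m * s)) two_pi_Z = infdist (real m * ((a j - a 1) * s)) two_pi_Z"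
    by (simp add: mult_ac)
  also have "\<dots> \<le> real m * infdist ((a j - a 1) * s) two_pi_Z" by (rule infdist_two_pi_Z_mult)
  also have "\<dots> \<le> real m * dist_lattice d a s"
    unfolding dist_lattice_def using j(1) by (intro mult_left_mono Max_ge) auto
  finally show ?thesis using j by simp
qed

text \<open>With x = q1 q2 (1 - cos(\<theta>2 - \<theta>1)) the squared norm is exactly (q1 + q2)^2
  - 2 x, and q1 + q2 <= 1 lets this be bounded by (q1 + q2 - x)^2.\<close>

lemma norm_two_point_le:
  fixes q1 q2 \<theta>1 \<theta>2 :: real
  assumes "0 < q1" "0 < q2" "q1 + q2 \<le> 1"
  shows "norm (of_real q1 * iexp \<theta>1 + of_real q2 * iexp \<theta>2) \<le> q1 + q2 - q1 * q2 * (1 - cos (\<theta>2 - \<theta>1))"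
proof (rule power2_le_imp_le)
  define x where "x = q1 * q2 * (1 - cos (\<theta>2 - \<theta>1))"
  have x0: "0 \<le> x" using assms by (simp add: x_def)
  have "(norm (of_real q1 * iexp \<theta>1 + of_real q2 * iexp \<theta>2))\<^sup>2 =
     (q1 * cos \<theta>1 + q2 * cos \<theta>2)\<^sup>2 + (q1 * sin \<theta>1 + q2 * sin \<theta>2)\<^sup>2"
    by (simp add: cmod_power2 Re_exp Im_exp)
  also have "\<dots> = q1\<^sup>2 * ((cos \<theta>1)\<^sup>2 + (sin \<theta>1)\<^sup>2) + q2\<^sup>2 * ((cos \<theta>2)\<^sup>2 + (sin \<theta>2)\<^sup>2)
     + 2 * q1 * q2 * (cos \<theta>2 * cos \<theta>1 + sin \<theta>2 * sin \<theta>1)"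
    by algebra
  also have "\<dots> = (q1 + q2)\<^sup>2 - 2 * x"
    by (simp add: x_def cos_diff power2_eq_square algebra_simps)
  also have "\<dots> \<le> (q1 + q2 - x)\<^sup>2"
  proof -
    have "0 \<le> 2 * x * (1 - (q1 + q2)) + x\<^sup>2" using x0 assms by simp
    then show ?thesis by (simp add: power2_eq_square algebra_simps)
  qed
  finally show "(norm (of_real q1 * iexp \<theta>1 + of_real q2 * iexp \<theta>2))\<^sup>2
      \<le> (q1 + q2 - q1 * q2 * (1 - cos (\<theta>2 - \<theta>1)))\<^sup>2" by (simp add: x_def)
  have "x \<le> q1 * q2 * 2" unfolding x_def using assms by (intro mult_left_mono) auto
  moreover have "q1 * q2 \<le> q1 * 1" "q1 * q2 \<le> 1 * q2" using assms by (auto intro!: mult_left_mono mult_right_mono)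
  ultimately show "0 \<le> q1 + q2 - q1 * q2 * (1 - cos (\<theta>2 - \<theta>1))" unfolding x_def by linarith
qed

text \<open>Cancellation is taken from two atoms only: a 1 and the a j whose difference to it
  attains the maximum in \<open>dist_lattice\<close>. The others enter by the triangle inequality; q
  is the smallest probability.\<close>

lemma norm_char_step_law_le:
  assumes om: "(a, p) \<in> Omega d" and "d \<ge> 1"
  obtains c where "c > 0" "\<And>s. norm (char (step_law d a p) s) \<le> 1 - c * (dist_lattice d a s)\<^sup>2"
proof -
  have p: "\<And>j. j \<in> {1..d+1} \<Longrightarrow> 0 < p j" and sum1: "(\<Sum>j=1..d+1. p j) = 1"
    using om by (auto simp: Omega_def)
  define q where "q = Min (p ` {1..d+1})"
  have "q \<in> p ` {1..d+1}" unfolding q_def by (intro Min_in) auto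
  then have q: "q > 0" using p by auto
  have q_le: "q \<le> p j" if "j \<in> {1..d+1}" for j unfolding q_def using that by (intro Min_le) auto
  show thesis
  proof (rule that[of "q\<^sup>2 / 8"])
    fix s
    obtain j where j: "j \<in> {2..d+1}" "dist_lattice d a s = infdist ((a j - a 1) * s) two_pi_Z"
      using dist_lattice_attained[OF \<open>d \<ge> 1\<close>] by blast
    let ?J = "{1..d+1} - {1, j}"
    have split: "(\<Sum>i=1..d+1. f i) = f 1 + f j + sum f ?J" for f :: "nat \<Rightarrow> 'x::comm_monoid_add"
      using j by (subst sum.subset_diff[of "{1, j}"]) (auto simp: add_ac)
    have "norm (char (step_law d a p) s) \<le> norm (of_real (p 1) * iexp (s * a 1) + of_real (p j) * iexp (s * a j))
       + norm (\<Sum>i\<in>?J. of_real (p i) * iexp (s * a i))"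
      unfolding char_step_law[OF om] by (subst split) (rule norm_triangle_ineq)
    also have "norm (\<Sum>i\<in>?J. of_real (p i) * iexp (s * a i)) \<le> (\<Sum>i\<in>?J. p i)"
    proof (rule sum_norm_le)
      fix i assume "i \<in> ?J"
      then show "norm (of_real (p i) * iexp (s * a i)) \<le> p i"
        using p[of i] unfolding norm_mult norm_exp_i_times by simp
    qed
    also have "norm (of_real (p 1) * iexp (s * a 1) + of_real (p j) * iexp (s * a j))
        \<le> p 1 + p j - p 1 * p j * (1 - cos (s * a j - s * a 1))"
    proof (rule norm_two_point_le)
      show "0 < p 1" "0 < p j" using p j by auto
      have "0 \<le> sum p ?J" using p by (intro sum_nonneg) (auto intro: less_imp_le)
      then show "p 1 + p j \<le> 1" using split[of p] sum1 by simp
    qed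
    finally have "norm (char (step_law d a p) s) \<le> 1 - p 1 * p j * (1 - cos (s * a j - s * a 1))"
      using split[of p] sum1 by simp
    moreover have "q * q * ((dist_lattice d a s)\<^sup>2 / 8) \<le> p 1 * p j * (1 - cos (s * a j - s * a 1))"
    proof (intro mult_mono)
      show "(dist_lattice d a s)\<^sup>2 / 8 \<le> 1 - cos (s * a j - s * a 1)"
        using one_minus_cos_ge_infdist[of "(a j - a 1) * s"] by (simp add: j(2) algebra_simps)
    qed (use q q_le j less_imp_le[OF p] in auto)
    ultimately show "norm (char (step_law d a p) s) \<le> 1 - q\<^sup>2 / 8 * (dist_lattice d a s)\<^sup>2"
      by (simp add: power2_eq_square)
  qed (use q in simp)
qed

text \<open>The Diophantine hypothesis speaks only of |s| > 1, but frequencies from a fixed \<delta>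
  > 0 upwards occur. For \<delta> <= |s| <= 1 it is applied to m s with a fixed integer m >
  1/\<delta>, which gives a constant lower bound.\<close>

lemma char_step_law_decay:
  assumes om: "(a, p) \<in> Omega d" and "d \<ge> 1" and dio: "diophantine d \<beta> a" and "\<beta> > 0" "\<delta> > 0"
  obtains c where "c > 0"
    "\<And>s S. S \<ge> 1 \<Longrightarrow> \<delta> \<le> \<bar>s\<bar> \<Longrightarrow> \<bar>s\<bar> \<le> S \<Longrightarrow> norm (char (step_law d a p) s) \<le> 1 - c * S powr (- 2 * \<beta>)"
proof -
  obtain c where c: "c > 0" "\<And>s. norm (char (step_law d a p) s) \<le> 1 - c * (dist_lattice d a s)\<^sup>2"
    using norm_char_step_law_le[OF om \<open>d \<ge> 1\<close>] by blast
  obtain K where K: "K > 0" "\<And>s. \<bar>s\<bar> > 1 \<Longrightarrow> dist_lattice d a s \<ge> K * \<bar>s\<bar> powr (- \<beta>)"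
    using dio unfolding diophantine_def by blast
  define m where "m = nat \<lceil>1 / \<delta>\<rceil> + 1"
  have m: "real m > 1 / \<delta>" "m > 0" by (simp_all add: m_def) linarith
  define k where "k = min K (K * real m powr (- \<beta>) / real m)"
  have k: "k > 0" using K(1) m by (simp add: k_def)
  have lower: "k * S powr (- \<beta>) \<le> dist_lattice d a s" if S: "S \<ge> 1" "\<delta> \<le> \<bar>s\<bar>" "\<bar>s\<bar> \<le> S" for s S
  proof (cases "\<bar>s\<bar> > 1")
    case True
    have "k * S powr (- \<beta>) \<le> K * \<bar>s\<bar> powr (- \<beta>)"
      using True S k K(1) \<open>\<beta> > 0\<close> by (intro mult_mono powr_mono2') (auto simp: k_def)
    then show ?thesis using K(2)[OF True] by linarith
  next
    case False
    have "1 < real m * \<delta>" using m \<open>\<delta> > 0\<close> by (simp add: pos_divide_less_eq)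
    also have "\<dots> \<le> real m * \<bar>s\<bar>" using S by (intro mult_left_mono) auto
    finally have ms: "1 < \<bar>real m * s\<bar>" by (simp add: abs_mult)
    have "K * real m powr (- \<beta>) \<le> K * \<bar>real m * s\<bar> powr (- \<beta>)"
      using False ms K(1) \<open>\<beta> > 0\<close> m
      by (intro mult_left_mono powr_mono2') (auto simp: abs_mult mult_le_cancel_left1)
    also have "\<dots> \<le> dist_lattice d a (real m * s)" by (rule K(2)[OF ms])
    also have "\<dots> \<le> real m * dist_lattice d a s" by (rule dist_lattice_mult[OF \<open>d \<ge> 1\<close>])
    finally have "K * real m powr (- \<beta>) / real m \<le> dist_lattice d a s"
      using m by (simp add: divide_le_eq mult.commute)
    then have "k \<le> dist_lattice d a s" by (simp add: k_def)
    moreover have "k * S powr (- \<beta>) \<le> k * 1"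
      using S k \<open>\<beta> > 0\<close> by (intro mult_left_mono) (auto simp: powr_minus inverse_le_1_iff ge_one_powr_ge_zero)
    ultimately show ?thesis by simp
  qed
  show thesis
  proof (rule that[of "c * k\<^sup>2"])
    show "c * k\<^sup>2 > 0" using c k by simp
    fix s S :: real
    assume S: "S \<ge> 1" "\<delta> \<le> \<bar>s\<bar>" "\<bar>s\<bar> \<le> S"
    have "(k * S powr (- \<beta>))\<^sup>2 \<le> (dist_lattice d a s)\<^sup>2"
      using lower[OF S] k by (intro power_mono) auto
    moreover have "(S powr (- \<beta>))\<^sup>2 = S powr (- 2 * \<beta>)"
      by (simp add: power2_eq_square powr_add[symmetric])
    ultimately have "c * k\<^sup>2 * S powr (- 2 * \<beta>) \<le> c * (dist_lattice d a s)\<^sup>2"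
      using c by (simp add: power_mult_distrib)
    then show "norm (char (step_law d a p) s) \<le> 1 - c * k\<^sup>2 * S powr (- 2 * \<beta>)"
      using c(2)[of s] by linarith
  qed
qed

text \<open>Zero variance would make all a j equal to 0, hence \<open>dist_lattice\<close> zero at
  every s; the point s = 2 already contradicts the Diophantine bound.\<close>

lemma std_dev_step_law_pos:
  assumes om: "(a, p) \<in> Omega d" and "d \<ge> 1" and dio: "diophantine d \<beta> a"
  shows "std_dev (step_law d a p) > 0"
proof (rule ccontr)
  assume "\<not> ?thesis"
  then have le: "(\<Sum>j=1..d+1. p j * (a j)\<^sup>2) \<le> 0"
    by (simp add: std_dev_step_law[OF om])
  have p: "\<And>j. j \<in> {1..d+1} \<Longrightarrow> 0 < p j" using om by (auto simp: Omega_def)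
  have nn: "0 \<le> p j * (a j)\<^sup>2" if "j \<in> {1..d+1}" for j using p[OF that] by simp
  then have "(\<Sum>j=1..d+1. p j * (a j)\<^sup>2) = 0" using le by (intro antisym sum_nonneg) auto
  then have "\<forall>j\<in>{1..d+1}. p j * (a j)\<^sup>2 = 0"
    using nn by (subst (asm) sum_nonneg_eq_0_iff) auto
  then have a: "a j = 0" if "j \<in> {1..d+1}" for j
  proof -
    have "p j * (a j)\<^sup>2 = 0" using that \<open>\<forall>j\<in>_. _\<close> by blast
    then show ?thesis using p[OF that] by simp
  qed
  obtain j where j: "j \<in> {2..d+1}" "dist_lattice d a 2 = infdist ((a j - a 1) * 2) two_pi_Z"
    using dist_lattice_attained[OF \<open>d \<ge> 1\<close>] by blast
  have "(0::real) \<in> two_pi_Z" by (auto intro!: image_eqI[of _ _ 0])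
  then have "dist_lattice d a 2 = 0" using j a[of j] a[of 1] by (simp add: infdist_zero)
  moreover obtain K where "K > 0" "\<And>s. \<bar>s\<bar> > 1 \<Longrightarrow> dist_lattice d a s \<ge> K * \<bar>s\<bar> powr (- \<beta>)"
    using dio unfolding diophantine_def by blast
  then have "dist_lattice d a 2 > 0"
    by (metis abs_numeral less_le_trans mult_pos_pos one_less_numeral_iff powr_gt_zero semiring_norm(76) zero_neq_numeral)
  ultimately show False by simp
qed

section \<open>Edgeworth expansion of the step law\<close>

lemma char_step_law_power_expansion:
  assumes om: "(a, p) \<in> Omega d" and \<sigma>: "std_dev (step_law d a p) > 0"
  obtains s v where "s > 0" "v 0 = 1"
    "\<And>k t. norm (cpoly (v k) (\<i> * complex_of_real t)) \<le> exp (t\<^sup>2 / 8) / s ^ k"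
    "\<And>n t r. n > 0 \<Longrightarrow> \<bar>t\<bar> \<le> s / 2 * sqrt (real n) \<Longrightarrow>
      norm (char (step_law d a p) (t / (std_dev (step_law d a p) * sqrt (real n))) ^ n -
        complex_of_real (exp (- (t\<^sup>2) / 2)) *
          (\<Sum>k\<le>r. (\<i> * complex_of_real t / complex_of_real (sqrt (real n))) ^ k * cpoly (v k) (\<i> * complex_of_real t)))
        \<le> 2 * exp (- 3 * t\<^sup>2 / 8) * (\<bar>t\<bar> / (s * sqrt (real n))) ^ Suc r"
proof -
  define \<sigma> where "\<sigma> = std_dev (step_law d a p)"
  have \<sigma>_pos: "\<sigma> > 0" using \<sigma> by (simp add: \<sigma>_def)
  \<comment> \<open>\<open>D 0\<close> is the moment generating function of X/\<sigma> and
    \<open>D m\<close> its m-th derivative. Dividing by \<sigma> makes the second derivative at 0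
    equal to 1; the characteristic function is read off on the imaginary axis.\<close>
  define D where "D = (\<lambda>m z. \<Sum>j=1..d+1. complex_of_real (p j) * complex_of_real (a j / \<sigma>) ^ m * exp (z * complex_of_real (a j / \<sigma>)))"
  have D_deriv: "(D m has_field_derivative D (Suc m) z) (at z)" for m z
    unfolding D_def using \<sigma>_pos by (auto intro!: derivative_eq_intros sum.cong simp: mult_ac)
  then have deriv_D: "deriv (D m) = D (Suc m)" for m
    by (intro ext DERIV_imp_deriv)
  have D0: "D 0 0 = 1" "D 1 0 = 0" "D 2 0 = 1"
  proof -
    have sums: "(\<Sum>j=1..d+1. p j) = 1" "(\<Sum>j=1..d+1. p j * a j) = 0"
      using om unfolding Omega_def by blast+
    have "D 0 0 = complex_of_real (\<Sum>j=1..d+1. p j)" by (simp add: D_def)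
    then show "D 0 0 = 1" unfolding sums by simp
    have "D 1 0 = complex_of_real ((\<Sum>j=1..d+1. p j * a j) / \<sigma>)"
      by (simp add: D_def sum_divide_distrib del: sum.cl_ivl_Suc)
    then show "D 1 0 = 0" unfolding sums by simp
    have var: "\<sigma>\<^sup>2 = (\<Sum>j=1..d+1. p j * (a j)\<^sup>2)"
      using om \<sigma>_pos unfolding \<sigma>_def std_dev_step_law[OF om]
      by (intro real_sqrt_pow2 sum_nonneg mult_nonneg_nonneg) (auto simp: Omega_def intro: less_imp_le)
    have "D 2 0 = complex_of_real ((\<Sum>j=1..d+1. p j * (a j)\<^sup>2) / \<sigma>\<^sup>2)"
      by (simp add: D_def sum_divide_distrib power_divide del: sum.cl_ivl_Suc)
    then show "D 2 0 = 1" using \<sigma>_pos unfolding var[symmetric] by simp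
  qed
  have hol: "D 0 holomorphic_on UNIV"
    using D_deriv by (auto simp: holomorphic_on_open)
  have cnj: "D 0 (cnj z) = cnj (D 0 z)" for z
    by (simp add: D_def exp_cnj)
  have d2: "deriv (deriv (D 0)) 0 = 1" using D0(3) by (simp add: deriv_D numeral_2_eq_2)
  have d1: "deriv (D 0) 0 = 0" using D0(2) by (simp add: deriv_D)
  have char: "char (step_law d a p) (t / (\<sigma> * sqrt (real n))) = D 0 (\<i> * t / complex_of_real (sqrt (real n)))" for t n
    unfolding char_step_law[OF om] D_def by (intro sum.cong refl) (simp add: mult_ac)
  obtain s v where s: "s > 0" "v 0 = 1"
    "\<And>k w. norm (cpoly (v k) w) \<le> exp ((norm w)\<^sup>2 / 8) / s ^ k"
    "\<And>n (w::complex) r. n > 0 \<Longrightarrow> norm w \<le> s / 2 * sqrt (real n) \<Longrightarrow>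
      norm (D 0 (w / sqrt n) ^ n * exp (- w\<^sup>2 / 2) - (\<Sum>k\<le>r. (w / sqrt n) ^ k * cpoly (v k) w))
        \<le> 2 * exp ((norm w)\<^sup>2 / 8) * (norm w / (s * sqrt n)) ^ Suc r"
    using power_expansion_near_0[OF hol D0(1) d1 d2 cnj] by blast
  show thesis
  proof (rule that[of s v], goal_cases)
    case (3 k t)
    show ?case using s(3)[of k "\<i> * complex_of_real t"] by (simp add: norm_mult)
  next
    case (4 n t r)
    let ?w = "\<i> * complex_of_real t"
    let ?S = "\<Sum>k\<le>r. (?w / complex_of_real (sqrt (real n))) ^ k * cpoly (v k) ?w"
    let ?e = "complex_of_real (exp (- (t\<^sup>2) / 2))"
    have w: "norm ?w = \<bar>t\<bar>" by (simp add: norm_mult)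
    have e: "?e * exp (- ?w\<^sup>2 / 2) = 1"
      by (simp add: power_mult_distrib exp_of_real[symmetric] exp_add[symmetric])
    have "norm (D 0 (?w / complex_of_real (sqrt (real n))) ^ n - ?e * ?S) =
       norm (?e * (D 0 (?w / complex_of_real (sqrt (real n))) ^ n * exp (- ?w\<^sup>2 / 2) - ?S))"
      by (simp only: right_diff_distrib mult.left_commute[of ?e] e mult_1_right)
    also have "\<dots> = exp (- (t\<^sup>2) / 2) * norm (D 0 (?w / complex_of_real (sqrt (real n))) ^ n * exp (- ?w\<^sup>2 / 2) - ?S)"
      by (simp only: norm_mult norm_of_real abs_exp_cancel)
    also have "\<dots> \<le> exp (- (t\<^sup>2) / 2) * (2 * exp (\<bar>t\<bar>\<^sup>2 / 8) * (\<bar>t\<bar> / (s * sqrt n)) ^ Suc r)"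
      using s(4)[OF 4(1), of ?w r] 4(2) unfolding w by (intro mult_left_mono) auto
    also have "\<dots> = 2 * (exp (- (t\<^sup>2) / 2) * exp (t\<^sup>2 / 8)) * (\<bar>t\<bar> / (s * sqrt n)) ^ Suc r"
      by (simp add: mult_ac)
    also have "exp (- (t\<^sup>2) / 2) * exp (t\<^sup>2 / 8) = exp (- 3 * t\<^sup>2 / 8)"
      by (simp add: exp_add[symmetric])
    finally show ?case unfolding \<sigma>_def[symmetric] char .
  qed (use s in auto)
qed

lemma powr_minus_half:
  assumes "n > 0"
  shows "real n powr (- real k / 2) = 1 / sqrt (real n) ^ k"
proof -
  have "sqrt (real n) ^ k = sqrt (real n) powr real k"
    using assms by (intro powr_realpow[symmetric]) simp
  also have "\<dots> = (real n powr (1 / 2)) powr real k"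
    by (simp add: powr_half_sqrt)
  also have "\<dots> = real n powr (real k / 2)" by (simp add: powr_powr)
  finally show ?thesis by (simp add: powr_minus_divide)
qed

text \<open>The expansion is recognized as the transform of a sum with explicit polynomials; these
  satisfy the defining o-condition, and uniqueness identifies them with
  \<open>edgeworth_polys\<close>.\<close>

lemma edgeworth_Fourier_expansion:
  assumes om: "(a, p) \<in> Omega d" and \<sigma>: "std_dev (step_law d a p) > 0"
  obtains s where "s > 0"
    "\<And>n t. n > 0 \<Longrightarrow> norm (fourier_stieltjes (edgeworth (step_law d a p) r n) t)
        \<le> exp (- 3 * t\<^sup>2 / 8) * (\<Sum>k\<le>r. (\<bar>t\<bar> / (s * sqrt (real n))) ^ k)"
    "\<And>n t. n > 0 \<Longrightarrow> \<bar>t\<bar> \<le> s / 2 * sqrt (real n) \<Longrightarrow>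
      norm (char (step_law d a p) (t / (std_dev (step_law d a p) * sqrt (real n))) ^ n -
        fourier_stieltjes (edgeworth (step_law d a p) r n) t)
        \<le> 2 * exp (- 3 * t\<^sup>2 / 8) * (\<bar>t\<bar> / (s * sqrt (real n))) ^ Suc r"
proof -
  let ?\<mu> = "step_law d a p"
  obtain s v where s: "s > 0" "v 0 = 1"
    "\<And>k t. norm (cpoly (v k) (\<i> * complex_of_real t)) \<le> exp (t\<^sup>2 / 8) / s ^ k"
    "\<And>n t r. n > 0 \<Longrightarrow> \<bar>t\<bar> \<le> s / 2 * sqrt (real n) \<Longrightarrow>
      norm (char ?\<mu> (t / (std_dev ?\<mu> * sqrt (real n))) ^ n -
        complex_of_real (exp (- (t\<^sup>2) / 2)) *
          (\<Sum>k\<le>r. (\<i> * complex_of_real t / complex_of_real (sqrt (real n))) ^ k * cpoly (v k) (\<i> * complex_of_real t)))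
        \<le> 2 * exp (- 3 * t\<^sup>2 / 8) * (\<bar>t\<bar> / (s * sqrt (real n))) ^ Suc r"
    using char_step_law_power_expansion[OF om \<sigma>] by blast
  \<comment> \<open>The transform of the k-th summand's derivative is -w times that of P k, so this
    choice produces w^k v_k(w). For k = 0 the subtraction k - 1 is truncated, but P uses only k >=
    1.\<close>
  have "\<forall>k. \<exists>q. gauss_pair q (- (monom 1 (k - 1) * v k))" using ex_gauss_pair_left by blast
  then obtain Q where Q: "\<And>k. gauss_pair (Q k) (- (monom 1 (k - 1) * v k))" by metis
  define P where "P = (\<lambda>k. if k \<in> {1..r} then Q k else 0)"
  define A where "A = (\<lambda>n t. complex_of_real (exp (- (t\<^sup>2) / 2)) *
          (\<Sum>k\<le>r. (\<i> * complex_of_real t / complex_of_real (sqrt (real n))) ^ k * cpoly (v k) (\<i> * complex_of_real t)))"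
  have FS: "fourier_stieltjes (edgeworth_sum P r n) t = A n t" if "n > 0" for n t
  proof -
    let ?w = "\<i> * complex_of_real t"
    let ?e = "complex_of_real (exp (- (t\<^sup>2) / 2))"
    have summand: "\<i> * t * (complex_of_real (real n powr (- real k / 2)) * gauss_Fourier (P k) t) =
      - (?e * ((?w / complex_of_real (sqrt (real n))) ^ k * cpoly (v k) ?w))" if k: "k \<in> {1..r}" for k
    proof -
      have 1: "gauss_Fourier (P k) t = - (?w ^ (k - 1) * cpoly (v k) ?w) * ?e"
        using Q[of k] k by (simp add: P_def gauss_pair_def gauss_Fourier_def)
      have 2: "?w * ?w ^ (k - 1) = ?w ^ k" using k by (cases k) auto
      have "real n powr (- real k / 2) = 1 / sqrt (real n) ^ k"
        using \<open>n > 0\<close> by (rule powr_minus_half)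
      then have 3: "(?w / complex_of_real (sqrt (real n))) ^ k = ?w ^ k * complex_of_real (real n powr (- real k / 2))"
        by (simp add: power_divide)
      show ?thesis unfolding 1 3 2[symmetric] by (simp add: mult_ac)
    qed
    have "fourier_stieltjes (edgeworth_sum P r n) t =
      ?e - (\<Sum>k=1..r. - (?e * ((?w / complex_of_real (sqrt (real n))) ^ k * cpoly (v k) ?w)))"
      unfolding fourier_stieltjes_edgeworth_sum sum_distrib_left by (simp only: summand cong: sum.cong)
    also have "\<dots> = ?e * (cpoly (v 0) ?w + (\<Sum>k=1..r. (?w / complex_of_real (sqrt (real n))) ^ k * cpoly (v k) ?w))"
      by (simp add: s(2) sum_negf sum_distrib_left distrib_left)
    also have "\<dots> = A n t"
      unfolding A_def by (simp add: sum.atMost_shift atLeast0AtMost[symmetric] sum.atLeast_Suc_atMost)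
    finally show ?thesis .
  qed
  have edgeworth_P: "is_edgeworth_polys ?\<mu> r P"
    unfolding is_edgeworth_polys_def
  proof (intro conjI allI impI)
    fix t
    define C where "C = 2 * exp (- 3 * t\<^sup>2 / 8) * (\<bar>t\<bar> / s) ^ Suc r"
    \<comment> \<open>For fixed t the condition |t| <= (s/2) sqrt n holds eventually, so the
      remainder bound of order r + 1 applies; it beats the required o(n^(-r/2)) by n^(-1/2).\<close>
    have "(\<lambda>n. char ?\<mu> (t / (std_dev ?\<mu> * sqrt (real n))) ^ n - fourier_stieltjes (edgeworth_sum P r n) t)
      \<in> O(\<lambda>n. complex_of_real (real n powr (- real (Suc r) / 2)))"
    proof (rule bigoI[where c = C])
      have "\<forall>\<^sub>F n in sequentially. 2 * \<bar>t\<bar> / s \<le> sqrt (real n)"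
        by real_asymp
      then show "\<forall>\<^sub>F n in sequentially. norm (char ?\<mu> (t / (std_dev ?\<mu> * sqrt (real n))) ^ n - fourier_stieltjes (edgeworth_sum P r n) t)
        \<le> C * norm (complex_of_real (real n powr (- real (Suc r) / 2)))"
        using eventually_gt_at_top[of 0]
      proof eventually_elim
        case (elim n)
        have "\<bar>t\<bar> \<le> s / 2 * sqrt (real n)" using elim s(1) by (simp add: field_simps)
        from s(4)[OF elim(2) this, of r]
        have "norm (char ?\<mu> (t / (std_dev ?\<mu> * sqrt (real n))) ^ n - fourier_stieltjes (edgeworth_sum P r n) t)
          \<le> 2 * exp (- 3 * t\<^sup>2 / 8) * (\<bar>t\<bar> / (s * sqrt (real n))) ^ Suc r"
          unfolding FS[OF elim(2)] A_def .
        also have "(\<bar>t\<bar> / (s * sqrt (real n))) ^ Suc r = (\<bar>t\<bar> / s) ^ Suc r * (1 / sqrt (real n) ^ Suc r)"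
          by (simp add: power_divide power_mult_distrib)
        also have "1 / sqrt (real n) ^ Suc r = real n powr (- real (Suc r) / 2)"
          using elim(2) by (rule powr_minus_half[symmetric])
        finally show ?case by (simp add: C_def mult_ac)
      qed
    qed
    also have "(\<lambda>n. complex_of_real (real n powr (- real (Suc r) / 2))) \<in> o(\<lambda>n. complex_of_real (real n powr (- real r / 2)))"
    proof (rule smalloI_tendsto)
      have "(\<lambda>n. real n powr (- 1 / 2)) \<longlonglongrightarrow> 0"
        by (intro tendsto_neg_powr filterlim_real_sequentially) auto
      then have "(\<lambda>n. complex_of_real (real n powr (- 1 / 2))) \<longlonglongrightarrow> of_real 0" by (rule tendsto_of_real)
      moreover have "\<forall>\<^sub>F n in sequentially. complex_of_real (real n powr (- 1 / 2)) =
         complex_of_real (real n powr (- real (Suc r) / 2)) / complex_of_real (real n powr (- real r / 2))"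
        using eventually_gt_at_top[of 0]
      proof eventually_elim
        case (elim n)
        have "real n powr (- 1 / 2) = real n powr (- real (Suc r) / 2 - (- real r / 2))"
          by (rule arg_cong[where f = "\<lambda>x. real n powr x"]) (simp add: field_simps)
        then show ?case unfolding powr_diff by (simp only: of_real_divide)
      qed
      ultimately have "(\<lambda>n. complex_of_real (real n powr (- real (Suc r) / 2)) / complex_of_real (real n powr (- real r / 2))) \<longlonglongrightarrow> of_real 0"
        by (rule Lim_transform_eventually)
      then show "(\<lambda>n. complex_of_real (real n powr (- real (Suc r) / 2)) / complex_of_real (real n powr (- real r / 2))) \<longlonglongrightarrow> 0"
        by simp
      show "\<forall>\<^sub>F n in sequentially. complex_of_real (real n powr (- real r / 2)) \<noteq> 0"
        using eventually_gt_at_top[of 0] by eventually_elim auto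
    qed
    finally show "(\<lambda>n. char ?\<mu> (t / (std_dev ?\<mu> * sqrt (real n))) ^ n - fourier_stieltjes (edgeworth_sum P r n) t)
      \<in> o(\<lambda>n. complex_of_real (real n powr (- real r / 2)))" .
  qed (auto simp: P_def)
  have "edgeworth_polys ?\<mu> r = P"
    unfolding edgeworth_polys_def using edgeworth_P is_edgeworth_polys_unique by (intro the_equality) blast+
  then have E: "fourier_stieltjes (edgeworth ?\<mu> r n) t = A n t" if "n > 0" for n t
    using FS[OF that] by (simp add: edgeworth_def[abs_def])
  show thesis
  proof (rule that[of s])
    show "s > 0" by fact
    fix n :: nat and t :: real assume n: "n > 0"
    show "norm (fourier_stieltjes (edgeworth ?\<mu> r n) t)
        \<le> exp (- 3 * t\<^sup>2 / 8) * (\<Sum>k\<le>r. (\<bar>t\<bar> / (s * sqrt (real n))) ^ k)"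
    proof -
      have "norm (A n t) \<le> exp (- (t\<^sup>2) / 2) * (\<Sum>k\<le>r. (\<bar>t\<bar> / sqrt (real n)) ^ k * (exp (t\<^sup>2 / 8) / s ^ k))"
        unfolding A_def norm_mult norm_of_real abs_exp_cancel
      proof (intro mult_left_mono sum_norm_le)
        fix k
        have "norm (\<i> * complex_of_real t / complex_of_real (sqrt (real n))) = \<bar>t\<bar> / sqrt (real n)"
          by (simp add: norm_divide norm_mult)
        then show "norm ((\<i> * complex_of_real t / complex_of_real (sqrt (real n))) ^ k * cpoly (v k) (\<i> * complex_of_real t))
          \<le> (\<bar>t\<bar> / sqrt (real n)) ^ k * (exp (t\<^sup>2 / 8) / s ^ k)"
          unfolding norm_mult norm_power by (intro mult_mono s(3)) auto
      qed auto
      also have "\<dots> = (exp (- (t\<^sup>2) / 2) * exp (t\<^sup>2 / 8)) * (\<Sum>k\<le>r. (\<bar>t\<bar> / (s * sqrt (real n))) ^ k)"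
        by (simp add: sum_distrib_left power_divide power_mult_distrib mult_ac)
      also have "exp (- (t\<^sup>2) / 2) * exp (t\<^sup>2 / 8) = exp (- 3 * t\<^sup>2 / 8)"
        by (simp add: exp_add[symmetric])
      finally show ?thesis unfolding E[OF n] .
    qed
    show "norm (char ?\<mu> (t / (std_dev ?\<mu> * sqrt (real n))) ^ n - fourier_stieltjes (edgeworth ?\<mu> r n) t)
        \<le> 2 * exp (- 3 * t\<^sup>2 / 8) * (\<bar>t\<bar> / (s * sqrt (real n))) ^ Suc r" if "\<bar>t\<bar> \<le> s / 2 * sqrt (real n)"
      unfolding E[OF n] A_def using s(4)[OF n that, of r] .
  qed
qed

section \<open>Quantitative bounds for the two frequency ranges\<close>

lemma tendsto_powr_times_exp_neg_powr:
  fixes a c \<gamma> :: real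
  assumes "c > 0" "\<gamma> > 0"
  shows "(\<lambda>n. real n powr a * exp (- c * real n powr \<gamma>)) \<longlonglongrightarrow> 0"
  using assms by real_asymp

lemma power_le_fact_mult_exp: "y ^ k \<le> fact k * exp y" if "0 \<le> y" for y :: real
proof -
  have "y ^ k /\<^sub>R fact k \<le> (\<Sum>n. y ^ n /\<^sub>R fact n)"
    using sum_le_suminf[OF summable_exp_generic[of y], of "{k}"] that by simp
  then show ?thesis by (simp add: exp_def field_simps)
qed

text \<open>Odd powers are removed by |x|^k <= 1 + x^(2k); then y^k <= k! exp y is used at y =
  x^2/8.\<close>

lemma power_times_exp_le: "\<bar>x\<bar> ^ k * exp (- (x\<^sup>2) / 8) \<le> 1 + 8 ^ k * fact k" for x :: real
proof -
  have "\<bar>x\<bar> ^ k \<le> 1 + (x\<^sup>2) ^ k"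
  proof (cases "\<bar>x\<bar> \<le> 1")
    case True
    then have "\<bar>x\<bar> ^ k \<le> 1" by (intro power_le_one) auto
    then show ?thesis by (simp add: add_increasing2)
  next
    case False
    then have "\<bar>x\<bar> ^ k \<le> \<bar>x\<bar> ^ (2 * k)" by (intro power_increasing) auto
    then show ?thesis by (simp add: power_mult)
  qed
  also have "(x\<^sup>2) ^ k = 8 ^ k * (x\<^sup>2 / 8) ^ k" by (simp add: power_divide)
  also have "\<dots> \<le> 8 ^ k * (fact k * exp (x\<^sup>2 / 8))"
    by (intro mult_left_mono power_le_fact_mult_exp) auto
  finally have "\<bar>x\<bar> ^ k * exp (- (x\<^sup>2) / 8) \<le> (1 + 8 ^ k * (fact k * exp (x\<^sup>2 / 8))) * exp (- (x\<^sup>2) / 8)"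
    by (intro mult_right_mono) auto
  also have "\<dots> = exp (- (x\<^sup>2) / 8) + 8 ^ k * fact k * (exp (x\<^sup>2 / 8) * exp (- (x\<^sup>2) / 8))"
    by (simp add: algebra_simps)
  also have "exp (x\<^sup>2 / 8) * exp (- (x\<^sup>2) / 8) = 1" by (simp add: exp_add[symmetric])
  finally show ?thesis by (smt (verit) one_le_exp_iff exp_le_one_iff divide_nonpos_pos mult_1_right zero_le_power2)
qed

lemma char_step_law_power_decay:
  assumes om: "(a, p) \<in> Omega d" and "d \<ge> 1" and dio: "diophantine d \<beta> a" and "\<beta> > 0"
    and "s > 0" and "\<rho> > 1 / 2"
  obtains c where "c > 0"
    "\<And>n t. n > 0 \<Longrightarrow> s / 2 * sqrt (real n) \<le> \<bar>t\<bar> \<Longrightarrow> \<bar>t\<bar> \<le> real n powr \<rho> \<Longrightarrow>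
      norm (char (step_law d a p) (t / (std_dev (step_law d a p) * sqrt (real n))) ^ n)
        \<le> exp (- c * real n powr (1 - 2 * \<beta> * (\<rho> - 1 / 2)))"
proof -
  define \<sigma> where "\<sigma> = std_dev (step_law d a p)"
  have \<sigma>: "\<sigma> > 0" unfolding \<sigma>_def by (rule std_dev_step_law_pos[OF om \<open>d \<ge> 1\<close> dio])
  have "s / (2 * \<sigma>) > 0" using \<sigma> \<open>s > 0\<close> by simp
  then obtain c where c: "c > 0"
    "\<And>u S. S \<ge> 1 \<Longrightarrow> s / (2 * \<sigma>) \<le> \<bar>u\<bar> \<Longrightarrow> \<bar>u\<bar> \<le> S \<Longrightarrow> norm (char (step_law d a p) u) \<le> 1 - c * S powr (- 2 * \<beta>)"
    using char_step_law_decay[OF om \<open>d \<ge> 1\<close> dio \<open>\<beta> > 0\<close>] by blast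
  \<comment> \<open>S = \<kappa> n^(\<rho> - 1/2) must dominate |t| / (\<sigma> sqrt n) and also be
    at least 1; the maximum secures both.\<close>
  define \<kappa> where "\<kappa> = max 1 (1 / \<sigma>)"
  have \<kappa>: "\<kappa> \<ge> 1" "\<kappa> \<ge> 1 / \<sigma>" by (simp_all add: \<kappa>_def)
  show thesis
  proof (rule that[of "c * \<kappa> powr (- 2 * \<beta>)"])
    show "c * \<kappa> powr (- 2 * \<beta>) > 0" using c \<kappa> by simp
    fix n :: nat and t :: real
    assume n: "n > 0" and t: "s / 2 * sqrt (real n) \<le> \<bar>t\<bar>" "\<bar>t\<bar> \<le> real n powr \<rho>"
    define S where "S = \<kappa> * real n powr (\<rho> - 1 / 2)"
    let ?u = "t / (\<sigma> * sqrt (real n))"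
    have "1 * 1 \<le> \<kappa> * real n powr (\<rho> - 1 / 2)"
      using n \<kappa> \<open>\<rho> > 1 / 2\<close> by (intro mult_mono ge_one_powr_ge_zero) auto
    then have S: "S \<ge> 1" by (simp add: S_def)
    have abs_u: "\<bar>?u\<bar> = \<bar>t\<bar> / (\<sigma> * sqrt (real n))" using \<sigma> by (simp add: abs_mult)
    have u1: "s / (2 * \<sigma>) \<le> \<bar>?u\<bar>"
      unfolding abs_u using t(1) n \<sigma> by (simp add: field_simps)
    have "\<bar>?u\<bar> \<le> real n powr \<rho> / (\<sigma> * sqrt (real n))"
      unfolding abs_u using t(2) \<sigma> by (intro divide_right_mono) auto
    also have "\<dots> = 1 / \<sigma> * real n powr (\<rho> - 1 / 2)"
      by (simp add: powr_diff powr_half_sqrt)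
    also have "\<dots> \<le> S" unfolding S_def using \<kappa> by (intro mult_right_mono) auto
    finally have u2: "\<bar>?u\<bar> \<le> S" .
    have "norm (char (step_law d a p) ?u) \<le> 1 - c * S powr (- 2 * \<beta>)" by (rule c(2)[OF S u1 u2])
    also have "\<dots> \<le> exp (- (c * S powr (- 2 * \<beta>)))"
      using exp_ge_add_one_self[of "- (c * S powr (- 2 * \<beta>))"] by simp
    finally have "norm (char (step_law d a p) ?u) ^ n \<le> exp (- (c * S powr (- 2 * \<beta>))) ^ n"
      by (intro power_mono) auto
    also have "\<dots> = exp (- (c * (real n * S powr (- 2 * \<beta>))))"
      by (simp add: exp_of_nat_mult[symmetric] mult_ac)
    also have "real n * S powr (- 2 * \<beta>) = \<kappa> powr (- 2 * \<beta>) * real n powr (1 - 2 * \<beta> * (\<rho> - 1 / 2))"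
    proof -
      have 1: "S powr (- 2 * \<beta>) = \<kappa> powr (- 2 * \<beta>) * real n powr ((\<rho> - 1 / 2) * (- 2 * \<beta>))"
        unfolding S_def using \<kappa> by (simp add: powr_mult powr_powr)
      have 2: "1 - 2 * \<beta> * (\<rho> - 1 / 2) = 1 + (\<rho> - 1 / 2) * (- 2 * \<beta>)" by simp
      show ?thesis unfolding 1 2 powr_add using n by simp
    qed
    finally show "norm (char (step_law d a p) (t / (std_dev (step_law d a p) * sqrt (real n))) ^ n)
        \<le> exp (- (c * \<kappa> powr (- 2 * \<beta>)) * real n powr (1 - 2 * \<beta> * (\<rho> - 1 / 2)))"
      by (simp add: norm_power \<sigma>_def mult_ac)
  qed
qed

text \<open>Since n^(-k/2) <= 1 for n >= 1, the bound is independent of n. It becomes the Lipschitz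
  constant m in Esseen's inequality.\<close>

lemma edgeworth_density_bounded:
  "\<exists>m\<ge>0. \<forall>n>0. \<forall>x. \<bar>std_normal_density x * poly (edgeworth_density_poly P r n) x\<bar> \<le> m"
proof -
  have "\<forall>q. \<exists>m. \<forall>x. \<bar>std_normal_density x * poly q x\<bar> \<le> m" using std_normal_poly_bounded by blast
  then obtain m where m: "\<And>q x. \<bar>std_normal_density x * poly q x\<bar> \<le> m q" by metis
  let ?q = "\<lambda>k. pderiv (P k) - pCons 0 (P k)"
  have m_nonneg: "0 \<le> m q" for q using m[of 0 q] by linarith
  have "\<bar>std_normal_density x * poly (edgeworth_density_poly P r n) x\<bar> \<le> m 1 + (\<Sum>k=1..r. m (?q k))"
    if "n > 0" for n x
  proof -
    have "std_normal_density x * poly (edgeworth_density_poly P r n) x = std_normal_density x * poly 1 x +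
       (\<Sum>k=1..r. real n powr (- real k / 2) * (std_normal_density x * poly (?q k) x))"
      unfolding edgeworth_density_poly_def poly_add poly_sum poly_smult distrib_left sum_distrib_left
      by (simp only: mult.left_commute)
    also have "\<bar>\<dots>\<bar> \<le> \<bar>std_normal_density x * poly 1 x\<bar> +
       (\<Sum>k=1..r. \<bar>real n powr (- real k / 2) * (std_normal_density x * poly (?q k) x)\<bar>)"
      by (intro order_trans[OF abs_triangle_ineq] add_left_mono sum_abs)
    also have "\<dots> \<le> m 1 + (\<Sum>k=1..r. m (?q k))"
    proof (intro add_mono m sum_mono)
      fix k
      have "real n powr (- real k / 2) \<le> real n powr 0" using that by (intro powr_mono) auto
      then have "real n powr (- real k / 2) * \<bar>std_normal_density x * poly (?q k) x\<bar> \<le> 1 * m (?q k)"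
        using that by (intro mult_mono m) auto
      then show "\<bar>real n powr (- real k / 2) * (std_normal_density x * poly (?q k) x)\<bar> \<le> m (?q k)"
        unfolding abs_mult[of "real n powr _"] by simp
    qed
    finally show ?thesis .
  qed
  moreover have "0 \<le> m 1 + (\<Sum>k=1..r. m (?q k))" by (intro add_nonneg_nonneg sum_nonneg m_nonneg)
  ultimately show ?thesis by blast
qed

text \<open>With the next two lemmas, this presents the Edgeworth sum as the second measure in
  Esseen's inequality.\<close>

lemma weighted_line_edgeworth:
  "weighted_line lborel (\<lambda>y. std_normal_density y * poly (edgeworth_density_poly P r n) y)"
  by unfold_locales (auto simp: integrable_std_normal_poly intro: lborel.sigma_finite_countable)

lemma cumulative_edgeworth:
  "cumulative lborel (\<lambda>y. std_normal_density y * poly (edgeworth_density_poly P r n) y) = edgeworth_sum P r n"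
  unfolding cumulative_def edgeworth_sum_eq_integral set_lebesgue_integral_def by (simp add: mult.commute)

lemma fourier_edgeworth:
  "fourier lborel (\<lambda>y. std_normal_density y * poly (edgeworth_density_poly P r n) y) = fourier_stieltjes (edgeworth_sum P r n)"
  unfolding fourier_def fourier_stieltjes_def deriv_edgeworth_sum ..

section \<open>The law of the normalized sum\<close>

context prob_space
begin

lemma weighted_line_distr:
  assumes [measurable]: "Y \<in> borel_measurable M"
  shows "weighted_line (distr M borel Y) (\<lambda>_. 1)"
proof -
  interpret D: prob_space "distr M borel Y" by (rule prob_space_distr) simp
  show ?thesis
    by (rule weighted_line.intro) (simp_all add: D.sigma_finite_measure_axioms)
qed

lemma cumulative_distr:
  assumes [measurable]: "Y \<in> borel_measurable M"
  shows "cumulative (distr M borel Y) (\<lambda>_. 1) x = prob {\<omega> \<in> space M. Y \<omega> \<le> x}"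
proof -
  have "cumulative (distr M borel Y) (\<lambda>_. 1) x = (LINT \<omega>|M. indicator {..x} (Y \<omega>))"
    unfolding cumulative_def by (subst integral_distr) auto
  also have "\<dots> = (LINT \<omega>|M. indicator {\<omega> \<in> space M. Y \<omega> \<le> x} \<omega>)"
    by (intro Bochner_Integration.integral_cong) (auto simp: indicator_def)
  also have "\<dots> = prob {\<omega> \<in> space M. Y \<omega> \<le> x}"
    by (simp add: Int_def conj_comms cong: conj_cong)
  finally show ?thesis .
qed

lemma fourier_distr: "fourier (distr M borel Y) (\<lambda>_. 1) = char (distr M borel Y)"
  by (simp add: fourier_def char_def fun_eq_iff)

lemma char_normalized_sum:
  fixes X :: "nat \<Rightarrow> 'a \<Rightarrow> real" and A :: real
  assumes indep: "indep_vars (\<lambda>_. borel) X {1..}" and law: "\<And>i. i \<ge> 1 \<Longrightarrow> distr M borel (X i) = \<mu>"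
  shows "char (distr M borel (\<lambda>\<omega>. (\<Sum>i=1..n. X i \<omega>) / A)) t = char \<mu> (t / A) ^ n"
proof -
  have [measurable]: "X i \<in> borel_measurable M" if "i \<in> {1..n}" for i
    using indep that by (auto simp: indep_vars_def)
  have "char (distr M borel (\<lambda>\<omega>. (\<Sum>i=1..n. X i \<omega>) / A)) t = char (distr M borel (\<lambda>\<omega>. \<Sum>i=1..n. X i \<omega>)) (t / A)"
    unfolding char_def by (subst (1 2) integral_distr) (auto simp: mult_ac)
  also have "\<dots> = (\<Prod>i=1..n. char (distr M borel (X i)) (t / A))"
    by (rule char_distr_sum[OF indep_vars_subset[OF indep]]) auto
  also have "\<dots> = char \<mu> (t / A) ^ n"
    using law by simp
  finally show ?thesis .
qed

end

theorem corollary1p1: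
  fixes d r :: nat and a p :: "nat \<Rightarrow> real" and \<beta> R :: real
    and M :: "'w measure" and X :: "nat \<Rightarrow> 'w \<Rightarrow> real"
  assumes "d \<ge> 2"
    and "(a, p) \<in> Omega d"
    and "\<beta> > 0"
    and "diophantine d \<beta> a"
    and "int r = 1 + below_floor (1 / \<beta>)"
    and "real r < 2 * R" and "2 * R < 1 / \<beta> + 1"
    and "prob_space M"
    and "prob_space.indep_vars M (\<lambda>_. borel) X {1..}"
    and "\<And>i. i \<ge> 1 \<Longrightarrow> distr M borel (X i) = step_law d a p"
  shows "uniform_limit UNIV
    (\<lambda>n z. real n powr R *
       (measure M {\<omega> \<in> space M.
           (\<Sum>i=1..n. X i \<omega>) / (std_dev (step_law d a p) * sqrt (real n)) \<le> z}
        - edgeworth (step_law d a p) r n z))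
    (\<lambda>_. 0) sequentially"
proof -
  interpret prob_space M by fact
  note om = assms(2) and \<beta> = assms(3) and dio = assms(4) and indep = assms(9) and law = assms(10)
  have d: "d \<ge> 1" using assms(1) by simp
  define \<mu> where "\<mu> = step_law d a p"
  define \<sigma> where "\<sigma> = std_dev \<mu>"
  have \<sigma>: "\<sigma> > 0" unfolding \<sigma>_def \<mu>_def by (rule std_dev_step_law_pos[OF om d dio])

  have r: "int r = \<lceil>1 / \<beta>\<rceil>" using assms(5) by (simp add: below_floor_eq)
  then have r_ge: "1 / \<beta> \<le> real r" by linarith
  have "0 < real r" using r_ge \<beta> by (smt (verit) zero_less_divide_1_iff)
  then have "r \<ge> 1" by simp
  \<comment> \<open>R > 1/2 comes from r >= 1 and makes \<rho> > 1/2, so the cutoff n^\<rho> grows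
    faster than sqrt n. R < (r+1)/2 makes the contribution of low frequencies o(n^(-R)).\<close>
  then have R: "1 / 2 < R" "R < real (Suc r) / 2" using assms(6,7) r_ge by auto
  obtain \<rho> where \<rho>: "R < \<rho>" "\<rho> < (1 / \<beta> + 1) / 2" using dense[of R "(1 / \<beta> + 1) / 2"] assms(7) by auto
  define \<gamma> where "\<gamma> = 1 - 2 * \<beta> * (\<rho> - 1 / 2)"
  have "2 * \<beta> * (\<rho> - 1 / 2) < 2 * \<beta> * (1 / (2 * \<beta>))"
    using \<rho> \<beta> by (intro mult_strict_left_mono) (auto simp: field_simps)
  then have \<gamma>: "\<gamma> > 0" using \<beta> by (simp add: \<gamma>_def)

  obtain s where s: "s > 0"
    and E_le: "\<And>n t. n > 0 \<Longrightarrow> norm (fourier_stieltjes (edgeworth \<mu> r n) t)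
        \<le> exp (- 3 * t\<^sup>2 / 8) * (\<Sum>k\<le>r. (\<bar>t\<bar> / (s * sqrt (real n))) ^ k)"
    and near: "\<And>n t. n > 0 \<Longrightarrow> \<bar>t\<bar> \<le> s / 2 * sqrt (real n) \<Longrightarrow>
      norm (char \<mu> (t / (\<sigma> * sqrt (real n))) ^ n - fourier_stieltjes (edgeworth \<mu> r n) t)
        \<le> 2 * exp (- 3 * t\<^sup>2 / 8) * (\<bar>t\<bar> / (s * sqrt (real n))) ^ Suc r"
    using edgeworth_Fourier_expansion[OF om, of r] \<sigma> unfolding \<mu>_def \<sigma>_def by blast
  obtain c where c: "c > 0" and far: "\<And>n t. n > 0 \<Longrightarrow> s / 2 * sqrt (real n) \<le> \<bar>t\<bar> \<Longrightarrow> \<bar>t\<bar> \<le> real n powr \<rho> \<Longrightarrow>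
      norm (char \<mu> (t / (\<sigma> * sqrt (real n))) ^ n) \<le> exp (- c * real n powr \<gamma>)"
    using char_step_law_power_decay[OF om d dio \<beta> s, of \<rho>] R \<rho> unfolding \<mu>_def \<sigma>_def \<gamma>_def by auto

  \<comment> \<open>The extra weight 1 + t^2 trades part of the Gaussian for the factor 1/(1 + t^2),
    whose integral over the whole line bounds the low-frequency part independently of T.\<close>
  define K0 where "K0 = (1 + 8 ^ r * fact r) + (1 + 8 ^ (r + 2) * fact (r + 2) :: real)"
  have K0: "\<bar>t\<bar> ^ r * (1 + t\<^sup>2) * exp (- 3 * t\<^sup>2 / 8) \<le> K0" for t
  proof -
    have "\<bar>t\<bar> ^ r * (1 + t\<^sup>2) * exp (- 3 * t\<^sup>2 / 8) \<le> \<bar>t\<bar> ^ r * (1 + t\<^sup>2) * exp (- (t\<^sup>2) / 8)"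
      by (intro mult_left_mono) auto
    also have "\<dots> = \<bar>t\<bar> ^ r * exp (- (t\<^sup>2) / 8) + \<bar>t\<bar> ^ (r + 2) * exp (- (t\<^sup>2) / 8)"
      by (simp add: algebra_simps power_add power2_eq_square)
    also have "\<dots> \<le> K0"
      unfolding K0_def by (intro add_mono power_times_exp_le)
    finally show ?thesis .
  qed
  have K0_nonneg: "0 \<le> K0" by (simp add: K0_def)
  define K where "K = 2 / s ^ Suc r * K0"
  have K: "0 \<le> K" using K0_nonneg s by (simp add: K_def)
  define C1 where "C1 = (\<Sum>k\<le>r. (1 + 8 ^ k * fact k) / s ^ k)"
  have C1: "0 \<le> C1" unfolding C1_def using s by (intro sum_nonneg) auto
  \<comment> \<open>High frequencies: the first term bounds the characteristic function, the second
    the Edgeworth transform, with s^2/16 = (s/2)^2/4 from |t| >= (s/2) sqrt n and exp(-t^2/4). The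
    exponent \<open>powr 1\<close> lets one limit lemma serve both terms.\<close>
  define E where "E = (\<lambda>n. exp (- c * real n powr \<gamma>) + C1 * exp (- (s\<^sup>2 / 16) * real n powr 1))"
  have E: "0 \<le> E n" for n using C1 by (simp add: E_def)
  \<comment> \<open>A single integrand for both ranges: the first summand covers low frequencies,
    the constant E n the high ones.\<close>
  define B where "B = (\<lambda>n t. K * real n powr (- real (Suc r) / 2) * inverse (1 + t\<^sup>2) + E n)"
  have B_nonneg: "0 \<le> B n t" for n t
    unfolding B_def using K E by (intro add_nonneg_nonneg mult_nonneg_nonneg) auto
  have B: "norm (char \<mu> (t / (\<sigma> * sqrt (real n))) ^ n - fourier_stieltjes (edgeworth \<mu> r n) t) \<le> \<bar>t\<bar> * B n t"
    if n: "n > 0" and large: "1 \<le> s / 2 * sqrt (real n)" and t: "\<bar>t\<bar> \<le> real n powr \<rho>" for n t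
  proof (cases "\<bar>t\<bar> \<le> s / 2 * sqrt (real n)")
    case True
    have pos: "0 < 1 + t\<^sup>2" by (simp add: add_pos_nonneg)
    have "norm (char \<mu> (t / (\<sigma> * sqrt (real n))) ^ n - fourier_stieltjes (edgeworth \<mu> r n) t)
      \<le> 2 * exp (- 3 * t\<^sup>2 / 8) * (\<bar>t\<bar> / (s * sqrt (real n))) ^ Suc r"
      by (rule near[OF n True])
    also have "\<dots> = \<bar>t\<bar> * (2 / s ^ Suc r * (\<bar>t\<bar> ^ r * exp (- 3 * t\<^sup>2 / 8)) * (1 / sqrt (real n) ^ Suc r))"
      by (simp add: power_divide power_mult_distrib mult_ac)
    also have "1 / sqrt (real n) ^ Suc r = real n powr (- real (Suc r) / 2)"
      by (rule powr_minus_half[OF n, symmetric])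
    also have "\<bar>t\<bar> * (2 / s ^ Suc r * (\<bar>t\<bar> ^ r * exp (- 3 * t\<^sup>2 / 8)) * real n powr (- real (Suc r) / 2))
       \<le> \<bar>t\<bar> * (2 / s ^ Suc r * (K0 * inverse (1 + t\<^sup>2)) * real n powr (- real (Suc r) / 2))"
    proof (intro mult_left_mono mult_right_mono)
      have "\<bar>t\<bar> ^ r * exp (- 3 * t\<^sup>2 / 8) \<le> K0 / (1 + t\<^sup>2)"
        unfolding pos_le_divide_eq[OF pos] using K0[of t] by (simp add: mult_ac)
      then show "\<bar>t\<bar> ^ r * exp (- 3 * t\<^sup>2 / 8) \<le> K0 * inverse (1 + t\<^sup>2)"
        by (simp only: divide_inverse[of K0])
    qed (use s in auto)
    also have "\<dots> \<le> \<bar>t\<bar> * B n t"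
    proof (rule mult_left_mono)
      have "2 / s ^ Suc r * (K0 * inverse (1 + t\<^sup>2)) * real n powr (- real (Suc r) / 2) = B n t - E n"
        unfolding B_def K_def by (simp only: mult_ac add_diff_cancel_right')
      then show "2 / s ^ Suc r * (K0 * inverse (1 + t\<^sup>2)) * real n powr (- real (Suc r) / 2) \<le> B n t"
        using E[of n] by linarith
    qed simp
    finally show ?thesis .
  next
    case False
    \<comment> \<open>This is what the assumption 1 <= (s/2) sqrt n is for: at high frequencies the
      factor |t| required by Esseen's inequality can be inserted for free.\<close>
    then have t1: "1 \<le> \<bar>t\<bar>" using large by linarith
    have sqrt1: "1 \<le> sqrt (real n)" using n by simp
    have "norm (fourier_stieltjes (edgeworth \<mu> r n) t) \<le> exp (- 3 * t\<^sup>2 / 8) * (\<Sum>k\<le>r. (\<bar>t\<bar> / (s * sqrt (real n))) ^ k)"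
      by (rule E_le[OF n])
    also have "\<dots> \<le> exp (- 3 * t\<^sup>2 / 8) * (\<Sum>k\<le>r. (\<bar>t\<bar> / s) ^ k)"
    proof (intro mult_left_mono sum_mono power_mono)
      have "s * 1 \<le> s * sqrt (real n)" using sqrt1 s by (intro mult_left_mono) auto
      then show "\<bar>t\<bar> / (s * sqrt (real n)) \<le> \<bar>t\<bar> / s" using s by (intro divide_left_mono) auto
    qed (use s in auto)
    \<comment> \<open>The Gaussian is split: exp(-t^2/8) tames the powers of t, giving
      \<open>C1\<close>, and exp(-t^2/4) supplies the decay in n.\<close>
    also have "\<dots> = exp (- (t\<^sup>2) / 4) * (\<Sum>k\<le>r. \<bar>t\<bar> ^ k * exp (- (t\<^sup>2) / 8) / s ^ k)"
    proof -
      have "exp (- 3 * t\<^sup>2 / 8) = exp (- (t\<^sup>2) / 4) * exp (- (t\<^sup>2) / 8)"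
        by (simp add: exp_add[symmetric])
      then show ?thesis
        unfolding sum_distrib_left by (intro sum.cong refl) (simp only: power_divide mult_ac times_divide_eq_right times_divide_eq_left)
    qed
    also have "\<dots> \<le> exp (- (t\<^sup>2) / 4) * C1"
      unfolding C1_def using s by (intro mult_left_mono sum_mono divide_right_mono power_times_exp_le) auto
    also have "\<dots> \<le> exp (- (s\<^sup>2 / 16) * real n powr 1) * C1"
    proof (intro mult_right_mono C1)
      have "(s / 2 * sqrt (real n))\<^sup>2 \<le> \<bar>t\<bar>\<^sup>2" using False s by (intro power_mono) auto
      then have "s\<^sup>2 / 4 * real n \<le> t\<^sup>2" by (simp add: power_mult_distrib power_divide)
      then show "exp (- (t\<^sup>2) / 4) \<le> exp (- (s\<^sup>2 / 16) * real n powr 1)"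
        using n by (simp add: mult.commute)
    qed
    finally have 1: "norm (fourier_stieltjes (edgeworth \<mu> r n) t) \<le> C1 * exp (- (s\<^sup>2 / 16) * real n powr 1)"
      by (simp add: mult.commute)
    have 2: "norm (char \<mu> (t / (\<sigma> * sqrt (real n))) ^ n) \<le> exp (- c * real n powr \<gamma>)"
      using far[OF n _ t] False by simp
    have "norm (char \<mu> (t / (\<sigma> * sqrt (real n))) ^ n - fourier_stieltjes (edgeworth \<mu> r n) t) \<le> E n"
      unfolding E_def by (intro order_trans[OF norm_triangle_ineq4] add_mono 1 2)
    also have "E n \<le> B n t" unfolding B_def using K by simp
    also have "B n t \<le> \<bar>t\<bar> * B n t" using mult_right_mono[OF t1 B_nonneg[of n t]] by simp
    finally show ?thesis .
  qed
  have inv_int: "integrable lborel (\<lambda>t::real. inverse (1 + t\<^sup>2))"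
    using integrable_inverse_1_plus_square by (simp add: set_integrable_def)
  define I0 where "I0 = (LBINT t::real. inverse (1 + t\<^sup>2))"
  have B_int: "set_integrable lborel {-T..T} (B n)" for n T
    unfolding B_def
  proof (intro set_integral_add(1) set_integrable_mult_right)
    show "set_integrable lborel {-T..T} (\<lambda>t::real. inverse (1 + t\<^sup>2))"
      unfolding set_integrable_def using inv_int by (intro integrable_mult_indicator) auto
    show "set_integrable lborel {-T..T} (\<lambda>t::real. E n)"
      by (rule borel_integrable_atLeastAtMost') (rule continuous_on_const)
  qed
  have B_le: "(LBINT t:{-T..T}. B n t) \<le> K * real n powr (- real (Suc r) / 2) * I0 + 2 * T * E n"
    if "T \<ge> 0" for n T
  proof -
    let ?k = "K * real n powr (- real (Suc r) / 2)"
    have "(LBINT t:{-T..T}. B n t) \<le> (LBINT t. ?k * inverse (1 + t\<^sup>2) + indicator {-T..T} t * E n)"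
      unfolding set_lebesgue_integral_def
    proof (rule Bochner_Integration.integral_mono)
      show "integrable lborel (\<lambda>t. indicator {-T..T} t *\<^sub>R B n t)"
        using B_int unfolding set_integrable_def .
      show "integrable lborel (\<lambda>t. ?k * inverse (1 + t\<^sup>2) + indicator {-T..T} t * E n)"
        using inv_int that by (intro Bochner_Integration.integrable_add integrable_mult_right integrable_mult_left
            integrable_real_indicator) auto
      fix t :: real
      have "0 \<le> ?k * inverse (1 + t\<^sup>2)" using K by (intro mult_nonneg_nonneg) auto
      then show "indicator {-T..T} t *\<^sub>R B n t \<le> ?k * inverse (1 + t\<^sup>2) + indicator {-T..T} t * E n"
        by (auto simp: B_def indicator_def)
    qed
    also have "\<dots> = ?k * I0 + 2 * T * E n"
      using inv_int that by (subst Bochner_Integration.integral_add) (auto simp: I0_def)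
    finally show ?thesis .
  qed

  obtain m where m: "m \<ge> 0"
    "\<And>n x. n > 0 \<Longrightarrow> \<bar>std_normal_density x * poly (edgeworth_density_poly (edgeworth_polys \<mu> r) r n) x\<bar> \<le> m"
    using edgeworth_density_bounded[of "edgeworth_polys \<mu> r" r] by blast
  have edgeworth_eq: "edgeworth \<mu> r n = edgeworth_sum (edgeworth_polys \<mu> r) r n" for n
    by (simp add: edgeworth_def[abs_def])
  have lip: "edgeworth \<mu> r n (x + h) \<le> edgeworth \<mu> r n x + m * h" if "n > 0" "0 \<le> h" for n x h
  proof -
    have "edgeworth \<mu> r n (x + h) - m * (x + h) \<le> edgeworth \<mu> r n x - m * x"
    proof (rule DERIV_nonpos_imp_nonincreasing[where f = "\<lambda>y. edgeworth \<mu> r n y - m * y"])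
      fix y
      let ?D = "std_normal_density y * poly (edgeworth_density_poly (edgeworth_polys \<mu> r) r n) y"
      have "((\<lambda>y. edgeworth \<mu> r n y - m * y) has_real_derivative ?D - m) (at y)"
        unfolding edgeworth_eq by (auto intro!: derivative_eq_intros DERIV_edgeworth_sum)
      moreover have "?D - m \<le> 0" using m(2)[OF that(1), of y] by linarith
      ultimately show "\<exists>D. ((\<lambda>y. edgeworth \<mu> r n y - m * y) has_real_derivative D) (at y) \<and> D \<le> 0" by blast
    qed (use that in simp)
    then show ?thesis by (simp add: algebra_simps)
  qed

  obtain C where C: "C \<ge> 0"
    "\<And>N1 f1 N2 f2 (B :: real \<Rightarrow> real) T m x. weighted_line N1 f1 \<Longrightarrow> weighted_line N2 f2 \<Longrightarrow> T > 0 \<Longrightarrow>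
      (\<And>s. \<bar>s\<bar> \<le> T \<Longrightarrow> norm (fourier N1 f1 s - fourier N2 f2 s) \<le> \<bar>s\<bar> * B s) \<Longrightarrow>
      (\<And>s. 0 \<le> B s) \<Longrightarrow> set_integrable lborel {-T..T} B \<Longrightarrow>
      mono (cumulative N1 f1) \<Longrightarrow> m \<ge> 0 \<Longrightarrow>
      (\<And>x s. 0 \<le> s \<Longrightarrow> cumulative N2 f2 (x + s) \<le> cumulative N2 f2 x + m * s) \<Longrightarrow>
      \<bar>cumulative N1 f1 x - cumulative N2 f2 x\<bar> \<le> C * ((LBINT s:{-T..T}. B s) + m / T)"
    using Esseen_smoothing by blast
  let ?F = "\<lambda>n z. prob {\<omega> \<in> space M. (\<Sum>i=1..n. X i \<omega>) / (\<sigma> * sqrt (real n)) \<le> z}"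
  \<comment> \<open>n^R times Esseen's bound with T = n^\<rho>. The outer powers have negative
    exponents, as R < (r+1)/2 and R < \<rho>; the middle terms are powers of n, one factor n^\<rho>
    being the length of [-T,T], against stretched or plain exponentials. Independence of z gives the
    uniformity.\<close>
  define u where "u = (\<lambda>n. C * (K * I0 * real n powr (R - real (Suc r) / 2)
     + 2 * (real n powr (R + \<rho>) * exp (- c * real n powr \<gamma>)
       + C1 * (real n powr (R + \<rho>) * exp (- (s\<^sup>2 / 16) * real n powr 1))) + m * real n powr (R - \<rho>)))"
  have bound: "\<bar>real n powr R * (?F n z - edgeworth \<mu> r n z)\<bar> \<le> u n"
    if n: "n > 0" and large: "1 \<le> s / 2 * sqrt (real n)" for n z
  proof -
    define Y where "Y = (\<lambda>\<omega>. (\<Sum>i=1..n. X i \<omega>) / (\<sigma> * sqrt (real n)))"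
    define T where "T = real n powr \<rho>"
    have T: "T > 0" using n by (simp add: T_def)
    have "X i \<in> borel_measurable M" if "i \<in> {1..n}" for i
      using indep that by (auto simp: indep_vars_def)
    then have Y [measurable]: "Y \<in> borel_measurable M"
      unfolding Y_def by (intro borel_measurable_divide borel_measurable_sum) auto
    let ?g = "\<lambda>y. std_normal_density y * poly (edgeworth_density_poly (edgeworth_polys \<mu> r) r n) y"
    have fourier1: "fourier (distr M borel Y) (\<lambda>_. 1) t = char \<mu> (t / (\<sigma> * sqrt (real n))) ^ n" for t
      unfolding fourier_distr Y_def using char_normalized_sum[OF indep, of \<mu>] law by (simp add: \<mu>_def)
    have fourier2: "fourier lborel ?g = fourier_stieltjes (edgeworth \<mu> r n)"
      unfolding fourier_edgeworth edgeworth_eq ..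
    have cum2: "cumulative lborel ?g = edgeworth \<mu> r n"
      unfolding cumulative_edgeworth edgeworth_eq ..
    have cum1: "cumulative (distr M borel Y) (\<lambda>_. 1) x = ?F n x" for x
      unfolding cumulative_distr[OF Y] by (simp add: Y_def)
    have "\<bar>cumulative (distr M borel Y) (\<lambda>_. 1) z - cumulative lborel ?g z\<bar> \<le> C * ((LBINT t:{-T..T}. B n t) + m / T)"
    proof (rule C(2)[OF weighted_line_distr[OF Y] weighted_line_edgeworth T])
      show "norm (fourier (distr M borel Y) (\<lambda>_. 1) t - fourier lborel ?g t) \<le> \<bar>t\<bar> * B n t" if "\<bar>t\<bar> \<le> T" for t
        unfolding fourier1 fourier2 using B[OF n large] that by (simp add: T_def)
      show "mono (cumulative (distr M borel Y) (\<lambda>_. 1))"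
        unfolding cumulative_distr[OF Y] by (intro monoI finite_measure_mono) auto
      show "cumulative lborel ?g (x + h) \<le> cumulative lborel ?g x + m * h" if "0 \<le> h" for x h
        unfolding cum2 by (rule lip[OF n that])
    qed (use B_nonneg B_int m in auto)
    also have "\<dots> \<le> C * ((K * real n powr (- real (Suc r) / 2) * I0 + 2 * T * E n) + m / T)"
      using C(1) T by (intro mult_left_mono add_right_mono B_le) auto
    finally have "real n powr R * \<bar>?F n z - edgeworth \<mu> r n z\<bar> \<le>
        real n powr R * (C * ((K * real n powr (- real (Suc r) / 2) * I0 + 2 * T * E n) + m / T))"
      unfolding cum1 cum2 by (intro mult_left_mono) auto
    also have "\<dots> = u n"
    proof -
      have 1: "real n powr (R - real (Suc r) / 2) = real n powr R * real n powr (- real (Suc r) / 2)"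
        by (simp only: powr_add[symmetric] minus_divide_left diff_conv_add_uminus)
      have 2: "real n powr (R + \<rho>) = real n powr R * T" by (simp add: T_def powr_add)
      have 3: "real n powr (R - \<rho>) = real n powr R / T" by (simp add: T_def powr_diff)
      show ?thesis unfolding u_def 1 2 3 E_def by (simp only: ring_distribs mult_ac times_divide_eq_right)
    qed
    finally show ?thesis by (simp add: abs_mult)
  qed
  have "u \<longlonglongrightarrow> C * (K * I0 * 0 + 2 * (0 + C1 * 0) + m * 0)"
    unfolding u_def using c s \<gamma> R \<rho>
    by (intro tendsto_intros tendsto_powr_times_exp_neg_powr tendsto_neg_powr filterlim_real_sequentially) auto
  then have u: "u \<longlonglongrightarrow> 0" by simp
  have ev: "\<forall>\<^sub>F n in sequentially. 1 \<le> s / 2 * sqrt (real n)"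
    using s by real_asymp
  show ?thesis
    unfolding \<mu>_def[symmetric] \<sigma>_def[symmetric]
  proof (rule uniform_limitI)
    fix e :: real assume "e > 0"
    then have "\<forall>\<^sub>F n in sequentially. u n < e" using u by (intro order_tendstoD(2)) auto
    then show "\<forall>\<^sub>F n in sequentially. \<forall>z\<in>UNIV. dist (real n powr R * (?F n z - edgeworth \<mu> r n z)) 0 < e"
      using ev eventually_gt_at_top[of 0]
    proof eventually_elim
      case (elim n)
      show ?case using bound[OF elim(3,2)] elim(1) by (auto intro: le_less_trans)
    qed
  qed
qed

end
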